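(* Let $p_1<p_2<\ldots<p_k$ be prime numbers, let $G$ be a finite nilpotent group and let $P_1,P_2,\ldots,P_k$ be its Sylow subgroups, with $|P_i|=p_i^{n_i}$ where $n_i\geq 3$ for all $i\in\{1,2,\ldots,k\}$. (i) Assume that $p_1=2$ and $n_1=3$. If $d^*(P_1)>d^*(D_8)$ and $d^*(P_i)>d^*(M_{p_i^{n_i}})$ for all $i\in\{2,3,\ldots,k\}$, then $G$ is a Dedekind group. (ii) Assume that $n_1\geq 4$ if $p_1=2$, and $n_1\geq 3$ if $p_1$ is odd. If $d^*(P_i)>d^*(M_{p_i^{n_i}})$ for all $i\in\{1,2,\ldots,k\}$, then $G$ is a Dedekind group.
   Context: All groups are finite. For a finite group $G$, $L(G)$ denotes the set (lattice) of all subgroups of $G$, $k'(G)$ the number of conjugacy classes of subgroups of $G$, and $d'(G)=\frac{k'(G)}{|L(G)|}$. A section of $G$ is a quotient $H/K$ with $K\trianglelefteq H\leq G$, and $d^*(G)=\min\{d'(S)\mid S \text{ is a section of } G\}$. A Dedekind group is a group all of whose subgroups are normal. $D_8$ is the dihedral group of order 8. For a prime $p$ and an integer $n$ with $n\geq 4$ if $p=2$ and $n\geq 3$ if $p$ is odd, $M_{p^n}=\langle x,y\mid x^{p^{n-1}}=y^p=1,\ yx=x^{p^{n-2}+1}y\rangle$ (of order $p^n$). The Sylow subgroups listed are all those for the primes dividing $|G|$, so $|G|=\prod_{i=1}^k p_i^{n_i}$. *)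

theory Defs
  imports "HOL-Algebra.Algebra"
begin

section \<open>Subgroups, conjugacy classes of subgroups, sections\<close>

definition subgroups_of :: "('a, 'b) monoid_scheme \<Rightarrow> 'a set set" where
  "subgroups_of G = {H. subgroup H G}"

definition subgroup_classes :: "('a, 'b) monoid_scheme \<Rightarrow> 'a set set set" where
  "subgroup_classes G =
     orbits G (subgroups_of G)
       (\<lambda>g. \<lambda>H \<in> subgroups_of G. g <#\<^bsub>G\<^esub> H #>\<^bsub>G\<^esub> (inv\<^bsub>G\<^esub> g))"

definition d_prime :: "('a, 'b) monoid_scheme \<Rightarrow> real" where
  "d_prime G = real (card (subgroup_classes G)) / real (card (subgroups_of G))"

text \<open>Meaningful for finite groups, where the set of sections is finite and nonempty.\<close>

definition d_star :: "('a, 'b) monoid_scheme \<Rightarrow> real" where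
  "d_star G = Min {d_prime (G\<lparr>carrier := H\<rparr> Mod K) | H K.
                     subgroup H G \<and> K \<lhd> G\<lparr>carrier := H\<rparr>}"


section \<open>Classes of groups\<close>

definition dedekind_group :: "('a, 'b) monoid_scheme \<Rightarrow> bool" where
  "dedekind_group G \<longleftrightarrow> group G \<and> (\<forall>H. subgroup H G \<longrightarrow> H \<lhd> G)"

fun lower_central :: "('a, 'b) monoid_scheme \<Rightarrow> nat \<Rightarrow> 'a set" where
  "lower_central G 0 = carrier G"
| "lower_central G (Suc c) =
     generate G {h \<otimes>\<^bsub>G\<^esub> g \<otimes>\<^bsub>G\<^esub> inv\<^bsub>G\<^esub> h \<otimes>\<^bsub>G\<^esub> inv\<^bsub>G\<^esub> g | h g.
                   h \<in> lower_central G c \<and> g \<in> carrier G}"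

definition nilpotent_group :: "('a, 'b) monoid_scheme \<Rightarrow> bool" where
  "nilpotent_group G \<longleftrightarrow> group G \<and> (\<exists>c. lower_central G c = {\<one>\<^bsub>G\<^esub>})"

definition sylow_subgroup :: "('a, 'b) monoid_scheme \<Rightarrow> nat \<Rightarrow> 'a set \<Rightarrow> bool" where
  "sylow_subgroup G p P \<longleftrightarrow> subgroup P G \<and> card P = p ^ multiplicity p (order G)"


section \<open>Groups given by generators and relations\<close>

text \<open>
  A letter \<open>(x, True)\<close> stands for the generator \<open>x\<close> and \<open>(x, False)\<close> for its formal inverse;
  a relation \<open>(u, v)\<close> stands for the equation \<open>u = v\<close>. All elements of the type \<open>'x\<close> are
  generators.
\<close>

type_synonym 'x gword = "('x \<times> bool) list"

inductive pres_eq :: "('x gword \<times> 'x gword) set \<Rightarrow> 'x gword \<Rightarrow> 'x gword \<Rightarrow> bool"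
  for R where
  rel: "(u, v) \<in> R \<Longrightarrow> pres_eq R u v"
| cancel: "pres_eq R [(x, e), (x, \<not> e)] []"
| refl: "pres_eq R u u"
| sym: "pres_eq R u v \<Longrightarrow> pres_eq R v u"
| trans: "pres_eq R u v \<Longrightarrow> pres_eq R v w \<Longrightarrow> pres_eq R u w"
| append: "pres_eq R u u' \<Longrightarrow> pres_eq R v v' \<Longrightarrow> pres_eq R (u @ v) (u' @ v')"

definition pres_class :: "('x gword \<times> 'x gword) set \<Rightarrow> 'x gword \<Rightarrow> 'x gword set" where
  "pres_class R u = {v. pres_eq R u v}"

definition presented_group :: "('x gword \<times> 'x gword) set \<Rightarrow> 'x gword set monoid" where
  "presented_group R =
     \<lparr>carrier = range (pres_class R),
      monoid.mult = (\<lambda>A B. {w. \<exists>u\<in>A. \<exists>v\<in>B. pres_eq R (u @ v) w}),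
      one = pres_class R []\<rparr>"

lemma pres_class_eq_iff: "pres_class R u = pres_class R v \<longleftrightarrow> pres_eq R u v"
  unfolding pres_class_def
  by (auto intro: pres_eq.refl pres_eq.sym pres_eq.trans)

lemma presented_group_mult:
  "pres_class R u \<otimes>\<^bsub>presented_group R\<^esub> pres_class R v = pres_class R (u @ v)"
proof -
  have "pres_eq R (u @ v) w" if "pres_eq R u u'" "pres_eq R v v'" "pres_eq R (u' @ v') w" for u' v' w
    using that pres_eq.append pres_eq.trans by metis
  then show ?thesis
    unfolding presented_group_def pres_class_def
    by (auto intro: pres_eq.refl)
qed

lemma group_presented_group: "group (presented_group R)"
proof (rule groupI)
  note car = presented_group_def[of R, THEN arg_cong[where f = carrier], simplified]
  note un = presented_group_def[of R, THEN arg_cong[where f = one], simplified]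
  show "\<one>\<^bsub>presented_group R\<^esub> \<in> carrier (presented_group R)"
    by (simp add: car un)
  show "a \<otimes>\<^bsub>presented_group R\<^esub> b \<in> carrier (presented_group R)"
    if "a \<in> carrier (presented_group R)" "b \<in> carrier (presented_group R)" for a b
    using that by (auto simp: car presented_group_mult)
  show "a \<otimes>\<^bsub>presented_group R\<^esub> b \<otimes>\<^bsub>presented_group R\<^esub> c
      = a \<otimes>\<^bsub>presented_group R\<^esub> (b \<otimes>\<^bsub>presented_group R\<^esub> c)"
    if "a \<in> carrier (presented_group R)" "b \<in> carrier (presented_group R)"
       "c \<in> carrier (presented_group R)" for a b c
    using that by (auto simp: car presented_group_mult)
  show "\<one>\<^bsub>presented_group R\<^esub> \<otimes>\<^bsub>presented_group R\<^esub> a = a"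
    if "a \<in> carrier (presented_group R)" for a
    using that by (auto simp: car un presented_group_mult)
  show "\<exists>b\<in>carrier (presented_group R). b \<otimes>\<^bsub>presented_group R\<^esub> a = \<one>\<^bsub>presented_group R\<^esub>"
    if a: "a \<in> carrier (presented_group R)" for a
  proof -
    have "\<exists>v. pres_eq R (v @ u) []" for u
    proof (induction u)
      case Nil
      show ?case using pres_eq.refl[of R "[]"] by (metis append_Nil)
    next
      case (Cons l u)
      obtain x e where l: "l = (x, e)" by (cases l)
      obtain v where v: "pres_eq R (v @ u) []" using Cons.IH by blast
      have "pres_eq R ([(x, \<not> e), (x, e)] @ u) ([] @ u)"
        using pres_eq.append[OF pres_eq.cancel[of R x "\<not> e"] pres_eq.refl[of R u]] by simp
      then have "pres_eq R (v @ [(x, \<not> e), (x, e)] @ u) (v @ u)"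
        using pres_eq.append[OF pres_eq.refl[of R v]] by simp
      then have "pres_eq R ((v @ [(x, \<not> e)]) @ l # u) []"
        using v pres_eq.trans l by fastforce
      then show ?case by blast
    qed
    then show ?thesis
      using a by (fastforce simp: car un presented_group_mult pres_class_eq_iff)
  qed
qed

datatype two_gens = GX | GY

abbreviation wx :: "two_gens gword" where "wx \<equiv> [(GX, True)]"
abbreviation wx_inv :: "two_gens gword" where "wx_inv \<equiv> [(GX, False)]"
abbreviation wy :: "two_gens gword" where "wy \<equiv> [(GY, True)]"

abbreviation wpow :: "'x gword \<Rightarrow> nat \<Rightarrow> 'x gword" where
  "wpow w m \<equiv> concat (replicate m w)"

text \<open>The group \<open>\<langle>x, y | x\<^sup>4 = y\<^sup>2 = 1, y x y = x\<^sup>-\<^sup>1\<rangle>\<close>.\<close>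

definition D8 :: "two_gens gword set monoid" where
  "D8 = presented_group
          {(wpow wx 4, []), (wpow wy 2, []), (wy @ wx @ wy, wx_inv)}"

text \<open>The group of order \<open>p ^ n\<close> usually written \<open>M\<close> with index \<open>p ^ n\<close>; intended for \<open>p\<close> prime,
  with \<open>n \<ge> 4\<close> if \<open>p = 2\<close> and \<open>n \<ge> 3\<close> if \<open>p\<close> is odd.\<close>

definition M_group :: "nat \<Rightarrow> nat \<Rightarrow> two_gens gword set monoid" where
  "M_group p n = presented_group
          {(wpow wx (p ^ (n - 1)), []), (wpow wy p, []),
           (wy @ wx, wpow wx (p ^ (n - 2) + 1) @ wy)}"

end

theory Submission
  imports Defs "HOL-Number_Theory.Residues"
begin

text \<open>
  Put \<open>T = (n - 1)(p + 1) + 2\<close>. A non-Dedekind group of order \<open>p\<^sup>n\<close> has a section \<open>S\<close> that is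
  non-Dedekind while all proper sections of \<open>S\<close> are Dedekind. Such an \<open>S\<close> is generated by elements
  \<open>x\<close>, \<open>y\<close> with \<open>y\<close> of order \<open>p\<close> and \<open>[x, y]\<close> generating a central subgroup \<open>N\<close> of order \<open>p\<close> that lies
  in every nontrivial normal subgroup. The overgroups of \<open>N\<close> are the subgroups of
  \<open>S / N = \<langle>x N\<rangle> \<times> \<langle>y N\<rangle>\<close>, so \<open>S\<close> has at most \<open>T - p\<close> normal subgroups; every class of nonnormal
  subgroups has at least \<open>p\<close> members, and hence \<open>d'(S) \<le> 1 - (p - 1) / T\<close>. The presented group \<open>M\<close> is
  either abelian or of the same shape with at least \<open>T - p\<close> normal and at most \<open>p\<close> nonnormal
  subgroups, and its other sections are abelian, so \<open>d*(M) \<ge> 1 - (p - 1) / T\<close>; no model of the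
  presentation is needed. The dihedral group satisfies the relations of \<open>M\<close> for \<open>p = 2\<close>, \<open>n = 3\<close>, and
  there the same count gives \<open>4 / 5\<close> on both sides. Finally, a nilpotent group with Dedekind Sylow
  subgroups is Dedekind.
\<close>

text \<open>\<open>T\<close> is the number of subgroups of the genuine modular group: the product of
  cyclic groups of orders \<open>p ^ r\<close> and \<open>p\<close> has \<open>r(p + 1) + 2\<close>
  subgroups, here \<open>r = n - 2\<close>, and the trivial subgroup together with one class of
  \<open>p\<close> nonnormal subgroups brings the total to
  \<open>(n - 2)(p + 1) + 3 + p = T\<close>. So the extremal ratio is \<open>T - p + 1\<close>
  classes to \<open>T\<close> subgroups. For a minimal section the order enters only through
  \<open>r \<le> n - 2\<close>, which comes from counting normal forms. Upper and lower bound meet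
  at the same number, so no value of \<open>d_star\<close> is ever computed. The pair
  \<open>p = 2\<close>, \<open>n = 3\<close> is exceptional because the \<open>p\<close>-th power of
  a product of powers of \<open>x\<close> and \<open>y\<close> involves the binomial coefficient
  \<open>p(p - 1) / 2\<close>, which \<open>p\<close> divides only when \<open>p\<close> is odd; for
  \<open>p = 2\<close> a factor \<open>p ^ (n - 3)\<close> makes up for this unless
  \<open>n = 3\<close>. The dihedral group then has four nonnormal subgroups in two classes, hence
  \<open>8 / 10\<close> instead of \<open>7 / 8\<close>.\<close>

section \<open>Ideals of exponents and integer powers\<close>

text \<open>A nonempty set of integers closed under differences is a principal ideal, and here its
  generator divides \<open>p ^ n\<close>. Applied to the exponents \<open>a\<close> with
  \<open>x [^] a\<close> in a given subgroup, this measures how that subgroup meets the powers of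
  \<open>x\<close>.\<close>

lemma int_ideal_prime_power:
  fixes I :: "int set" and p n :: nat
  assumes p: "Factorial_Ring.prime p" and diff: "\<And>a b. a \<in> I \<Longrightarrow> b \<in> I \<Longrightarrow> a - b \<in> I"
    and pn: "int p ^ n \<in> I"
  obtains j where "j \<le> n" "\<And>a. a \<in> I \<longleftrightarrow> int p ^ j dvd a"
proof -
  have z: "0 \<in> I" using diff[OF pn pn] by simp
  have neg: "- a \<in> I" if "a \<in> I" for a using diff[OF z that] by simp
  have add: "a + b \<in> I" if "a \<in> I" "b \<in> I" for a b using diff[OF that(1) neg[OF that(2)]] by simp
  have mulnat: "int k * a \<in> I" if "a \<in> I" for k a
    by (induction k) (auto simp: z algebra_simps intro: add that)
  have mul: "k * a \<in> I" if "a \<in> I" for k a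
    by (cases k rule: int_cases2) (use that mulnat neg in \<open>auto simp flip: minus_mult_left\<close>)
  define d where "d = (LEAST d. d > 0 \<and> int d \<in> I)"
  have "p ^ n > 0 \<and> int (p ^ n) \<in> I" using pn prime_gt_0_nat[OF p] by simp
  then have d: "d > 0" "int d \<in> I" and dmin: "\<And>e. e > 0 \<Longrightarrow> int e \<in> I \<Longrightarrow> d \<le> e"
    using LeastI[of "\<lambda>d. d > 0 \<and> int d \<in> I" "p ^ n"] Least_le[of "\<lambda>d. d > 0 \<and> int d \<in> I"]
    unfolding d_def by blast+
  have iff: "a \<in> I \<longleftrightarrow> int d dvd a" for a
  proof
    assume "a \<in> I"
    then have "a mod int d \<in> I"
      using diff[OF _ mul[OF d(2)], of a "a div int d"] by (simp add: minus_div_mult_eq_mod)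
    moreover have "0 \<le> a mod int d" "a mod int d < int d" using d(1) by simp_all
    ultimately have "a mod int d = 0" using dmin[of "nat (a mod int d)"] by (cases "a mod int d = 0") auto
    then show "int d dvd a" by presburger
  next
    assume "int d dvd a"
    then show "a \<in> I" using mul[OF d(2)] by (metis dvd_def mult.commute)
  qed
  have "d dvd p ^ n" using iff pn by (metis int_dvd_int_iff of_nat_power)
  then obtain j where "j \<le> n" "d = p ^ j" using divides_primepow_nat[OF p] by blast
  then show thesis using that iff by simp
qed

lemma int_inverse_mod_prime:
  fixes b :: int
  assumes "Factorial_Ring.prime p" "\<not> int p dvd b"
  obtains t where "int p dvd t * b - 1"
proof -
  have "coprime (int p) b" using assms by (simp add: prime_imp_coprime)
  then obtain u v where "u * int p + v * b = 1" by (metis bezout_int coprime_imp_gcd_eq_1)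
  then have "v * b - 1 = int p * (- u)" by (simp add: algebra_simps)
  then show thesis using that by (metis dvd_triv_left)
qed

context group
begin

lemma conj_int_pow:
  fixes c :: int
  assumes "g \<in> carrier G" "h \<in> carrier G"
  shows "g \<otimes> h [^] c \<otimes> inv g = (g \<otimes> h \<otimes> inv g) [^] c"
proof -
  have "(\<lambda>h. g \<otimes> h \<otimes> inv g) \<in> hom G G"
  proof (rule homI)
    fix a b assume ab: "a \<in> carrier G" "b \<in> carrier G"
    have "inv g \<otimes> (g \<otimes> w) = w" if "w \<in> carrier G" for w
      using that assms(1) by (simp flip: m_assoc)
    then show "g \<otimes> (a \<otimes> b) \<otimes> inv g = g \<otimes> a \<otimes> inv g \<otimes> (g \<otimes> b \<otimes> inv g)"
      using ab assms(1) by (simp add: m_assoc)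
  qed (use assms(1) in auto)
  then show ?thesis using hom_int_pow[of _ G G h c] assms is_group by blast
qed

lemma commute_int_pow:
  fixes c :: int
  assumes "g \<in> carrier G" "h \<in> carrier G" "g \<otimes> h = h \<otimes> g"
  shows "g \<otimes> h [^] c = h [^] c \<otimes> g"
proof -
  have "g \<otimes> h \<otimes> inv g = h" using assms by (simp add: m_assoc)
  then have "g \<otimes> h [^] c \<otimes> inv g = h [^] c" using conj_int_pow[of g h c] assms by simp
  then show ?thesis using assms by (metis int_pow_closed inv_solve_right' m_closed)
qed

lemma int_pow_zero_dvd:
  assumes "g \<in> carrier G" "g [^] (p::nat) = \<one>" "int p dvd c"
  shows "g [^] (c::int) = \<one>"
proof -
  obtain k where "c = int p * k" using assms(3) by (elim dvdE)
  then show ?thesis using assms by (metis int_pow_int int_pow_one int_pow_pow)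
qed

lemma prime_order_int_pow_iff:
  assumes "Factorial_Ring.prime p" "g \<in> carrier G" "g [^] (p::nat) = \<one>" "g \<noteq> \<one>"
  shows "g [^] (c::int) = \<one> \<longleftrightarrow> int p dvd c"
proof -
  have "ord g dvd p" using assms by (simp add: pow_eq_id)
  moreover have "ord g \<noteq> 1" using assms ord_eq_1 by simp
  ultimately have "ord g = p" using assms(1) by (meson prime_nat_iff)
  then show ?thesis using int_pow_eq_id assms by simp
qed

end

section \<open>Two-generator groups with central commutator\<close>

text \<open>Orders of elements are left open, so that the presented group, whose size is unknown, is
  an instance as well as the minimal section.\<close>

locale commutator_triple = group G for G (structure) +
  fixes x y z
  assumes xC [simp, intro]: "x \<in> carrier G" and yC [simp, intro]: "y \<in> carrier G"
    and zC [simp, intro]: "z \<in> carrier G"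
    and z_central: "\<And>g. g \<in> carrier G \<Longrightarrow> g \<otimes> z = z \<otimes> g"
    and yx: "y \<otimes> x = x \<otimes> y \<otimes> z"
    and gen: "carrier G = generate G {x, y}"
begin

definition nf :: "int \<Rightarrow> int \<Rightarrow> int \<Rightarrow> 'a" where
  "nf a b c = x [^] a \<otimes> y [^] b \<otimes> z [^] c"

lemma nf_closed [simp, intro]: "nf a b c \<in> carrier G"
  by (simp add: nf_def)

lemma zpow_central: "g \<in> carrier G \<Longrightarrow> g \<otimes> z [^] (c::int) = z [^] c \<otimes> g"
  by (intro commute_int_pow z_central) auto

text \<open>Conjugation by \<open>y\<close> multiplies \<open>x\<close> by the central
  \<open>z\<close>, hence \<open>x [^] a\<close> by \<open>z [^] a\<close>. Read as conjugation of
  \<open>y\<close> by the inverse of \<open>x [^] a\<close>, this extends to \<open>y [^] b\<close>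
  in the same way, without a case split on signs.\<close>

lemma ypow_xpow: "y [^] (b::int) \<otimes> x [^] (a::int) = x [^] a \<otimes> y [^] b \<otimes> z [^] (a * b)"
proof -
  have "y \<otimes> x \<otimes> inv y = x \<otimes> z"
    by (simp add: yx m_assoc z_central)
  then have "y \<otimes> x [^] a \<otimes> inv y = x [^] a \<otimes> z [^] a"
    using conj_int_pow[of y x a] int_pow_mult_distrib[of x z a] z_central[of x] by simp
  then have "y \<otimes> x [^] a = x [^] a \<otimes> z [^] a \<otimes> y"
    by (metis int_pow_closed inv_solve_right' m_closed xC yC zC)
  then have "inv (x [^] a) \<otimes> y \<otimes> inv (inv (x [^] a)) = y \<otimes> z [^] a"
  proof -
    assume *: "y \<otimes> x [^] a = x [^] a \<otimes> z [^] a \<otimes> y"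
    have "inv (x [^] a) \<otimes> y \<otimes> inv (inv (x [^] a)) = inv (x [^] a) \<otimes> (y \<otimes> x [^] a)"
      by (simp add: m_assoc)
    also have "\<dots> = (inv (x [^] a) \<otimes> x [^] a) \<otimes> (z [^] a \<otimes> y)"
      unfolding * by (simp only: m_assoc inv_closed int_pow_closed m_closed xC yC zC)
    also have "\<dots> = y \<otimes> z [^] a" by (simp add: zpow_central)
    finally show ?thesis .
  qed
  then have "inv (x [^] a) \<otimes> y [^] b \<otimes> inv (inv (x [^] a)) = y [^] b \<otimes> z [^] (a * b)"
    using conj_int_pow[of "inv (x [^] a)" y b] 
    by (simp add: int_pow_mult_distrib zpow_central int_pow_pow)
  then have "y [^] b \<otimes> x [^] a = x [^] a \<otimes> (y [^] b \<otimes> z [^] (a * b))"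
    by (simp add: m_assoc inv_solve_left')
  then show ?thesis by (simp add: m_assoc)
qed

lemma nf_mult: "nf a b c \<otimes> nf a' b' c' = nf (a + a') (b + b') (c + c' + a' * b)"
proof -
  have "nf a b c \<otimes> nf a' b' c' = x [^] a \<otimes> (y [^] b \<otimes> (z [^] c \<otimes> x [^] a')) \<otimes> y [^] b' \<otimes> z [^] c'"
    by (simp add: nf_def m_assoc)
  also have "z [^] c \<otimes> x [^] a' = x [^] a' \<otimes> z [^] c" by (simp add: zpow_central)
  also have "y [^] b \<otimes> (x [^] a' \<otimes> z [^] c) = y [^] b \<otimes> x [^] a' \<otimes> z [^] c" by (simp add: m_assoc)
  also have "\<dots> = x [^] a' \<otimes> y [^] b \<otimes> (z [^] (a' * b) \<otimes> z [^] c)" by (simp add: ypow_xpow m_assoc)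
  also have "z [^] (a' * b) \<otimes> z [^] c = z [^] (a' * b + c)" by (simp add: int_pow_mult)
  also have "x [^] a \<otimes> (x [^] a' \<otimes> y [^] b \<otimes> z [^] (a' * b + c)) \<otimes> y [^] b' \<otimes> z [^] c'
     = (x [^] a \<otimes> x [^] a') \<otimes> (y [^] b \<otimes> (z [^] (a' * b + c) \<otimes> y [^] b')) \<otimes> z [^] c'"
    by (simp add: m_assoc)
  also have "z [^] (a' * b + c) \<otimes> y [^] b' = y [^] b' \<otimes> z [^] (a' * b + c)" by (simp add: zpow_central)
  also have "x [^] a \<otimes> x [^] a' \<otimes> (y [^] b \<otimes> (y [^] b' \<otimes> z [^] (a' * b + c))) \<otimes> z [^] c'
     = (x [^] a \<otimes> x [^] a') \<otimes> (y [^] b \<otimes> y [^] b') \<otimes> (z [^] (a' * b + c) \<otimes> z [^] c')"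
    by (simp add: m_assoc)
  also have "\<dots> = nf (a + a') (b + b') (c + c' + a' * b)"
    by (simp add: nf_def add_ac flip: int_pow_mult)
  finally show ?thesis .
qed

lemma nf_zero: "nf 0 0 0 = \<one>" and nf_x: "nf 1 0 0 = x" and nf_y: "nf 0 1 0 = y"
  and nf_z: "nf 0 0 1 = z"
  by (simp_all add: nf_def)

lemma nf_xpow: "nf a 0 0 = x [^] a" and nf_ypow: "nf 0 b 0 = y [^] b" and nf_zpow: "nf 0 0 c = z [^] c"
  by (simp_all add: nf_def)

lemma nf_inv: "inv (nf a b c) = nf (- a) (- b) (a * b - c)"
  by (rule inv_equality) (simp_all add: nf_mult nf_zero)

lemma nf_cases:
  assumes "g \<in> carrier G"
  obtains a b c where "g = nf a b c"
proof -
  let ?N = "{nf a b c | a b c. True}"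
  have "subgroup ?N G"
  proof
    show "\<one> \<in> ?N"
      by (rule CollectI) (metis nf_zero)
    show "g \<otimes> h \<in> ?N" if "g \<in> ?N" "h \<in> ?N" for g h
      using that nf_mult by blast
    show "inv g \<in> ?N" if "g \<in> ?N" for g
      using that nf_inv by blast
  qed auto
  moreover have "{x, y} \<subseteq> ?N"
    by (auto, metis nf_x, metis nf_y)
  ultimately have "carrier G \<subseteq> ?N"
    unfolding gen using generate_subgroup_incl by blast
  then show thesis using assms that by auto
qed

text \<open>Up to sign, the exponent of the commutator is the determinant of the two pairs
  \<open>(a, b)\<close>. Questions about commuting thus become congruences for this
  determinant.\<close>

lemma commute_nf: "nf a b c \<otimes> nf a' b' c' = nf a' b' c' \<otimes> nf a b c \<otimes> z [^] (a' * b - a * b')"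
  unfolding nf_zpow[symmetric] nf_mult by (simp add: algebra_simps)

lemma nf_conj: "nf a b c \<otimes> nf a' b' c' \<otimes> inv (nf a b c) = nf a' b' (c' + a' * b - a * b')"
  unfolding nf_inv nf_mult by (simp add: algebra_simps)

text \<open>Each power of \<open>y\<close> has to pass all later powers of \<open>x\<close>, which
  accounts for the binomial coefficient. Its residue at \<open>k = p\<close> is what separates
  \<open>p = 2\<close> from the odd primes.\<close>

lemma nf_nat_pow: "nf a b 0 [^] (k::nat) = nf (int k * a) (int k * b) (a * b * (int k * (int k - 1) div 2))"
proof (induction k)
  case 0
  then show ?case by (simp add: nf_zero)
next
  case (Suc k)
  have "even (int k * (int k - 1))" by simp
  then obtain t where t: "int k * (int k - 1) = 2 * t" by blast
  then have t': "int (Suc k) * (int (Suc k) - 1) = 2 * (t + int k)" by (simp add: algebra_simps)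
  have d: "int k * (int k - 1) div 2 = t" "int (Suc k) * (int (Suc k) - 1) div 2 = t + int k"
    unfolding t t' by simp_all
  show ?case unfolding nat_pow_Suc Suc.IH d by (simp add: nf_mult algebra_simps)
qed

text \<open>Conjugation alters an element only by a power of \<open>z\<close>. Consequently a
  nonnormal subgroup misses \<open>z\<close>.\<close>

lemma normal_if_z:
  assumes "subgroup B G" "z \<in> B"
  shows "B \<lhd> G"
proof -
  have zB: "z [^] (c::int) \<in> B" for c by (rule subgroup_int_pow_closed[OF assms])
  have "g \<otimes> h \<otimes> inv g \<in> B" if g: "g \<in> carrier G" and h: "h \<in> B" for g h
  proof -
    obtain a b c where gn: "g = nf a b c" using nf_cases[OF g] .
    obtain a' b' c' where hn: "h = nf a' b' c'" using nf_cases h assms(1) subgroup.mem_carrier by metis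
    have "g \<otimes> h \<otimes> inv g = h \<otimes> z [^] (a' * b - a * b')"
      by (simp only: gn hn nf_conj) (simp only: nf_zpow[symmetric] nf_mult, simp add: algebra_simps)
    then show ?thesis using h zB assms(1) by (simp add: subgroup.m_closed)
  qed
  then show ?thesis using normal_inv_iff assms(1) by blast
qed

end

section \<open>Counting the subgroups that contain the commutator\<close>

text \<open>\<open>x_z\<close> gives \<open>x\<close> the order \<open>p ^ r\<close> modulo the
  powers of \<open>z\<close>; it covers the case where \<open>z\<close> is a power of
  \<open>x\<close> as well as the case where it is not.\<close>

locale class2_pgroup = commutator_triple G x y z for G (structure) and x y z +
  fixes p r :: nat
  assumes prime_p: "Factorial_Ring.prime p"
    and yp: "y [^] p = \<one>" and zp: "z [^] p = \<one>" and z_ne: "z \<noteq> \<one>"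
    and x_z: "\<And>a::int. x [^] a \<in> range (\<lambda>c::int. z [^] c) \<longleftrightarrow> int p ^ r dvd a"
begin

lemma p_gt_1: "p > 1"
  using prime_p by (rule prime_gt_1_nat)

lemma zpow_eq_one_iff: "z [^] (c::int) = \<one> \<longleftrightarrow> int p dvd c"
  by (rule prime_order_int_pow_iff[OF prime_p zC zp z_ne])

text \<open>Commuting with \<open>x\<close> reads off \<open>z [^] b\<close>, so \<open>p\<close>
  divides \<open>b\<close>. Then \<open>y\<close> drops out and \<open>x_z\<close> applies to what
  remains.\<close>

lemma nf_eq_oneD:
  assumes "nf a b c = \<one>"
  shows "int p ^ r dvd a" "int p dvd b"
proof -
  have "\<one> \<otimes> nf 1 0 0 = nf 1 0 0 \<otimes> \<one> \<otimes> z [^] b"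
    using commute_nf[of a b c 1 0 0] assms by simp
  then have "x \<otimes> z [^] b = x" by (simp add: nf_x)
  then show pb: "int p dvd b" using zpow_eq_one_iff by simp
  have "y [^] b = \<one>" by (rule int_pow_zero_dvd[OF yC yp pb])
  then have "x [^] a \<otimes> z [^] c = \<one>" using assms by (simp add: nf_def)
  then have "x [^] a = z [^] (- c)"
    by (metis int_pow_neg inv_equality int_pow_closed inv_inv xC zC)
  then show "int p ^ r dvd a" using x_z by blast
qed

lemma nf_eqD:
  assumes "nf a b c = nf a' b' c'"
  shows "int p ^ r dvd a - a'" "int p dvd b - b'"
proof -
  have "nf a b c \<otimes> inv (nf a' b' c') = \<one>" using assms by simp
  then have "nf (a - a') (b - b') (c + (a' * b' - c') - a' * b) = \<one>"
    unfolding nf_inv nf_mult by simp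
  then show "int p ^ r dvd a - a'" "int p dvd b - b'" using nf_eq_oneD by blast+
qed

lemma nf_mem_iff:
  assumes "subgroup B G" "z \<in> B"
  shows "nf a b c \<in> B \<longleftrightarrow> nf a b 0 \<in> B"
proof -
  have zB: "z [^] (c::int) \<in> B" for c by (rule subgroup_int_pow_closed[OF assms])
  have "nf a b c = nf a b 0 \<otimes> z [^] c" "nf a b 0 = nf a b c \<otimes> z [^] (- c)"
    unfolding nf_zpow[symmetric] nf_mult by simp_all
  then show ?thesis using zB subgroup.m_closed[OF assms(1)] by metis
qed

text \<open>Modulo \<open>z\<close>, this is the subgroup generated by
  \<open>x [^] (p ^ j)\<close>.\<close>

definition rect :: "nat \<Rightarrow> 'a set" where
  "rect j = {nf a b c | a b c. int p ^ j dvd a \<and> int p dvd b}"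

text \<open>Modulo \<open>z\<close>, this is the subgroup generated by \<open>x [^] (p ^ j)\<close>
  and \<open>x [^] s \<otimes> y\<close>: the pairs \<open>(a, b)\<close> run through the lattice
  spanned by \<open>(p ^ j, 0)\<close> and \<open>(s, 1)\<close>.\<close>

definition slant :: "nat \<Rightarrow> int \<Rightarrow> 'a set" where
  "slant j s = {nf a b c | a b c. int p ^ j dvd a - s * b}"

lemma nf_in_rect_iff:
  assumes "j \<le> r"
  shows "nf a b c \<in> rect j \<longleftrightarrow> int p ^ j dvd a \<and> int p dvd b"
proof
  assume "nf a b c \<in> rect j"
  then obtain a' b' c' where e: "nf a b c = nf a' b' c'" and d: "int p ^ j dvd a'" "int p dvd b'"
    unfolding rect_def by blast
  have "int p ^ j dvd a - a'" using nf_eqD(1)[OF e] assms power_le_dvd by blast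
  then show "int p ^ j dvd a \<and> int p dvd b"
    using d nf_eqD(2)[OF e] by (metis diff_add_cancel dvd_add)
qed (auto simp: rect_def)

text \<open>The exponents \<open>a\<close> and \<open>b\<close> are determined only modulo
  \<open>p ^ r\<close> and \<open>p\<close>. The two hypotheses make the congruence invariant under
  these changes.\<close>

lemma nf_in_slant_iff:
  assumes "j \<le> r" "int p ^ j dvd int p * s"
  shows "nf a b c \<in> slant j s \<longleftrightarrow> int p ^ j dvd a - s * b"
proof
  assume "nf a b c \<in> slant j s"
  then obtain a' b' c' where e: "nf a b c = nf a' b' c'" and d: "int p ^ j dvd a' - s * b'"
    unfolding slant_def by blast
  have 1: "int p ^ j dvd a - a'" using nf_eqD(1)[OF e] assms power_le_dvd by blast
  obtain k where "b - b' = int p * k" using nf_eqD(2)[OF e] by (elim dvdE)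
  then have "s * (b - b') = int p * s * k" by simp
  then have 2: "int p ^ j dvd s * (b - b')" using assms(2) by (simp only: dvd_mult2)
  have "a - s * b = (a - a') + (a' - s * b') - s * (b - b')" by (simp add: algebra_simps)
  then show "int p ^ j dvd a - s * b" using 1 2 d by (metis dvd_add dvd_diff)
qed (auto simp: slant_def)

lemma subgroup_rect: "subgroup (rect j) G"
proof
  show "\<one> \<in> rect j" unfolding rect_def by (rule CollectI) (metis nf_zero dvd_0_right)
  show "g \<otimes> h \<in> rect j" if gh: "g \<in> rect j" "h \<in> rect j" for g h
  proof -
    obtain a b c a' b' c' where "g = nf a b c" "h = nf a' b' c'"
      and "int p ^ j dvd a" "int p dvd b" "int p ^ j dvd a'" "int p dvd b'"
      using gh unfolding rect_def by blast
    then have "g \<otimes> h = nf (a + a') (b + b') (c + c' + a' * b)" "int p ^ j dvd a + a'" "int p dvd b + b'"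
      by (simp_all add: nf_mult)
    then show ?thesis unfolding rect_def by blast
  qed
  show "inv g \<in> rect j" if g: "g \<in> rect j" for g
  proof -
    obtain a b c where "g = nf a b c" "int p ^ j dvd a" "int p dvd b"
      using g unfolding rect_def by blast
    then have "inv g = nf (- a) (- b) (a * b - c)" "int p ^ j dvd - a" "int p dvd - b"
      by (simp_all add: nf_inv)
    then show ?thesis unfolding rect_def by blast
  qed
qed (auto simp: rect_def)

lemma subgroup_slant: "subgroup (slant j s) G"
proof
  show "\<one> \<in> slant j s" unfolding slant_def
    by (rule CollectI) (metis nf_zero dvd_0_right mult_zero_right diff_zero)
  show "g \<otimes> h \<in> slant j s" if gh: "g \<in> slant j s" "h \<in> slant j s" for g h
  proof -
    obtain a b c a' b' c' where e: "g = nf a b c" "h = nf a' b' c'"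
      and d: "int p ^ j dvd a - s * b" "int p ^ j dvd a' - s * b'"
      using gh unfolding slant_def by blast
    have "(a + a') - s * (b + b') = (a - s * b) + (a' - s * b')" by (simp add: algebra_simps)
    then have "int p ^ j dvd (a + a') - s * (b + b')" using d by (metis dvd_add)
    moreover have "g \<otimes> h = nf (a + a') (b + b') (c + c' + a' * b)" using e by (simp add: nf_mult)
    ultimately show ?thesis unfolding slant_def by blast
  qed
  show "inv g \<in> slant j s" if g: "g \<in> slant j s" for g
  proof -
    obtain a b c where e: "g = nf a b c" and d: "int p ^ j dvd a - s * b"
      using g unfolding slant_def by blast
    have "- a - s * (- b) = - (a - s * b)" by simp
    then have "int p ^ j dvd - a - s * (- b)" using d by (simp only: dvd_minus_iff)
    moreover have "inv g = nf (- a) (- b) (a * b - c)" using e by (simp add: nf_inv)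
    ultimately show ?thesis unfolding slant_def by blast
  qed
qed (auto simp: slant_def)

lemma z_in_rect: "z \<in> rect j" and z_in_slant: "z \<in> slant j s"
  unfolding rect_def slant_def by (rule CollectI, metis nf_z dvd_0_right mult_zero_right diff_zero)+

text \<open>If all \<open>y\<close> exponents in \<open>B\<close> vanish modulo \<open>p\<close>,
  only powers of \<open>x\<close> and \<open>z\<close> are left. Otherwise \<open>B\<close> contains
  some \<open>x [^] s \<otimes> y\<close>, and this element together with the level \<open>j\<close>
  at which \<open>B\<close> meets the powers of \<open>x\<close> determines
  \<open>B\<close>.\<close>

lemma overgroup_cases:
  assumes B: "subgroup B G" "z \<in> B"
  obtains (rect) j where "j \<le> r" "B = rect j"
  | (whole) "B = carrier G"
  | (slant) j i where "1 \<le> j" "j \<le> r" "i < p" "B = slant j (int p ^ (j - 1) * int i)"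
proof -
  note memB = nf_mem_iff[OF B]
  have mB: "nf (a + a') (b + b') 0 \<in> B" if "nf a b 0 \<in> B" "nf a' b' 0 \<in> B" for a b a' b'
    using subgroup.m_closed[OF B(1) that] unfolding nf_mult using memB by blast
  have iB: "nf (- a) (- b) 0 \<in> B" if "nf a b 0 \<in> B" for a b
    using subgroup.m_inv_closed[OF B(1) that] unfolding nf_inv using memB by blast
  have kn: "nf (int k * a) (int k * b) 0 \<in> B" if "nf a b 0 \<in> B" for k a b
  proof (induction k)
    case 0
    show ?case using B(1) by (simp add: nf_zero subgroup.one_closed)
  next
    case (Suc k)
    show ?case using mB[OF Suc that] by (simp add: algebra_simps)
  qed
  have kB: "nf (k * a) (k * b) 0 \<in> B" if "nf a b 0 \<in> B" for k a b
    by (cases k rule: int_cases2) (use kn[OF that] iB[OF kn[OF that]] in \<open>auto\<close>)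
  have dB: "nf (a - a') (b - b') 0 \<in> B" if "nf a b 0 \<in> B" "nf a' b' 0 \<in> B" for a b a' b'
    using mB[OF that(1) iB[OF that(2)]] by simp
  have yB: "nf 0 b 0 \<in> B" if "int p dvd b" for b
    using int_pow_zero_dvd[OF yC yp that] B(1) by (simp add: nf_ypow subgroup.one_closed)
  have "x [^] (int p ^ r) \<in> B"
    using x_z[of "int p ^ r"] subgroup_int_pow_closed[OF B] by auto
  then have pr: "int p ^ r \<in> {a. nf a 0 0 \<in> B}" by (simp add: nf_xpow)
  have "a - a' \<in> {a. nf a 0 0 \<in> B}" if "a \<in> {a. nf a 0 0 \<in> B}" "a' \<in> {a. nf a 0 0 \<in> B}" for a a'
    using that dB[of a 0 a' 0] by simp
  then obtain j where "j \<le> r" "\<And>a. a \<in> {a. nf a 0 0 \<in> B} \<longleftrightarrow> int p ^ j dvd a"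
    using int_ideal_prime_power[OF prime_p _ pr] by blast
  then have j: "j \<le> r" "\<And>a. nf a 0 0 \<in> B \<longleftrightarrow> int p ^ j dvd a" by auto
  \<comment> \<open>Both subgroups contain \<open>z\<close>, so elements with third exponent
    \<open>0\<close> decide equality.\<close>
  have eqI: "B = C" if "subgroup C G" "z \<in> C" "\<And>a b. nf a b 0 \<in> B \<longleftrightarrow> nf a b 0 \<in> C" for C
  proof -
    have "nf a b c \<in> B \<longleftrightarrow> nf a b c \<in> C" for a b c using that nf_mem_iff B by metis
    then have "g \<in> B \<longleftrightarrow> g \<in> C" if "g \<in> carrier G" for g using nf_cases[OF that] by metis
    then show "B = C" using subgroup.subset[OF B(1)] subgroup.subset[OF that(1)] by auto
  qed
  show thesis
  proof (cases "\<exists>a b. nf a b 0 \<in> B \<and> \<not> int p dvd b")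
    case False
    have "nf a b 0 \<in> B \<longleftrightarrow> nf a b 0 \<in> rect j" for a b
    proof -
      have "nf a b 0 \<in> B \<longleftrightarrow> nf a 0 0 \<in> B \<and> int p dvd b"
        using False dB[of a b 0 b] yB[of b] mB[of a 0 0 b] by auto
      then show ?thesis using j nf_in_rect_iff by simp
    qed
    then have "B = rect j" by (rule eqI[OF subgroup_rect z_in_rect])
    then show thesis using rect j by blast
  next
    case True
    then obtain a0 b0 where ab: "nf a0 b0 0 \<in> B" "\<not> int p dvd b0" by blast
    obtain t where t: "int p dvd t * b0 - 1" using int_inverse_mod_prime[OF prime_p ab(2)] .
    define s where "s = t * a0"
    have sB: "nf s 1 0 \<in> B" using dB[OF kB[OF ab(1), of t] yB[OF t]] by (simp add: s_def)
    have iff: "nf a b 0 \<in> B \<longleftrightarrow> int p ^ j dvd a - s * b" for a b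
    proof -
      have "nf a b 0 \<in> B \<longleftrightarrow> nf (a - s * b) 0 0 \<in> B"
        using kB[OF sB, of b] dB[of a b "b * s" "b"] mB[of "a - s * b" 0 "b * s" b]
        by (auto simp: mult.commute)
      then show ?thesis using j by simp
    qed
    have "nf (int p * s) 0 0 \<in> B" using dB[OF kB[OF sB, of "int p"] yB[of "int p"]] by simp
    then have ps: "int p ^ j dvd int p * s" using j by simp
    show thesis
    proof (cases j)
      \<comment> \<open>At level \<open>0\<close> the congruence is void; slants start at
        \<open>j = 1\<close>.\<close>
      case 0
      have "B = carrier G"
        by (rule eqI) (use iff 0 in \<open>auto simp: subgroup_self\<close>)
      then show thesis using whole by blast
    next
      case (Suc j')
      then have "int p ^ j' dvd s" using ps p_gt_1 by simp
      then obtain u where u: "s = int p ^ j' * u" by (elim dvdE)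
      \<comment> \<open>\<open>s\<close> counts only modulo \<open>p ^ j\<close> and is a multiple
        of \<open>p ^ (j - 1)\<close>, which leaves the values \<open>i < p\<close>.\<close>
      define i where "i = nat (u mod int p)"
      have ii: "int i = u mod int p" using p_gt_1 by (simp add: i_def)
      have "i < p" using p_gt_1 by (simp add: i_def nat_less_iff)
      let ?s = "int p ^ (j - 1) * int i"
      have "s - ?s = int p ^ j' * (u - u mod int p)" using u Suc by (simp add: ii algebra_simps)
      also have "\<dots> = int p ^ j * (u div int p)" using Suc by (simp add: minus_mod_eq_mult_div)
      finally have ss: "int p ^ j dvd (s - ?s) * b" for b by simp
      have ps': "int p ^ j dvd int p * ?s" using Suc by simp
      have "nf a b 0 \<in> B \<longleftrightarrow> nf a b 0 \<in> slant j ?s" for a b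
      proof -
        have "a - ?s * b = (a - s * b) + (s - ?s) * b" by (simp add: algebra_simps)
        then have "int p ^ j dvd a - ?s * b \<longleftrightarrow> int p ^ j dvd a - s * b"
          using ss[of b] by (metis dvd_add_left_iff)
        then show ?thesis using iff nf_in_slant_iff[OF j(1) ps'] by simp
      qed
      then have "B = slant j ?s" by (rule eqI[OF subgroup_slant z_in_slant])
      then show thesis using slant[of j i] j Suc \<open>i < p\<close> by simp
    qed
  qed
qed

text \<open>The summands are \<open>r + 1\<close> rectangles, \<open>r * p\<close> slants and the
  whole group.\<close>

lemma card_overgroups: "card {B. subgroup B G \<and> z \<in> B} = r * (p + 1) + 2"
proof -
  let ?R = "rect ` {..r}" and ?f = "\<lambda>(j, i). slant j (int p ^ (j - 1) * int i)"
  let ?T = "{1..r} \<times> {..<p}"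
  have eq: "{B. subgroup B G \<and> z \<in> B} = insert (carrier G) (?R \<union> ?f ` ?T)"
  proof
    show "{B. subgroup B G \<and> z \<in> B} \<subseteq> insert (carrier G) (?R \<union> ?f ` ?T)"
    proof
      fix B assume "B \<in> {B. subgroup B G \<and> z \<in> B}"
      then have "subgroup B G" "z \<in> B" by auto
      then show "B \<in> insert (carrier G) (?R \<union> ?f ` ?T)"
        by (cases rule: overgroup_cases) force+
    qed
    show "insert (carrier G) (?R \<union> ?f ` ?T) \<subseteq> {B. subgroup B G \<and> z \<in> B}"
      using subgroup_rect subgroup_slant z_in_rect z_in_slant subgroup_self by auto
  qed
  \<comment> \<open>Test elements: powers of \<open>x\<close> recover the level \<open>j\<close>,
    while elements with \<open>y\<close> exponent \<open>1\<close> recover the slope and tell slants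
    from rectangles.\<close>
  have rectx: "x [^] (int p ^ i) \<in> rect j \<longleftrightarrow> int p ^ j dvd int p ^ i" if "j \<le> r" for i j
    using nf_in_rect_iff[OF that, of "int p ^ i" 0 0] by (simp add: nf_xpow)
  have ps: "int p ^ j dvd int p * (int p ^ (j - 1) * int i)" if "j \<ge> 1" for j i
    using that by (cases j) simp_all
  have slantx: "x [^] (int p ^ k) \<in> ?f (j, i) \<longleftrightarrow> int p ^ j dvd int p ^ k"
    if "j \<le> r" "j \<ge> 1" for i j k
    using nf_in_slant_iff[OF that(1) ps[OF that(2)], of "int p ^ k" 0 0] by (simp add: nf_xpow)
  have slants: "nf a 1 0 \<in> ?f (j, i) \<longleftrightarrow> int p ^ j dvd a - int p ^ (j - 1) * int i"
    if "j \<le> r" "j \<ge> 1" for i j a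
    using nf_in_slant_iff[OF that(1) ps[OF that(2)], of a 1 0] by simp
  have le: "int p ^ j dvd int p ^ i \<Longrightarrow> j \<le> i" for i j
    using p_gt_1 by (metis of_nat_power int_dvd_int_iff power_dvd_imp_le)
  have injR: "inj_on rect {..r}"
    by (rule inj_onI) (metis rectx le atMost_iff dvd_refl order_antisym)
  have injf: "inj_on ?f ?T"
  proof (rule inj_onI)
    fix t t' assume T: "t \<in> ?T" "t' \<in> ?T" and e: "?f t = ?f t'"
    obtain j i j' i' where t: "t = (j, i)" "t' = (j', i')" by fastforce
    have b: "j \<le> r" "1 \<le> j" "i < p" "j' \<le> r" "1 \<le> j'" "i' < p" using T t by auto
    have e: "?f (j, i) = ?f (j', i')" using e t by simp
    have "int p ^ j dvd int p ^ j'" "int p ^ j' dvd int p ^ j"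
      using slantx[OF b(1,2), of j' i] slantx[OF b(4,5), of j' i'] slantx[OF b(1,2), of j i]
        slantx[OF b(4,5), of j i'] unfolding e by simp_all
    then have jj: "j = j'" using le by (simp add: order_antisym)
    then have "int p ^ j dvd int p ^ (j - 1) * int i' - int p ^ (j - 1) * int i"
      using slants[OF b(1,2), of "int p ^ (j - 1) * int i'" i]
        slants[OF b(4,5), of "int p ^ (j - 1) * int i'" i'] unfolding e by simp
    moreover obtain k where "j = Suc k" using b by (cases j) auto
    ultimately have "int p dvd int i' - int i"
      using p_gt_1 by (simp flip: right_diff_distrib)
    then have "int i' - int i = 0"
      using b dvd_imp_le_int[of "int i' - int i" "int p"] by linarith
    then show "t = t'" using t jj by simp
  qed
  have disj: "?R \<inter> ?f ` ?T = {}"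
  proof -
    have "rect j \<noteq> ?f (j', i')" if "j \<le> r" "1 \<le> j'" "j' \<le> r" for j j' i'
    proof
      assume e: "rect j = ?f (j', i')"
      have "nf (int p ^ (j' - 1) * int i') 1 0 \<in> rect j"
        unfolding e using slants[OF that(3,2)] by simp
      then show False using nf_in_rect_iff[OF that(1)] p_gt_1 by auto
    qed
    then show ?thesis by force
  qed
  have nin: "carrier G \<notin> ?R \<union> ?f ` ?T"
  proof
    assume "carrier G \<in> ?R \<union> ?f ` ?T"
    then consider j where "j \<le> r" "carrier G = rect j"
      | j i where "1 \<le> j" "j \<le> r" "carrier G = ?f (j, i)" by force
    then show False
    proof cases
      case 1
      then have "nf 0 1 0 \<in> rect j" by blast
      then show ?thesis using nf_in_rect_iff[OF 1(1)] p_gt_1 by auto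
    next
      case 2
      then have "x [^] (int p ^ 0) \<in> ?f (j, i)" by (metis int_pow_closed xC)
      then have "int p ^ j dvd int p ^ 0" using slantx[OF 2(2,1)] by blast
      then show ?thesis using le 2(1) by fastforce
    qed
  qed
  have "card (?R \<union> ?f ` ?T) = (r + 1) + r * p"
    using injR injf disj by (subst card_Un_disjoint) (auto simp: card_image)
  then show ?thesis unfolding eq using nin by (subst card_insert_disjoint) auto
qed

text \<open>In a rectangle both \<open>y\<close> exponents vanish modulo \<open>p\<close>; in a
  slant with \<open>j \<ge> 1\<close> the pairs \<open>(a, b)\<close> are proportional modulo
  \<open>p\<close>. Either way \<open>p\<close> divides the determinant in
  \<open>commute_nf\<close>.\<close>

lemma overgroup_commute:
  assumes B: "subgroup B G" "z \<in> B" "B \<noteq> carrier G" and gh: "g \<in> B" "h \<in> B"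
  shows "g \<otimes> h = h \<otimes> g"
proof -
  obtain a b c where g: "g = nf a b c" using nf_cases gh B(1) subgroup.mem_carrier by metis
  obtain a' b' c' where h: "h = nf a' b' c'" using nf_cases gh B(1) subgroup.mem_carrier by metis
  have "int p dvd a' * b - a * b'"
    using B(1,2)
  proof (cases rule: overgroup_cases)
    case (rect j)
    then have "int p dvd b" "int p dvd b'" using gh g h nf_in_rect_iff by auto
    then show ?thesis by simp
  next
    case (slant j i)
    let ?s = "int p ^ (j - 1) * int i"
    have "int p ^ j dvd int p * ?s" using slant(1) by (cases j) simp_all
    then have "int p ^ j dvd a - ?s * b" "int p ^ j dvd a' - ?s * b'"
      using gh g h slant nf_in_slant_iff by metis+
    moreover have "int p dvd int p ^ j" using slant(1) by (simp add: dvd_power)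
    ultimately have "int p dvd (a' - ?s * b') * b - (a - ?s * b) * b'" by (meson dvd_diff dvd_mult2 dvd_trans)
    then show ?thesis by (simp add: algebra_simps)
  qed (use B in auto)
  then show ?thesis using commute_nf[of a b c a' b' c'] zpow_eq_one_iff g h by simp
qed

text \<open>The normal forms with \<open>0 \<le> a < p ^ r\<close> and
  \<open>0 \<le> b, c < p\<close> are distinct. This turns the group order into a bound on
  \<open>r\<close>, and so on the number of overgroups of \<open>z\<close>.\<close>

lemma card_ge:
  assumes "finite (carrier G)"
  shows "p ^ (r + 2) \<le> order G"
proof -
  let ?D = "{0..<int p ^ r} \<times> {0..<int p} \<times> {0..<int p}"
  let ?f = "\<lambda>(a, b, c). nf a b c"
  have small: "k = k'" if "m dvd k - k'" "0 \<le> k" "k < m" "0 \<le> k'" "k' < m" for k k' m :: int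
    using that by (metis mod_eq_dvd_iff mod_pos_pos_trivial)
  have "inj_on ?f ?D"
  proof (rule inj_onI)
    fix t t' assume T: "t \<in> ?D" "t' \<in> ?D" and e: "?f t = ?f t'"
    obtain a b c a' b' c' where t: "t = (a, b, c)" "t' = (a', b', c')" by (cases t, cases t')
    have e: "nf a b c = nf a' b' c'" using e t by simp
    have ab: "a = a'" "b = b'" using nf_eqD[OF e] T t by (auto intro: small)
    then have "z [^] c = z [^] c'" using e unfolding nf_def by simp
    then have "z [^] (c - c') = \<one>" by (simp add: int_pow_diff)
    then have "int p dvd c - c'" using zpow_eq_one_iff by simp
    then have "c = c'" using T t by (auto intro: small)
    then show "t = t'" using ab t by simp
  qed
  then have "card ?D \<le> order G" unfolding order_def
    by (rule card_inj_on_le) (use assms in auto)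
  then show ?thesis by (simp add: card_cartesian_product nat_power_eq power2_eq_square algebra_simps)
qed

end

section \<open>Orbits of p-groups\<close>

lemma (in group_action) prime_dvd_card_orbit:
  assumes "Factorial_Ring.prime p" "order G = p ^ m" "v \<in> E" "orbit G \<phi> v \<noteq> {v}"
  shows "p dvd card (orbit G \<phi> v)"
proof -
  have "card (orbit G \<phi> v) dvd p ^ m"
    using orbit_stabilizer_theorem[OF assms(3)] assms(2) by (metis dvd_triv_left)
  then obtain i where i: "card (orbit G \<phi> v) = p ^ i"
    using divides_primepow_nat[OF assms(1)] by blast
  have "i \<noteq> 0"
  proof
    assume "i = 0"
    then obtain w where "orbit G \<phi> v = {w}" using i by (auto simp: card_1_singleton_iff)
    then show False using orbit_refl[OF assms(3)] assms(4) by auto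
  qed
  then show ?thesis using i by simp
qed

text \<open>Class equation: every orbit with more than one point has size divisible by
  \<open>p\<close>, so the fixed points agree in number with all points modulo
  \<open>p\<close>.\<close>

lemma (in group_action) prime_dvd_card_fixed_points:
  assumes p: "Factorial_Ring.prime p" and ord: "order G = p ^ m" and E: "finite E" "p dvd card E"
  shows "p dvd card {v \<in> E. orbit G \<phi> v = {v}}"
proof -
  let ?F = "{v \<in> E. orbit G \<phi> v = {v}}" and ?O = "orbits G E \<phi>"
  have fin: "finite ?O" unfolding orbits_def using E by simp
  have "(\<Sum>C\<in>?O. card C) = card E"
    using disjoint_sum[OF E(1), of "\<lambda>_. 1::nat"] by simp
  moreover have "(\<Sum>C\<in>?O. card C) = (\<Sum>C\<in>(\<lambda>v. {v}) ` ?F. card C) + (\<Sum>C\<in>?O - (\<lambda>v. {v}) ` ?F. card C)"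
    by (subst add.commute, rule sum.subset_diff) (use fin in \<open>auto simp: orbits_def\<close>)
  moreover have "(\<Sum>C\<in>(\<lambda>v. {v}) ` ?F. card C) = card ?F"
    by (subst sum.reindex) auto
  ultimately have sum: "card E = card ?F + (\<Sum>C\<in>?O - (\<lambda>v. {v}) ` ?F. card C)"
    by linarith
  have "p dvd (\<Sum>C\<in>?O - (\<lambda>v. {v}) ` ?F. card C)"
  proof (rule dvd_sum)
    fix C assume C: "C \<in> ?O - (\<lambda>v. {v}) ` ?F"
    then obtain v where v: "v \<in> E" "C = orbit G \<phi> v" by (auto simp: orbits_def)
    then have "orbit G \<phi> v \<noteq> {v}" using C by auto
    then show "p dvd card C" using prime_dvd_card_orbit[OF p ord v(1)] v(2) by simp
  qed
  then show ?thesis using E(2) unfolding sum by (simp only: dvd_add_left_iff)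
qed

lemma (in group) inv_cancel_left:
  assumes "g \<in> carrier G" "w \<in> carrier G"
  shows "g \<otimes> (inv g \<otimes> w) = w" "inv g \<otimes> (g \<otimes> w) = w"
  using assms by (simp_all flip: m_assoc)

lemma (in group) p_group_center_nontrivial:
  assumes p: "Factorial_Ring.prime p" and ord: "order G = p ^ m" and nt: "carrier G \<noteq> {\<one>}"
  obtains c where "c \<in> carrier G" "c \<noteq> \<one>" "\<And>g. g \<in> carrier G \<Longrightarrow> g \<otimes> c = c \<otimes> g"
proof -
  let ?\<phi> = "\<lambda>g. \<lambda>h \<in> carrier G. g \<otimes> h \<otimes> inv g"
  interpret group_action G "carrier G" ?\<phi> by (rule action_by_conjugation)
  let ?F = "{v \<in> carrier G. orbit G ?\<phi> v = {v}}"
  have fin: "finite (carrier G)" using ord prime_gt_0_nat[OF p] order_gt_0_iff_finite by simp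
  have "m \<noteq> 0" using ord nt order_one_triv_iff by (metis power_0)
  then have "p dvd card (carrier G)" using ord by (simp add: order_def)
  then have "p dvd card ?F" by (rule prime_dvd_card_fixed_points[OF p ord fin])
  moreover have one: "\<one> \<in> ?F" by (auto simp: orbit_def intro!: exI[of _ \<one>])
  moreover have "card ?F \<noteq> 0" using one fin by (auto simp: card_eq_0_iff)
  ultimately have "card ?F \<noteq> 1" using prime_gt_1_nat[OF p] by auto
  then have "?F \<noteq> {\<one>}" by auto
  then obtain c where c: "c \<in> ?F" "c \<noteq> \<one>" using one by blast
  have "g \<otimes> c = c \<otimes> g" if g: "g \<in> carrier G" for g
  proof -
    have "g \<otimes> c \<otimes> inv g \<in> orbit G ?\<phi> c" unfolding orbit_def using g c by auto
    then have "g \<otimes> c \<otimes> inv g = c" using c by auto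
    moreover have "c \<in> carrier G" using c by simp
    ultimately show ?thesis using g inv_solve_right[of c "g \<otimes> c" g] by simp
  qed
  then show thesis using that c by blast
qed

section \<open>Counting conjugacy classes of subgroups\<close>

context group
begin

abbreviation normals :: "'a set set" where
  "normals \<equiv> {H. H \<lhd> G}"

abbreviation nonnormals :: "'a set set" where
  "nonnormals \<equiv> {H. subgroup H G \<and> \<not> H \<lhd> G}"

definition conj_class :: "'a set \<Rightarrow> 'a set set" where
  "conj_class = orbit G (\<lambda>g. \<lambda>H \<in> {H. subgroup H G}. g <# H #> inv g)"

lemma subgroup_action: "group_action G {H. subgroup H G} (\<lambda>g. \<lambda>H \<in> {H. subgroup H G}. g <# H #> inv g)"
  by (rule action_by_conjugation_on_subgroups_set)

lemma subgroup_classes_eq: "subgroup_classes G = conj_class ` {H. subgroup H G}"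
  unfolding subgroup_classes_def orbits_def subgroups_of_def conj_class_def by blast

lemma conj_class_eq:
  assumes "subgroup H G"
  shows "conj_class H = {(\<lambda>h. g \<otimes> h \<otimes> inv g) ` H | g. g \<in> carrier G}"
proof -
  have "g <# H #> inv g = (\<lambda>h. g \<otimes> h \<otimes> inv g) ` H" for g
    unfolding l_coset_def r_coset_def by auto
  then show ?thesis using assms unfolding conj_class_def orbit_def by simp
qed

lemma conj_class_subgroups: "subgroup H G \<Longrightarrow> K \<in> conj_class H \<Longrightarrow> subgroup K G"
  using group_action.element_image[OF subgroup_action] unfolding conj_class_def orbit_def by auto

lemma conj_class_refl: "subgroup H G \<Longrightarrow> H \<in> conj_class H"
  using group_action.orbit_refl[OF subgroup_action] unfolding conj_class_def by simp

lemma conj_class_singleton_iff: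
  assumes "subgroup H G"
  shows "conj_class H = {H} \<longleftrightarrow> H \<lhd> G"
proof
  assume single: "conj_class H = {H}"
  show "H \<lhd> G"
  proof (rule normal_invI[OF assms])
    fix g h assume g: "g \<in> carrier G" and h: "h \<in> H"
    have "(\<lambda>h. g \<otimes> h \<otimes> inv g) ` H \<in> conj_class H"
      unfolding conj_class_eq[OF assms] by (rule CollectI) (use g in auto)
    then show "g \<otimes> h \<otimes> inv g \<in> H" using single h by (metis imageI singletonD)
  qed
next
  assume H: "H \<lhd> G"
  have "(\<lambda>h. g \<otimes> h \<otimes> inv g) ` H = H" if g: "g \<in> carrier G" for g
  proof
    show "(\<lambda>h. g \<otimes> h \<otimes> inv g) ` H \<subseteq> H" using normal.inv_op_closed2[OF H g] by auto
    show "H \<subseteq> (\<lambda>h. g \<otimes> h \<otimes> inv g) ` H"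
    proof
      fix h assume h: "h \<in> H"
      then have hC: "h \<in> carrier G" by (rule subgroup.mem_carrier[OF assms])
      have "inv g \<otimes> h \<otimes> inv (inv g) \<in> H" using normal.inv_op_closed2[OF H _ h, of "inv g"] g by simp
      moreover have "h = g \<otimes> (inv g \<otimes> h \<otimes> inv (inv g)) \<otimes> inv g"
        using g hC by (simp add: m_assoc inv_cancel_left)
      ultimately show "h \<in> (\<lambda>h. g \<otimes> h \<otimes> inv g) ` H" by (rule rev_image_eqI)
    qed
  qed
  then have "conj_class H \<subseteq> {H}" unfolding conj_class_eq[OF assms] by auto
  then show "conj_class H = {H}" using conj_class_refl[OF assms] by auto
qed

lemma conj_class_sym_eq:
  assumes "subgroup H G" "K \<in> conj_class H"
  shows "conj_class K = conj_class H"
proof -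
  have K: "subgroup K G" using conj_class_subgroups assms .
  have "H \<in> conj_class K"
    using group_action.orbit_sym[OF subgroup_action] assms K unfolding conj_class_def by simp
  moreover have "L \<in> conj_class A" if "subgroup A G" "B \<in> conj_class A" "L \<in> conj_class B" for A B L
  proof -
    have "subgroup B G" using conj_class_subgroups that(1,2) .
    moreover have "subgroup L G" using conj_class_subgroups[OF calculation that(3)] .
    ultimately show ?thesis
      using group_action.orbit_trans[OF subgroup_action, of A B L] that unfolding conj_class_def by simp
  qed
  ultimately show ?thesis using assms K by (metis equalityI subsetI)
qed

lemma conj_class_nonnormal:
  assumes "H \<in> nonnormals"
  shows "conj_class H \<subseteq> nonnormals"
proof
  fix K assume K: "K \<in> conj_class H"
  have sub: "subgroup K G" using conj_class_subgroups assms K by blast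
  have "\<not> K \<lhd> G"
  proof
    assume "K \<lhd> G"
    then have "conj_class H = {K}" using conj_class_singleton_iff[OF sub] conj_class_sym_eq assms K by auto
    then show False using conj_class_refl[of H] assms \<open>K \<lhd> G\<close> by auto
  qed
  then show "K \<in> nonnormals" using sub by simp
qed

lemma finite_subgroups: "finite (carrier G) \<Longrightarrow> finite {H. subgroup H G \<and> P H}"
  by (rule finite_subset[of _ "Pow (carrier G)"]) (auto dest: subgroup.subset)

lemma finite_normals: "finite (carrier G) \<Longrightarrow> finite normals"
  by (rule finite_subset[OF _ finite_subgroups[of "\<lambda>_. True"]]) (auto dest: normal_imp_subgroup)

lemma card_subgroups_split:
  assumes "finite (carrier G)"
  shows "card (subgroups_of G) = card normals + card nonnormals"
proof -
  have "subgroups_of G = normals \<union> nonnormals"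
    unfolding subgroups_of_def by (auto dest: normal_imp_subgroup)
  then show ?thesis using finite_normals[OF assms] finite_subgroups[OF assms]
    by (simp add: card_Un_disjoint disjoint_iff)
qed

lemma card_classes_split:
  assumes "finite (carrier G)"
  shows "card (subgroup_classes G) = card normals + card (conj_class ` nonnormals)"
proof -
  have "{H. subgroup H G} = normals \<union> nonnormals"
    by (auto dest: normal_imp_subgroup)
  moreover have "conj_class ` normals = (\<lambda>H. {H}) ` normals"
    by (rule image_cong[OF HOL.refl]) (use conj_class_singleton_iff normal_imp_subgroup in blast)
  ultimately have eq: "subgroup_classes G = (\<lambda>H. {H}) ` normals \<union> conj_class ` nonnormals"
    unfolding subgroup_classes_eq by (simp add: image_Un)
  have "conj_class H \<noteq> {K}" if "H \<in> nonnormals" "K \<lhd> G" for H K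
    using conj_class_nonnormal[OF that(1)] that by auto
  then have "(\<lambda>H. {H}) ` normals \<inter> conj_class ` nonnormals = {}" by blast
  then show ?thesis unfolding eq
    using finite_normals[OF assms] finite_subgroups[OF assms]
    by (subst card_Un_disjoint) (auto simp: card_image)
qed

lemma p_group_classes_bound:
  assumes p: "Factorial_Ring.prime p" and ord: "order G = p ^ m"
  shows "p * card (conj_class ` nonnormals) \<le> card nonnormals"
proof -
  have fin: "finite (carrier G)" using ord prime_gt_0_nat[OF p] order_gt_0_iff_finite by simp
  have finN: "finite nonnormals" by (rule finite_subgroups[OF fin])
  have le: "p \<le> card (conj_class H)" if H: "H \<in> nonnormals" for H
  proof -
    have "p dvd card (conj_class H)"
      using group_action.prime_dvd_card_orbit[OF subgroup_action p ord] conj_class_singleton_iff[of H] H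
      unfolding conj_class_def by auto
    moreover have "card (conj_class H) \<noteq> 0"
      using conj_class_refl[of H] finite_subset[OF conj_class_nonnormal[OF H] finN] H by auto
    ultimately show ?thesis by (simp add: dvd_imp_le)
  qed
  have "p * card (conj_class ` nonnormals) \<le> (\<Sum>C\<in>conj_class ` nonnormals. card C)"
    using sum_bounded_below[of "conj_class ` nonnormals" p card] le by (auto simp: mult.commute)
  also have "\<dots> = card (\<Union>(conj_class ` nonnormals))"
  proof (rule card_Union_disjoint[symmetric])
    have "conj_class H \<inter> conj_class K = {}"
      if "subgroup H G" "subgroup K G" "conj_class H \<noteq> conj_class K" for H K
      using that conj_class_sym_eq by blast
    then show "pairwise disjnt (conj_class ` nonnormals)"
      unfolding pairwise_def disjnt_def by blast
    show "finite C" if "C \<in> conj_class ` nonnormals" for C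
      using that finite_subset[OF conj_class_nonnormal finN] by blast
  qed
  also have "\<dots> \<le> card nonnormals"
    by (rule card_mono[OF finN]) (use conj_class_nonnormal in blast)
  finally show ?thesis .
qed

lemma d_prime_abelian:
  assumes "finite (carrier G)" "\<And>g h. g \<in> carrier G \<Longrightarrow> h \<in> carrier G \<Longrightarrow> g \<otimes> h = h \<otimes> g"
  shows "d_prime G = 1"
proof -
  have "H \<lhd> G" if "subgroup H G" for H
  proof -
    have "g \<otimes> h \<otimes> inv g = h" if "g \<in> carrier G" "h \<in> H" for g h
    proof -
      have hC: "h \<in> carrier G" by (rule subgroup.mem_carrier[OF \<open>subgroup H G\<close> that(2)])
      then have "g \<otimes> h = h \<otimes> g" using assms(2) that by blast
      then show ?thesis using that hC by (simp add: m_assoc)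
    qed
    then show ?thesis using that by (intro normal_invI) simp_all
  qed
  then have none: "nonnormals = {}" by blast
  moreover have "\<one> \<in> {\<one>}" "{\<one>} \<in> normals" using one_is_normal by auto
  then have "card normals \<noteq> 0" using finite_normals[OF assms(1)] by auto
  ultimately show ?thesis
    unfolding d_prime_def card_classes_split[OF assms(1)] card_subgroups_split[OF assms(1)] none by simp
qed

lemma d_prime_eq:
  assumes "finite (carrier G)"
  shows "d_prime G = (real (card normals) + real (card (conj_class ` nonnormals))) /
           (real (card normals) + real (card nonnormals))"
  unfolding d_prime_def card_classes_split[OF assms] card_subgroups_split[OF assms] by simp

lemma card_normals_pos:
  assumes "finite (carrier G)"
  shows "card normals > 0"
  using one_is_normal finite_normals[OF assms] by (auto simp: card_gt_0_iff)

text \<open>The worst case is \<open>T - p\<close> normal subgroups and one class of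
  \<open>p\<close> nonnormal ones: fewer normal subgroups, or more nonnormal ones in classes of size
  at least \<open>p\<close>, only lower the ratio.\<close>

lemma p_group_d_prime_le:
  assumes p: "Factorial_Ring.prime p" and ord: "order G = p ^ m" and ne: "nonnormals \<noteq> {}"
    and T: "card normals + p \<le> T"
  shows "d_prime G \<le> 1 - (real p - 1) / real T"
proof -
  have fin: "finite (carrier G)" using ord prime_gt_0_nat[OF p] order_gt_0_iff_finite by simp
  define \<nu> q \<kappa> where "\<nu> = card normals" and "q = card nonnormals" and "\<kappa> = card (conj_class ` nonnormals)"
  have pos: "\<nu> > 0" unfolding \<nu>_def by (rule card_normals_pos[OF fin])
  have "\<kappa> > 0" using ne finite_subgroups[OF fin] by (simp add: \<kappa>_def card_gt_0_iff)
  moreover have k: "p * \<kappa> \<le> q" unfolding \<kappa>_def q_def by (rule p_group_classes_bound[OF p ord])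
  ultimately have qp: "q \<ge> p" by (metis One_nat_def Suc_leI dual_order.trans mult.right_neutral mult_le_mono2)
  have p2: "p \<ge> 2" using prime_ge_2_nat[OF p] .
  \<comment> \<open>The bounds on \<open>q\<close> and \<open>\<nu>\<close> combine here. Multiplied
    by \<open>p - 1\<close>, this inequality is exactly the slack needed in the chain below.\<close>
  have "p * \<nu> \<le> q * (T - p)" using qp T unfolding \<nu>_def by (intro mult_le_mono) auto
  then have 1: "real p * real \<nu> \<le> real q * (real T - real p)"
    using T by (simp flip: of_nat_mult of_nat_diff add: \<nu>_def)
  have 2: "real p * real \<kappa> \<le> real q" using k by (metis of_nat_le_iff of_nat_mult)
  have Tpos: "real T > 0" using T p2 by simp
  have "real p * (real T * (\<nu> + \<kappa>)) = p * \<nu> * T + T * (p * \<kappa>)" by (simp add: algebra_simps)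
  also have "\<dots> \<le> p * \<nu> * T + T * q" using 2 Tpos by (simp add: mult_left_mono)
  also have "\<dots> \<le> p * \<nu> * T + T * q + (real p - 1) * (real q * (real T - real p) - real p * real \<nu>)"
    using 1 p2 by simp
  also have "\<dots> = real p * ((T - (real p - 1)) * (\<nu> + q))" by (simp add: algebra_simps)
  finally have "real T * (\<nu> + \<kappa>) \<le> (T - (real p - 1)) * (\<nu> + q)" using p2 by simp
  then have "(real \<nu> + \<kappa>) / (real \<nu> + q) \<le> (T - (real p - 1)) / T"
    using Tpos pos by (simp add: divide_simps mult.commute)
  also have "\<dots> = 1 - (real p - 1) / real T" using Tpos by (simp add: diff_divide_distrib)
  finally show ?thesis unfolding d_prime_eq[OF fin] \<nu>_def q_def \<kappa>_def .
qed

end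

section \<open>Minimal non-Dedekind p-groups\<close>

text \<open>Iterated Fermat. It serves to show that an automorphism of \<open>p\<close>-power order
  is trivial on a group of order \<open>p\<close>: if it raises to the power \<open>i\<close> and
  \<open>i ^ (p ^ m)\<close> is \<open>1\<close> modulo \<open>p\<close>, then so is
  \<open>i\<close>.\<close>

lemma fermat_int_power:
  assumes p: "Factorial_Ring.prime (p::nat)"
  shows "int p dvd i ^ (p ^ m) - i"
proof -
  have base: "int p dvd j ^ p - j" for j
  proof (cases "int p dvd j")
    case True
    then show ?thesis using prime_gt_0_nat[OF p] by (auto intro: dvd_diff dvd_power_same dvd_trans[OF _ dvd_power])
  next
    case False
    define a where "a = nat (j mod int p)"
    have pp: "p > 0" using prime_gt_0_nat[OF p] .
    have a: "int a = j mod int p" using pp by (simp add: a_def)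
    then have "\<not> p dvd a" using False by (metis dvd_mod_iff int_dvd_int_iff dvd_refl)
    then have "[a ^ (p - 1) = 1] (mod p)" using fermat_theorem[OF p] by simp
    then have "[a ^ (p - 1) * a = 1 * a] (mod p)" by (rule cong_scalar_right)
    then have "[a ^ p = a] (mod p)" using pp by (metis mult_1 power_minus_mult)
    then have "[int a ^ p = int a] (mod int p)" by (metis cong_int_iff of_nat_power)
    moreover have "[int a = j] (mod int p)" by (simp add: a cong_def)
    ultimately have "[j ^ p = j] (mod int p)" by (meson cong_pow cong_sym cong_trans)
    then show ?thesis by (simp add: cong_iff_dvd_diff)
  qed
  show ?thesis
  proof (induction m)
    case 0
    show ?case by simp
  next
    case (Suc m)
    have "i ^ p ^ Suc m - i = ((i ^ p ^ m) ^ p - i ^ p ^ m) + (i ^ p ^ m - i)"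
      by (simp add: power_mult[symmetric] mult.commute)
    then show ?case using base Suc by (metis dvd_add)
  qed
qed

context group
begin

abbreviation cyc :: "'a \<Rightarrow> 'a set" where
  "cyc g \<equiv> range (\<lambda>i::int. g [^] i)"

lemma subgroup_cyc: "g \<in> carrier G \<Longrightarrow> subgroup (cyc g) G"
  using generate_is_subgroup[of "{g}"] generate_pow[of g] by (simp add: full_SetCompr_eq)

lemma self_in_cyc: "g \<in> carrier G \<Longrightarrow> g \<in> cyc g"
  using int_pow_1 by (metis rangeI)

lemma cyc_subset: "subgroup H G \<Longrightarrow> g \<in> H \<Longrightarrow> cyc g \<subseteq> H"
  using subgroup_int_pow_closed by auto

lemma prime_order_root:
  assumes "Factorial_Ring.prime (p::nat)" "g \<in> carrier G" "g [^] p = \<one>" "\<not> int p dvd k"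
  obtains t :: int where "(g [^] k) [^] t = g"
proof -
  obtain t where t: "int p dvd t * k - 1" using int_inverse_mod_prime[OF assms(1,4)] .
  have "g [^] (t * k) = g [^] (t * k - 1) \<otimes> g [^] (1::int)"
    using int_pow_mult[OF assms(2), of "t * k - 1" 1] by simp
  then have "g [^] (t * k) = g" using int_pow_zero_dvd[OF assms(2,3) t] assms(2) by simp
  then show thesis using that[of t] assms(2) by (simp add: int_pow_pow mult.commute)
qed

lemma p_group_central_prime_order:
  assumes p: "Factorial_Ring.prime p" and ord: "order G = p ^ m" and nt: "carrier G \<noteq> {\<one>}"
  obtains c where "c \<in> carrier G" "c \<noteq> \<one>" "c [^] p = \<one>" "\<And>g. g \<in> carrier G \<Longrightarrow> g \<otimes> c = c \<otimes> g"
proof -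
  obtain d where d: "d \<in> carrier G" "d \<noteq> \<one>" "\<And>g. g \<in> carrier G \<Longrightarrow> g \<otimes> d = d \<otimes> g"
    using p_group_center_nontrivial[OF p ord nt] by blast
  have "local.ord d dvd p ^ m" using ord_dvd_group_order d ord by metis
  then obtain e where e: "local.ord d = p ^ e" using divides_primepow_nat[OF p] by blast
  have "e \<noteq> 0" using e d ord_eq_1 by (metis power_0)
  then obtain e' where e': "e = Suc e'" by (cases e) auto
  \<comment> \<open>Since \<open>d\<close> has order \<open>p ^ Suc e'\<close>, this power has order
    \<open>p\<close>, and it stays central.\<close>
  let ?c = "d [^] (p ^ e')"
  have "?c \<noteq> \<one>" using d e e' prime_gt_1_nat[OF p] by (simp add: pow_eq_id nat_dvd_not_less)
  moreover have "?c [^] p = \<one>" using d e e' by (simp add: nat_pow_pow pow_eq_id mult.commute)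
  moreover have "g \<otimes> ?c = ?c \<otimes> g" if "g \<in> carrier G" for g
    using commute_int_pow[of g d "int (p ^ e')"] d that by (simp add: int_pow_int del: of_nat_power)
  ultimately show thesis using that[of ?c] d by simp
qed

text \<open>This supplies a subgroup that contains both \<open>y\<close> and a given central
  \<open>V\<close>; in a minimal group it is normal as soon as \<open>V\<close> is normal and
  nontrivial.\<close>

lemma central_product_subgroup:
  assumes g: "g \<in> carrier G" and V: "subgroup V G" "\<And>v. v \<in> V \<Longrightarrow> g \<otimes> v = v \<otimes> g"
  shows "subgroup {g [^] (i::int) \<otimes> v | i v. v \<in> V} G"
proof -
  have VC: "v \<in> carrier G" if "v \<in> V" for v using subgroup.mem_carrier[OF V(1) that] .
  have comm: "g [^] i \<otimes> v = v \<otimes> g [^] i" if "v \<in> V" for v and i :: int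
    using commute_int_pow[of v g i] V(2)[OF that] VC[OF that] g by simp
  let ?W = "{g [^] (i::int) \<otimes> v | i v. v \<in> V}"
  show ?thesis
  proof
    show "?W \<subseteq> carrier G" using g VC by auto
    have "\<one> = g [^] (0::int) \<otimes> \<one>" by simp
    then show "\<one> \<in> ?W" using subgroup.one_closed[OF V(1)] by blast
    show "a \<otimes> b \<in> ?W" if ab: "a \<in> ?W" "b \<in> ?W" for a b
    proof -
      obtain i v j w where e: "a = g [^] (i::int) \<otimes> v" "v \<in> V" "b = g [^] (j::int) \<otimes> w" "w \<in> V"
        using ab by blast
      have "a \<otimes> b = g [^] i \<otimes> (v \<otimes> g [^] j) \<otimes> w" using e g VC by (simp add: m_assoc)
      also have "\<dots> = g [^] (i + j) \<otimes> (v \<otimes> w)"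
        using e g VC by (simp add: comm[symmetric] m_assoc int_pow_mult)
      finally show ?thesis using subgroup.m_closed[OF V(1) e(2,4)] by blast
    qed
    show "inv a \<in> ?W" if a: "a \<in> ?W" for a
    proof -
      obtain i v where e: "a = g [^] (i::int) \<otimes> v" "v \<in> V" using a by blast
      have "inv v \<in> V" using subgroup.m_inv_closed[OF V(1) e(2)] .
      moreover have "inv a = g [^] (- i) \<otimes> inv v"
        using e g VC comm[OF \<open>inv v \<in> V\<close>, of "- i"] by (simp add: inv_mult_group int_pow_neg)
      ultimately show ?thesis by blast
    qed
  qed
qed

text \<open>The generators \<open>x\<close>, \<open>y\<close> come from a nonnormal cyclic subgroup \<open>\<langle>y\<rangle>\<close>: its product with a
  central subgroup of order \<open>p\<close> is normal, which forces \<open>y\<close> to have order \<open>p\<close> and its conjugates to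
  differ from \<open>y\<close> by central elements.\<close>

lemma minimal_non_dedekind_structure:
  assumes p: "Factorial_Ring.prime p" and ord: "order G = p ^ m" and ne: "nonnormals \<noteq> {}"
    and quot: "\<And>V W. V \<lhd> G \<Longrightarrow> V \<noteq> {\<one>} \<Longrightarrow> subgroup W G \<Longrightarrow> V \<subseteq> W \<Longrightarrow> W \<lhd> G"
    and sub: "\<And>x y. x \<in> carrier G \<Longrightarrow> y \<in> carrier G \<Longrightarrow> generate G {x, y} \<noteq> carrier G
      \<Longrightarrow> x \<otimes> y \<otimes> inv x \<in> cyc y"
  obtains x y z r where "class2_pgroup G x y z p r" "\<And>V. V \<lhd> G \<Longrightarrow> V \<noteq> {\<one>} \<Longrightarrow> z \<in> V"
proof -
  obtain W where W: "subgroup W G" "\<not> W \<lhd> G" using ne by blast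
  then obtain x y where x: "x \<in> carrier G" and yW: "y \<in> W" and "x \<otimes> y \<otimes> inv x \<notin> W"
    using normal_invI by blast
  then have nin: "x \<otimes> y \<otimes> inv x \<notin> cyc y" using cyc_subset[OF W(1) yW] by blast
  have y: "y \<in> carrier G" using subgroup.mem_carrier[OF W(1) yW] .
  have xy: "x \<otimes> y \<noteq> y \<otimes> x"
  proof
    assume "x \<otimes> y = y \<otimes> x"
    then have "x \<otimes> y \<otimes> inv x = y" using x y by (simp add: m_assoc)
    then show False using nin self_in_cyc[OF y] by simp
  qed
  \<comment> \<open>Otherwise \<open>y\<close> would be a power of \<open>y [^] k\<close> and would
    itself commute with \<open>x\<close>.\<close>
  have y_indep: "int p dvd k" if k: "x \<otimes> y [^] k = y [^] k \<otimes> x" "y [^] p = \<one>" for k :: int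
  proof (rule ccontr)
    assume "\<not> int p dvd k"
    then obtain t :: int where "(y [^] k) [^] t = y" using prime_order_root[OF p y k(2)] by blast
    then show False using commute_int_pow[of x "y [^] k" t] k(1) x y xy by simp
  qed
  have "carrier G \<noteq> {\<one>}" using xy x y by auto
  then obtain c where c: "c \<in> carrier G" "c \<noteq> \<one>" "c [^] p = \<one>"
    and cc: "\<And>g. g \<in> carrier G \<Longrightarrow> g \<otimes> c = c \<otimes> g"
    using p_group_central_prime_order[OF p ord] by blast
  have cpow: "g \<otimes> c [^] (j::int) = c [^] j \<otimes> g" if "g \<in> carrier G" for g j
    using commute_int_pow[OF that c(1) cc[OF that]] .
  have cycc: "cyc c \<lhd> G"
  proof (rule normal_invI[OF subgroup_cyc[OF c(1)]])
    fix g h assume g: "g \<in> carrier G" and "h \<in> cyc c"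
    then obtain j :: int where "h = c [^] j" by blast
    then show "g \<otimes> h \<otimes> inv g \<in> cyc c" using cpow[OF g, of j] g c by (simp add: m_assoc)
  qed
  have cne: "cyc c \<noteq> {\<one>}" using self_in_cyc[OF c(1)] c(2) by blast
  let ?Y = "{y [^] (i::int) \<otimes> v | i v. v \<in> cyc c}"
  have Y: "subgroup ?Y G"
    by (rule central_product_subgroup[OF y subgroup_cyc[OF c(1)]]) (use cpow[OF y] in auto)
  have "cyc c \<subseteq> ?Y"
  proof
    fix v assume v: "v \<in> cyc c"
    then have "v = y [^] (0::int) \<otimes> v" using c by auto
    then show "v \<in> ?Y" using v by blast
  qed
  then have Yn: "?Y \<lhd> G" by (rule quot[OF cycc cne Y])
  have "y = y [^] (1::int) \<otimes> c [^] (0::int)" using y by simp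
  then have yY: "y \<in> ?Y" by blast
  have conj_y: "\<exists>(i::int) (j::int). g \<otimes> y \<otimes> inv g = y [^] i \<otimes> c [^] j" if g: "g \<in> carrier G" for g
  proof -
    obtain i v where "g \<otimes> y \<otimes> inv g = y [^] (i::int) \<otimes> v" "v \<in> cyc c"
      using normal.inv_op_closed2[OF Yn g yY] by blast
    moreover from this(2) obtain j :: int where "v = c [^] j" by blast
    ultimately show ?thesis by metis
  qed
  have yp: "y [^] p = \<one>"
  proof (rule ccontr)
    assume yp: "y [^] p \<noteq> \<one>"
    \<comment> \<open>Conjugates of \<open>y\<close> have the form
      \<open>y [^] i \<otimes> c [^] j\<close>, and the central factor dies in the
      \<open>p\<close>-th power. So a nontrivial \<open>y [^] p\<close> generates a nontrivial
      normal subgroup below \<open>cyc y\<close>, which would make \<open>cyc y\<close>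
      normal.\<close>
    have "cyc (y [^] p) \<lhd> G"
    proof (rule normal_invI)
      show "subgroup (cyc (y [^] p)) G" using subgroup_cyc y by simp
      fix g h assume g: "g \<in> carrier G" and "h \<in> cyc (y [^] p)"
      then obtain k :: int where h: "h = (y [^] p) [^] k" by blast
      obtain i j :: int where ij: "g \<otimes> y \<otimes> inv g = y [^] i \<otimes> c [^] j" using conj_y[OF g] by blast
      have "g \<otimes> y [^] p \<otimes> inv g = (y [^] i \<otimes> c [^] j) [^] (int p)"
        using conj_int_pow[OF g y, of "int p"] ij by (simp add: int_pow_int)
      also have "\<dots> = (y [^] i) [^] (int p) \<otimes> (c [^] j) [^] (int p)"
        using y c by (intro int_pow_mult_distrib cpow) auto
      also have "(c [^] j) [^] (int p) = \<one>"
        using int_pow_zero_dvd[OF c(1,3), of "j * int p"] c by (simp add: int_pow_pow)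
      also have "(y [^] i) [^] (int p) = (y [^] p) [^] i"
        using y by (simp add: int_pow_pow mult.commute flip: int_pow_int)
      finally have "g \<otimes> y [^] p \<otimes> inv g = (y [^] p) [^] i" using y by simp
      then have "g \<otimes> h \<otimes> inv g = (y [^] p) [^] (i * k)"
        using conj_int_pow[OF g, of "y [^] p" k] y unfolding h by (simp add: int_pow_pow)
      then show "g \<otimes> h \<otimes> inv g \<in> cyc (y [^] p)" by blast
    qed
    moreover have "cyc (y [^] p) \<noteq> {\<one>}" using yp self_in_cyc[of "y [^] p"] y by auto
    moreover have "y [^] p \<in> cyc y" using int_pow_int[of G y p] by (metis rangeI)
    ultimately have "cyc y \<lhd> G"
      using quot[OF _ _ subgroup_cyc[OF y] cyc_subset[OF subgroup_cyc[OF y]]] by blast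
    then show False using normal.inv_op_closed2[OF _ x self_in_cyc[OF y]] nin by blast
  qed
  obtain i j :: int where ij: "x \<otimes> y \<otimes> inv x = y [^] i \<otimes> c [^] j" using conj_y[OF x] by blast
  \<comment> \<open>Modulo \<open>c\<close>, conjugation by \<open>x [^] k\<close> raises
    \<open>y\<close> to the power \<open>i ^ k\<close>. It is trivial at \<open>k = p ^ m\<close>,
    so \<open>i ^ (p ^ m)\<close>, and by Fermat \<open>i\<close> itself, is \<open>1\<close> modulo
    \<open>p\<close>.\<close>
  have iter: "\<exists>s::int. x [^] k \<otimes> y \<otimes> inv (x [^] k) = y [^] (i ^ k) \<otimes> c [^] s" for k :: nat
  proof (induction k)
    case 0
    have "x [^] (0::nat) \<otimes> y \<otimes> inv (x [^] (0::nat)) = y [^] (i ^ 0) \<otimes> c [^] (0::int)" using y by simp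
    then show ?case by blast
  next
    case (Suc k)
    then obtain s :: int where s: "x [^] k \<otimes> y \<otimes> inv (x [^] k) = y [^] (i ^ k) \<otimes> c [^] s" by blast
    have "x [^] Suc k \<otimes> y \<otimes> inv (x [^] Suc k) = x \<otimes> (x [^] k \<otimes> y \<otimes> inv (x [^] k)) \<otimes> inv x"
      using x y unfolding nat_pow_Suc2[OF x] by (simp add: m_assoc inv_mult_group del: nat_pow_Suc)
    also have "\<dots> = (x \<otimes> y [^] (i ^ k) \<otimes> inv x) \<otimes> c [^] s"
      unfolding s using x y c cpow[of "inv x" s] by (simp add: m_assoc)
    also have "x \<otimes> y [^] (i ^ k) \<otimes> inv x = (y [^] i \<otimes> c [^] j) [^] (i ^ k)"
      using conj_int_pow[OF x y] ij by simp
    also have "\<dots> = (y [^] i) [^] (i ^ k) \<otimes> (c [^] j) [^] (i ^ k)"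
      using y c by (intro int_pow_mult_distrib cpow) auto
    also have "\<dots> = y [^] (i ^ Suc k) \<otimes> c [^] (j * i ^ k)" using y c by (simp add: int_pow_pow)
    also have "\<dots> \<otimes> c [^] s = y [^] (i ^ Suc k) \<otimes> c [^] (j * i ^ k + s)"
      using y c by (simp add: m_assoc int_pow_mult)
    finally show ?case by blast
  qed
  have "x [^] (p ^ m) = \<one>" using pow_order_eq_1[OF x] ord by simp
  then obtain s :: int where "y = y [^] (i ^ (p ^ m)) \<otimes> c [^] s" using iter[of "p ^ m"] y by auto
  then have "c [^] s = inv (y [^] (i ^ (p ^ m))) \<otimes> y [^] (1::int)"
    using y c by (simp add: inv_solve_left)
  also have "\<dots> = y [^] (1 - i ^ (p ^ m))"
    using y by (simp flip: int_pow_neg int_pow_mult del: int_pow_1) 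
  finally have "x \<otimes> y [^] (1 - i ^ (p ^ m)) = y [^] (1 - i ^ (p ^ m)) \<otimes> x" using cpow[OF x, of s] by simp
  then have "int p dvd 1 - i ^ (p ^ m)" using yp by (rule y_indep)
  moreover have "int p dvd i ^ (p ^ m) - i" by (rule fermat_int_power[OF p])
  ultimately have "int p dvd (1 - i ^ (p ^ m)) + (i ^ (p ^ m) - i)" by (rule dvd_add)
  then have "int p dvd i - 1" by (metis diff_add_cancel diff_add_eq dvd_diff_commute add.commute add_diff_eq)
  then have "y [^] (i - 1) = \<one>" by (rule int_pow_zero_dvd[OF y yp])
  then have "y [^] i = y" using y by (simp add: int_pow_diff) (metis inv_equality inv_inv int_pow_closed inv_closed)
  then have xyx: "x \<otimes> y \<otimes> inv x = y \<otimes> c [^] j" using ij by simp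
  \<comment> \<open>The sign turns
    \<open>x \<otimes> y \<otimes> inv x = y \<otimes> c [^] j\<close> into
    \<open>y \<otimes> x = x \<otimes> y \<otimes> z\<close>.\<close>
  define z where "z = c [^] (- j)"
  have z: "z \<in> carrier G" using c by (simp add: z_def)
  have zcen: "g \<otimes> z = z \<otimes> g" if "g \<in> carrier G" for g unfolding z_def by (rule cpow[OF that])
  have zne: "z \<noteq> \<one>"
  proof
    assume "z = \<one>"
    then have "c [^] j = \<one>" using c by (simp add: z_def int_pow_neg)
    then show False using xyx nin self_in_cyc[OF y] y by simp
  qed
  have zp: "z [^] p = \<one>"
    using int_pow_zero_dvd[OF c(1,3), of "- j * int p"] c by (simp add: z_def int_pow_pow flip: int_pow_int)
  have xyx': "x \<otimes> y \<otimes> inv x = y \<otimes> inv z" using xyx c by (simp add: z_def int_pow_neg)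
  have yx: "y \<otimes> x = x \<otimes> y \<otimes> z"
  proof -
    have "x \<otimes> y = y \<otimes> inv z \<otimes> x" using xyx' x y z by (metis inv_solve_right' m_closed inv_closed)
    then have "x \<otimes> y \<otimes> z = y \<otimes> inv z \<otimes> (z \<otimes> x)" using x y z zcen[OF x] by (simp add: m_assoc)
    also have "\<dots> = y \<otimes> x" using x y z by (simp add: m_assoc inv_cancel_left)
    finally show ?thesis by simp
  qed
  have gen: "carrier G = generate G {x, y}" using sub[OF x y] nin by blast
  interpret T: commutator_triple G x y z
    by unfold_locales (use x y z zcen yx gen in auto)
  let ?I = "{a. x [^] (a::int) \<in> cyc z}"
  have diff: "a - b \<in> ?I" if "a \<in> ?I" "b \<in> ?I" for a b
    using that subgroup.m_closed[OF subgroup_cyc[OF z]] subgroup.m_inv_closed[OF subgroup_cyc[OF z]] x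
    by (simp add: int_pow_diff)
  have "x [^] int (p ^ m) = \<one>" using \<open>x [^] (p ^ m) = \<one>\<close> unfolding int_pow_int .
  then have "int p ^ m \<in> ?I" using subgroup.one_closed[OF subgroup_cyc[OF z]] by simp
  then obtain r where "\<And>a. a \<in> ?I \<longleftrightarrow> int p ^ r dvd a"
    using int_ideal_prime_power[OF p diff] by blast
  then have r: "\<And>a. x [^] (a::int) \<in> cyc z \<longleftrightarrow> int p ^ r dvd a" by simp
  interpret C: class2_pgroup G x y z p r
    by unfold_locales (use p yp zp zne r in auto)
  have "z \<in> V" if V: "V \<lhd> G" "V \<noteq> {\<one>}" for V
  proof -
    have Vs: "subgroup V G" using V(1) by (rule normal_imp_subgroup)
    have root: "z \<in> V" if k: "z [^] (k::int) \<in> V" "\<not> int p dvd k" for k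
    proof -
      obtain t :: int where "(z [^] k) [^] t = z" using prime_order_root[OF p z zp k(2)] by blast
      then show ?thesis using subgroup_int_pow_closed[OF Vs k(1), of t] by simp
    qed
    show ?thesis
    proof (cases "\<exists>a b c. T.nf a b c \<in> V \<and> \<not> (int p dvd a \<and> int p dvd b)")
      case True
      then obtain a b c where v: "T.nf a b c \<in> V" and ab: "\<not> int p dvd a \<or> \<not> int p dvd b" by blast
      \<comment> \<open>Commutators with \<open>y\<close> and \<open>x\<close> put
        \<open>z [^] a\<close> and \<open>z [^] (- b)\<close> into \<open>V\<close>, and one of
        these exponents is prime to \<open>p\<close>.\<close>
      have "z [^] (a * b' - a' * b) \<in> V" for a' b'
      proof -
        have "T.nf a' b' 0 \<otimes> T.nf a b c \<otimes> inv (T.nf a' b' 0) \<in> V"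
          using normal.inv_op_closed2[OF V(1) _ v] by simp
        then have "T.nf a b (c + a * b' - a' * b) \<otimes> inv (T.nf a b c) \<in> V"
          unfolding T.nf_conj using v subgroup.m_closed[OF Vs] subgroup.m_inv_closed[OF Vs] by simp
        then show ?thesis unfolding T.nf_inv T.nf_mult T.nf_zpow[symmetric] by (simp add: algebra_simps)
      qed
      from this[of 1 0] this[of 0 1] have "z [^] a \<in> V" "z [^] (- b) \<in> V" by simp_all
      then show ?thesis using root ab by (metis dvd_minus_iff)
    next
      case False
      \<comment> \<open>All \<open>x\<close> and \<open>y\<close> exponents in \<open>V\<close> are
        multiples of \<open>p\<close>, so \<open>V\<close> is central. Its product with the powers
        of \<open>y\<close> is then normal and contains \<open>y \<otimes> inv z\<close>; by
        \<open>y_indep\<close> the power of \<open>y\<close> that remains is trivial, which forces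
        \<open>z\<close> into \<open>V\<close>.\<close>
      have cen: "g \<otimes> v = v \<otimes> g" if g: "g \<in> carrier G" and v: "v \<in> V" for g v
      proof -
        obtain a b c where vn: "v = T.nf a b c" using T.nf_cases subgroup.mem_carrier[OF Vs v] by metis
        obtain a' b' c' where gn: "g = T.nf a' b' c'" using T.nf_cases g by metis
        have "int p dvd a" "int p dvd b" using False v vn by blast+
        then have "z [^] (a * b' - a' * b) = \<one>" using C.zpow_eq_one_iff by simp
        then show ?thesis unfolding vn gn using T.commute_nf[of a' b' c' a b c] by simp
      qed
      let ?W = "{y [^] (i::int) \<otimes> v | i v. v \<in> V}"
      have "subgroup ?W G" by (rule central_product_subgroup[OF y Vs cen[OF y]])
      moreover have "V \<subseteq> ?W"
      proof
        fix v assume v: "v \<in> V"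
        then have "v = y [^] (0::int) \<otimes> v" using subgroup.mem_carrier[OF Vs v] by simp
        then show "v \<in> ?W" using v by blast
      qed
      ultimately have W: "?W \<lhd> G" by (rule quot[OF V])
      have "y = y [^] (1::int) \<otimes> \<one>" using y by simp
      then have "y \<in> ?W" using subgroup.one_closed[OF Vs] by blast
      then have "x \<otimes> y \<otimes> inv x \<in> ?W" by (rule normal.inv_op_closed2[OF W x])
      then obtain i :: int and v where iv: "y \<otimes> inv z = y [^] i \<otimes> v" and v: "v \<in> V" unfolding xyx' by blast
      have vC: "v \<in> carrier G" using subgroup.mem_carrier[OF Vs v] .
      have "inv (y [^] i) \<otimes> y = v \<otimes> z"
      proof -
        have "inv (y [^] i) \<otimes> (y \<otimes> inv z) = v" unfolding iv using y vC by (simp add: inv_cancel_left)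
        then show ?thesis using y z vC by (simp flip: m_assoc add: inv_solve_right') 
      qed
      then have e: "y [^] (1 - i) = v \<otimes> z"
        using y int_pow_mult[OF y, of "- i" 1] by (simp add: int_pow_neg)
      have "x \<otimes> (v \<otimes> z) = (v \<otimes> z) \<otimes> x"
        using cen[OF x v] zcen[OF x] x vC z by (metis m_assoc)
      then have "int p dvd 1 - i" using y_indep[OF _ yp] e by metis
      then have "v \<otimes> z = \<one>" using int_pow_zero_dvd[OF y yp] e by metis
      then have "z = inv v" using inv_equality vC z by (metis inv_inv)
      then show ?thesis using subgroup.m_inv_closed[OF Vs v] by simp
    qed
  qed
  then show thesis using that C.class2_pgroup_axioms by blast
qed

end

section \<open>Sections\<close>

lemma (in group) finite_sections:
  assumes "finite (carrier G)"
  shows "finite {d_prime (G\<lparr>carrier := H\<rparr> Mod K) | H K. subgroup H G \<and> K \<lhd> G\<lparr>carrier := H\<rparr>}"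
proof (rule finite_subset)
  show "{d_prime (G\<lparr>carrier := H\<rparr> Mod K) | H K. subgroup H G \<and> K \<lhd> G\<lparr>carrier := H\<rparr>}
    \<subseteq> (\<lambda>(H, K). d_prime (G\<lparr>carrier := H\<rparr> Mod K)) ` (Pow (carrier G) \<times> Pow (carrier G))"
  proof
    fix d assume "d \<in> {d_prime (G\<lparr>carrier := H\<rparr> Mod K) | H K. subgroup H G \<and> K \<lhd> G\<lparr>carrier := H\<rparr>}"
    then obtain H K where d: "d = d_prime (G\<lparr>carrier := H\<rparr> Mod K)" and HK: "subgroup H G" "K \<lhd> G\<lparr>carrier := H\<rparr>"
      by blast
    have H: "H \<subseteq> carrier G" using subgroup.subset[OF HK(1)] .
    have "K \<subseteq> H" using subgroup.subset[OF normal_imp_subgroup[OF HK(2)]] by simp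
    then have "(H, K) \<in> Pow (carrier G) \<times> Pow (carrier G)" using H by auto
    then show "d \<in> (\<lambda>(H, K). d_prime (G\<lparr>carrier := H\<rparr> Mod K)) ` (Pow (carrier G) \<times> Pow (carrier G))"
      using d by (metis (mono_tags, lifting) case_prod_conv rev_image_eqI)
  qed
qed (use assms in simp)

lemma (in group) d_star_le:
  assumes "finite (carrier G)" "subgroup H G" "K \<lhd> G\<lparr>carrier := H\<rparr>"
  shows "d_star G \<le> d_prime (G\<lparr>carrier := H\<rparr> Mod K)"
  unfolding d_star_def by (rule Min_le[OF finite_sections[OF assms(1)]]) (use assms in blast)

lemma (in group) d_star_ge:
  assumes "finite (carrier G)"
    and "\<And>H K. subgroup H G \<Longrightarrow> K \<lhd> G\<lparr>carrier := H\<rparr> \<Longrightarrow> d \<le> d_prime (G\<lparr>carrier := H\<rparr> Mod K)"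
  shows "d \<le> d_star G"
proof -
  have "{\<one>} \<lhd> G\<lparr>carrier := carrier G\<rparr>" using one_is_normal by simp
  then have "{d_prime (G\<lparr>carrier := H\<rparr> Mod K) | H K. subgroup H G \<and> K \<lhd> G\<lparr>carrier := H\<rparr>} \<noteq> {}"
    using subgroup_self by blast
  then show ?thesis
    unfolding d_star_def using finite_sections[OF assms(1)] assms(2) by (subst Min_ge_iff) auto
qed

lemma (in normal) Union_image_rcosets:
  assumes "subgroup U G" "H \<subseteq> U"
  shows "\<Union>((\<lambda>g. H #> g) ` U) = U"
proof
  have UC: "u \<in> carrier G" if "u \<in> U" for u by (rule subgroup.mem_carrier[OF assms(1) that])
  show "\<Union>((\<lambda>g. H #> g) ` U) \<subseteq> U"
    using assms(2) subgroup.m_closed[OF assms(1)] unfolding r_coset_def by blast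
  show "U \<subseteq> \<Union>((\<lambda>g. H #> g) ` U)"
    using rcos_self[OF UC subgroup_axioms] by blast
qed

lemma (in normal) image_rcosets_Union:
  assumes "subgroup A (G Mod H)"
  shows "(\<lambda>g. H #> g) ` \<Union>A = A"
proof -
  have "A \<subseteq> (\<lambda>g. H #> g) ` carrier G"
    using subgroup.subset[OF assms] by (simp add: carrier_FactGroup)
  then show ?thesis unfolding factgroup_subgroup_union_char[OF assms] by auto
qed

text \<open>With this correspondence, normality in a section is decided among overgroups of
  \<open>H\<close> in the group above.\<close>

lemma (in normal) normal_FactGroup_iff:
  assumes "subgroup A (G Mod H)"
  shows "A \<lhd> G Mod H \<longleftrightarrow> \<Union>A \<lhd> G"
proof
  assume "\<Union>A \<lhd> G"
  moreover have "group_hom G (G Mod H) (\<lambda>g. H #> g)"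
    using factorgroup_is_group r_coset_hom_Mod is_group by (simp add: group_hom_def group_hom_axioms_def)
  ultimately have "(\<lambda>g. H #> g) ` \<Union>A \<lhd> G Mod H"
    by (rule normal.surj_hom_normal_subgroup) (simp add: carrier_FactGroup)
  then show "A \<lhd> G Mod H" by (simp add: image_rcosets_Union[OF assms])
qed (rule factgroup_subgroup_union_normal)

text \<open>Minimising the subgroup \<open>H\<close> first and then maximising \<open>K\<close> makes all proper subgroups and
  proper quotients of the section Dedekind, and avoids sections of sections.\<close>

lemma (in group) non_dedekind_section:
  assumes p: "Factorial_Ring.prime p" and ord: "order G = p ^ n" and nd: "\<not> dedekind_group G"
  obtains H K m x y z r where "subgroup H G" "K \<lhd> G\<lparr>carrier := H\<rparr>" "m \<le> n"
    "order (G\<lparr>carrier := H\<rparr> Mod K) = p ^ m"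
    "class2_pgroup (G\<lparr>carrier := H\<rparr> Mod K) x y z p r"
    "\<And>V. V \<lhd> G\<lparr>carrier := H\<rparr> Mod K \<Longrightarrow> V \<noteq> {\<one>\<^bsub>G\<lparr>carrier := H\<rparr> Mod K\<^esub>} \<Longrightarrow> z \<in> V"
proof -
  have fin: "finite (carrier G)" using ord prime_gt_0_nat[OF p] order_gt_0_iff_finite by simp
  have "subgroup (carrier G) G \<and> \<not> dedekind_group (G\<lparr>carrier := carrier G\<rparr>)"
    using nd subgroup_self by simp
  then obtain H where H: "subgroup H G" "\<not> dedekind_group (G\<lparr>carrier := H\<rparr>)"
    and Hmin: "\<And>L. subgroup L G \<Longrightarrow> \<not> dedekind_group (G\<lparr>carrier := L\<rparr>) \<Longrightarrow> card H \<le> card L"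
    using ex_has_least_nat[of "\<lambda>H. subgroup H G \<and> \<not> dedekind_group (G\<lparr>carrier := H\<rparr>)" _ card] by blast
  define A where "A = G\<lparr>carrier := H\<rparr>"
  have cA: "carrier A = H" by (simp add: A_def)
  interpret A: group A unfolding A_def using H(1) by (rule subgroup_imp_group)
  have finH: "finite H" using fin subgroup.subset[OF H(1)] finite_subset by blast
  \<comment> \<open>\<open>Q K\<close> expresses, inside \<open>A\<close>, that the quotient by
    \<open>K\<close> is not Dedekind.\<close>
  define Q where "Q K \<longleftrightarrow> K \<lhd> A \<and> (\<exists>U. subgroup U A \<and> K \<subseteq> U \<and> \<not> U \<lhd> A)" for K
  have Qsub: "K \<subseteq> H" if "Q K" for K
    using that subgroup.subset[OF normal_imp_subgroup] cA unfolding Q_def by blast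
  obtain U where U: "subgroup U A" "\<not> U \<lhd> A"
    using H(2) A.group_axioms unfolding dedekind_group_def A_def by blast
  then have "Q {\<one>\<^bsub>A\<^esub>}" unfolding Q_def using A.one_is_normal subgroup.one_closed[OF U(1)] by blast
  moreover have "\<forall>K. Q K \<longrightarrow> card K < Suc (card H)" using Qsub card_mono[OF finH] by (simp add: less_Suc_eq_le)
  ultimately obtain K where K: "Q K" and Kmax: "\<And>L. Q L \<Longrightarrow> card L \<le> card K"
    using ex_has_greatest_nat[of Q _ card "Suc (card H)"] by blast
  have KA: "K \<lhd> A" using K Q_def by blast
  interpret N: normal K A by (rule KA)
  define S where "S = A Mod K"
  interpret S: group S unfolding S_def by (rule N.factorgroup_is_group)
  have cS: "carrier S = (\<lambda>h. K #>\<^bsub>A\<^esub> h) ` H" unfolding S_def carrier_FactGroup cA ..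
  have "order A dvd order G"
    using lagrange[OF H(1)] unfolding order_def cA by (metis dvd_triv_right)
  moreover have "order S dvd order A"
    using A.lagrange[OF N.is_subgroup] unfolding S_def FactGroup_def order_def by (simp, metis dvd_triv_left)
  ultimately have "order S dvd p ^ n" using ord dvd_trans by metis
  then obtain m where m: "m \<le> n" "order S = p ^ m" using divides_primepow_nat[OF p] by blast
  have ne: "S.nonnormals \<noteq> {}"
  proof -
    obtain U where U: "subgroup U A" "K \<subseteq> U" "\<not> U \<lhd> A" using K unfolding Q_def by blast
    let ?U = "(\<lambda>h. K #>\<^bsub>A\<^esub> h) ` U"
    have "group_hom A S (\<lambda>h. K #>\<^bsub>A\<^esub> h)"
      using N.r_coset_hom_Mod A.group_axioms S.group_axioms
      by (simp add: S_def group_hom_def group_hom_axioms_def)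
    then have sU: "subgroup ?U S" using group_hom.subgroup_img_is_subgroup U(1) by blast
    moreover have "\<not> ?U \<lhd> S"
      using N.normal_FactGroup_iff sU U(3) N.Union_image_rcosets[OF U(1,2)] unfolding S_def by auto
    ultimately show ?thesis by blast
  qed
  \<comment> \<open>The union of a nontrivial \<open>V\<close> is a normal subgroup larger than
    \<open>K\<close>, so by maximality of \<open>K\<close> all its overgroups are normal.\<close>
  have quot: "W \<lhd> S" if V: "V \<lhd> S" "V \<noteq> {\<one>\<^bsub>S\<^esub>}" and W: "subgroup W S" "V \<subseteq> W" for V W
  proof -
    have Vs: "subgroup V S" using V(1) by (rule normal_imp_subgroup)
    have V': "\<Union>V \<lhd> A" using N.factgroup_subgroup_union_normal V(1) unfolding S_def by blast
    have KV: "K \<in> V" using subgroup.one_closed[OF Vs] by (simp add: S_def)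
    then obtain C where C: "C \<in> V" "C \<noteq> K" using V(2) by (auto simp: S_def)
    obtain h where h: "h \<in> H" "C = K #>\<^bsub>A\<^esub> h" using C(1) subgroup.subset[OF Vs] cS by blast
    have "h \<notin> K" using h C(2) N.rcos_const[OF A.group_axioms] by blast
    moreover have "h \<in> C" using h A.rcos_self[OF _ N.subgroup_axioms] cA by simp
    ultimately have "K \<subset> \<Union>V" using KV C(1) by blast
    moreover have "finite (\<Union>V)"
      using finite_subset[OF subgroup.subset[OF normal_imp_subgroup[OF V']]] finH cA by simp
    ultimately have "card K < card (\<Union>V)" by (rule psubset_card_mono[rotated])
    then have "\<not> Q (\<Union>V)" using Kmax by (meson not_le)
    moreover have "subgroup (\<Union>W) A" using N.factgroup_subgroup_union_subgroup W(1) unfolding S_def by blast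
    moreover have "\<Union>V \<subseteq> \<Union>W" using W(2) by blast
    ultimately have "\<Union>W \<lhd> A" using V' unfolding Q_def by blast
    then show ?thesis using N.normal_FactGroup_iff W(1) unfolding S_def by blast
  qed
  \<comment> \<open>A proper subgroup of the section lifts to a proper subgroup of \<open>H\<close>,
    which is Dedekind by minimality of \<open>H\<close>.\<close>
  have gen: "x \<otimes>\<^bsub>S\<^esub> y \<otimes>\<^bsub>S\<^esub> inv\<^bsub>S\<^esub> x \<in> S.cyc y"
    if x: "x \<in> carrier S" and y: "y \<in> carrier S" and ng: "generate S {x, y} \<noteq> carrier S" for x y
  proof -
    let ?L = "generate S {x, y}"
    have sL: "subgroup ?L S" using S.generate_is_subgroup x y by simp
    have xL: "x \<in> ?L" and yL: "y \<in> ?L" by (auto intro: generate.incl)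
    have L: "subgroup (\<Union>?L) A" using N.factgroup_subgroup_union_subgroup sL unfolding S_def by blast
    have LG: "subgroup (\<Union>?L) G" using incl_subgroup[OF H(1)] L unfolding A_def by blast
    have "\<Union>?L \<noteq> H"
    proof
      assume "\<Union>?L = H"
      then have "?L = carrier S" using N.image_rcosets_Union[of ?L] sL cS unfolding S_def by simp
      then show False using ng by simp
    qed
    then have "\<Union>?L \<subset> H" using subgroup.subset[OF L] cA by blast
    then have "card (\<Union>?L) < card H" by (rule psubset_card_mono[OF finH])
    then have ded: "dedekind_group (G\<lparr>carrier := \<Union>?L\<rparr>)" using Hmin[OF LG] by (meson not_le)
    have sY: "subgroup (S.cyc y) S" by (rule S.subgroup_cyc[OF y])
    let ?Y = "\<Union>(S.cyc y)"
    have YA: "subgroup ?Y A" using N.factgroup_subgroup_union_subgroup sY unfolding S_def by blast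
    have YG: "subgroup ?Y G" using incl_subgroup[OF H(1)] YA unfolding A_def by blast
    have "?Y \<subseteq> \<Union>?L" using S.cyc_subset[OF sL yL] by blast
    then have "subgroup ?Y (G\<lparr>carrier := \<Union>?L\<rparr>)" by (rule subgroup_incl[OF YG LG])
    then have Yn: "?Y \<lhd> G\<lparr>carrier := \<Union>?L\<rparr>" using ded unfolding dedekind_group_def by blast
    obtain a where a: "a \<in> H" "x = K #>\<^bsub>A\<^esub> a" using x unfolding cS by (elim imageE)
    obtain b where b: "b \<in> H" "y = K #>\<^bsub>A\<^esub> b" using y unfolding cS by (elim imageE)
    have "a \<in> x" using A.rcos_self[OF _ N.subgroup_axioms, of a] a cA by simp
    then have aL: "a \<in> \<Union>?L" using xL by (rule UnionI[rotated])
    have "b \<in> y" using A.rcos_self[OF _ N.subgroup_axioms, of b] b cA by simp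
    then have bY: "b \<in> ?Y" using S.self_in_cyc[OF y] by (rule UnionI[rotated])
    have "a \<otimes> b \<otimes> inv a \<in> ?Y"
      using normal.inv_op_closed2[OF Yn _ bY, of a] aL m_inv_consistent[OF LG aL] by simp
    then have "a \<otimes>\<^bsub>A\<^esub> b \<otimes>\<^bsub>A\<^esub> inv\<^bsub>A\<^esub> a \<in> ?Y"
      using m_inv_consistent[OF H(1) a(1)] by (simp add: A_def)
    then have "K #>\<^bsub>A\<^esub> (a \<otimes>\<^bsub>A\<^esub> b \<otimes>\<^bsub>A\<^esub> inv\<^bsub>A\<^esub> a) \<in> S.cyc y"
      using N.factgroup_subgroup_union_char[of "S.cyc y"] sY unfolding S_def by blast
    moreover have "K #>\<^bsub>A\<^esub> (a \<otimes>\<^bsub>A\<^esub> b \<otimes>\<^bsub>A\<^esub> inv\<^bsub>A\<^esub> a) = x \<otimes>\<^bsub>S\<^esub> y \<otimes>\<^bsub>S\<^esub> inv\<^bsub>S\<^esub> x"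
    proof -
      have "group_hom A S (\<lambda>h. K #>\<^bsub>A\<^esub> h)"
        using N.r_coset_hom_Mod A.group_axioms S.group_axioms
        by (simp add: S_def group_hom_def group_hom_axioms_def)
      then interpret h: group_hom A S "\<lambda>h. K #>\<^bsub>A\<^esub> h" .
      have "a \<in> carrier A" "b \<in> carrier A" using a b cA by auto
      then show ?thesis unfolding a(2) b(2) by simp
    qed
    ultimately show ?thesis by simp
  qed
  show thesis
  proof (rule S.minimal_non_dedekind_structure[OF p m(2) ne quot gen])
    fix x y z r
    assume *: "class2_pgroup S x y z p r" "\<And>V. V \<lhd> S \<Longrightarrow> V \<noteq> {\<one>\<^bsub>S\<^esub>} \<Longrightarrow> z \<in> V"
    show thesis
      by (rule that[OF H(1) KA[unfolded A_def] m(1) m(2)[unfolded S_def A_def] *[unfolded S_def A_def]])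
  qed
qed

section \<open>Upper bounds for the ratio of the minimal section\<close>

context class2_pgroup
begin

text \<open>A normal \<open>cyc w\<close> would contain the nontrivial commutator of
  \<open>g\<close> and \<open>w\<close>, hence \<open>z\<close>. Having order \<open>p\<close>, it
  would consist of the powers of \<open>z\<close>, and \<open>w\<close> would be central.\<close>

lemma noncentral_prime_order_nonnormal:
  assumes w: "w \<in> carrier G" "w [^] p = \<one>" and g: "g \<in> carrier G" "g \<otimes> w \<noteq> w \<otimes> g"
  shows "\<not> cyc w \<lhd> G"
proof
  assume n: "cyc w \<lhd> G"
  have sw: "subgroup (cyc w) G" by (rule subgroup_cyc[OF w(1)])
  obtain a b c where wn: "w = nf a b c" using nf_cases[OF w(1)] .
  obtain a' b' c' where gn: "g = nf a' b' c'" using nf_cases[OF g(1)] .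
  define k where "k = a * b' - a' * b"
  have k: "\<not> int p dvd k" using g(2) zpow_eq_one_iff[of k] commute_nf[of a' b' c' a b c] unfolding wn gn k_def by auto
  have "g \<otimes> w \<otimes> inv g \<in> cyc w" by (rule normal.inv_op_closed2[OF n g(1) self_in_cyc[OF w(1)]])
  then have "g \<otimes> w \<otimes> inv g \<otimes> inv w \<in> cyc w"
    by (rule subgroup.m_closed[OF sw _ subgroup.m_inv_closed[OF sw self_in_cyc[OF w(1)]]])
  moreover have "g \<otimes> w \<otimes> inv g \<otimes> inv w = z [^] k"
    unfolding gn wn nf_conj unfolding nf_inv nf_mult nf_zpow[symmetric] by (simp add: k_def algebra_simps)
  ultimately have "z [^] k \<in> cyc w" by simp
  moreover obtain t :: int where "(z [^] k) [^] t = z" using prime_order_root[OF prime_p zC zp k] by blast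
  ultimately have "z \<in> cyc w" using subgroup_int_pow_closed[OF sw] by metis
  then obtain l :: int where l: "z = w [^] l" by blast
  have "\<not> int p dvd l" using int_pow_zero_dvd[OF w] l z_ne by metis
  then obtain t :: int where "z [^] t = w" using prime_order_root[OF prime_p w] l by metis
  then show False using zpow_central[OF g(1), of t] g(2) by simp
qed

lemma xy_noncommuting: "x \<otimes> y \<noteq> y \<otimes> x"
  unfolding yx using z_ne by simp

lemma nonnormals_nonempty: "nonnormals \<noteq> {}"
  using noncentral_prime_order_nonnormal[OF yC yp xC xy_noncommuting] subgroup_cyc[OF yC] by blast

lemma card_normals_le:
  assumes fin: "finite (carrier G)" and norm: "\<And>V. V \<lhd> G \<Longrightarrow> V \<noteq> {\<one>} \<Longrightarrow> z \<in> V"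
  shows "card normals \<le> r * (p + 1) + 3"
proof -
  have "normals \<subseteq> insert {\<one>} {B. subgroup B G \<and> z \<in> B}"
    using norm normal_imp_subgroup by blast
  then have "card normals \<le> card (insert {\<one>} {B. subgroup B G \<and> z \<in> B})"
    using finite_subgroups[OF fin] by (intro card_mono) auto
  also have "\<dots> \<le> Suc (r * (p + 1) + 2)"
    unfolding card_overgroups[symmetric] using finite_subgroups[OF fin] by (simp add: card_insert_if)
  finally show ?thesis by simp
qed

lemma minimal_d_prime_le:
  assumes ord: "order G = p ^ m" and "m \<le> n" and norm: "\<And>V. V \<lhd> G \<Longrightarrow> V \<noteq> {\<one>} \<Longrightarrow> z \<in> V"
  shows "d_prime G \<le> 1 - (real p - 1) / real ((n - 1) * (p + 1) + 2)"
proof (rule p_group_d_prime_le[OF prime_p ord nonnormals_nonempty])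
  have fin: "finite (carrier G)" using ord p_gt_1 order_gt_0_iff_finite by simp
  have "p ^ (r + 2) \<le> p ^ m" using card_ge[OF fin] ord by simp
  then have "r + 2 \<le> n" using p_gt_1 \<open>m \<le> n\<close> by (meson le_trans power_le_imp_le_exp)
  \<comment> \<open>At most \<open>r(p + 1) + 3\<close> normal subgroups plus \<open>p\<close> make
    at most \<open>(r + 1)(p + 1) + 2\<close>.\<close>
  then have "(r + 1) * (p + 1) \<le> (n - 1) * (p + 1)" by (intro mult_le_mono1) simp
  then show "card normals + p \<le> (n - 1) * (p + 1) + 2"
    using card_normals_le[OF fin norm] by simp
qed

text \<open>Since \<open>r \<le> 1\<close>, there are at most six normal subgroups. Four noncentral
  involutions \<open>y\<close>, \<open>y \<otimes> z\<close>, \<open>w\<close>,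
  \<open>w \<otimes> z\<close> provide four nonnormal ones, and the classes of these number at most
  half, so the ratio is at most \<open>(6 + 2) / (6 + 4)\<close>. The noncentral involution
  \<open>y\<close> is what rules out the quaternion group.\<close>

lemma minimal_d_prime_le_order_8:
  assumes "p = 2" and ord: "order G = 2 ^ m" and "m \<le> 3"
    and norm: "\<And>V. V \<lhd> G \<Longrightarrow> V \<noteq> {\<one>} \<Longrightarrow> z \<in> V"
  shows "d_prime G \<le> 4 / 5"
proof -
  have fin: "finite (carrier G)" using ord order_gt_0_iff_finite by simp
  have "(2::nat) ^ (r + 2) \<le> 2 ^ m" using card_ge[OF fin] ord \<open>p = 2\<close> by simp
  then have "r + 2 \<le> m" using power_increasing_iff[of "2::nat" "r + 2" m] by simp
  then have r: "r \<le> 1" using \<open>m \<le> 3\<close> by simp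
  then have nu: "card normals \<le> 6" using card_normals_le[OF fin norm] \<open>p = 2\<close> by simp
  have "x [^] (2::int) \<in> cyc z" using x_z[of 2] r \<open>p = 2\<close> by (cases r) auto
  then obtain c :: int where c: "x [^] (2::int) = z [^] c" by blast
  \<comment> \<open>The square of \<open>x\<close> is \<open>1\<close> or \<open>z\<close> by the
    parity of \<open>c\<close>. In the first case \<open>x\<close> serves; in the second
    \<open>x \<otimes> y\<close> does, as its square picks up one more factor
    \<open>z\<close>.\<close>
  have "\<exists>w\<in>carrier G. w [^] p = \<one> \<and> y \<otimes> w \<noteq> w \<otimes> y"
  proof (cases "even c")
    case True
    then have "x [^] (2::int) = \<one>" using c zpow_eq_one_iff[of c] \<open>p = 2\<close> by simp
    then have "x [^] p = \<one>" using int_pow_int[of G x 2] \<open>p = 2\<close> by simp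
    then show ?thesis using xy_noncommuting by (metis xC)
  next
    case False
    let ?w = "nf 1 1 0"
    have "?w [^] p = nf 2 2 1" using nf_nat_pow[of 1 1 2] \<open>p = 2\<close> by simp
    also have "\<dots> = z [^] (c + 1)"
      using int_pow_zero_dvd[OF yC yp, of 2] c \<open>p = 2\<close> by (simp add: nf_def int_pow_mult)
    also have "\<dots> = \<one>" using zpow_eq_one_iff False \<open>p = 2\<close> by simp
    finally have "?w [^] p = \<one>" .
    moreover have "y \<otimes> ?w \<noteq> ?w \<otimes> y"
      using commute_nf[of 0 1 0 1 1 0] z_ne by (simp add: nf_y nf_zpow[symmetric]) (simp add: nf_zpow)
    ultimately show ?thesis by (metis nf_closed)
  qed
  then obtain w where w: "w \<in> carrier G" "w [^] p = \<one>" "y \<otimes> w \<noteq> w \<otimes> y" by blast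
  let ?E = "{y, y \<otimes> z, w, w \<otimes> z}"
  have yz: "y \<otimes> (y \<otimes> z) = (y \<otimes> z) \<otimes> y" using z_central[OF yC] by (metis m_assoc yC zC)
  have ywz: "y \<otimes> (w \<otimes> z) \<noteq> (w \<otimes> z) \<otimes> y"
  proof
    assume "y \<otimes> (w \<otimes> z) = (w \<otimes> z) \<otimes> y"
    then have "(y \<otimes> w) \<otimes> z = (w \<otimes> y) \<otimes> z" using z_central[OF yC] w(1) by (simp add: m_assoc)
    then show False using w by simp
  qed
  have xyz: "x \<otimes> (y \<otimes> z) \<noteq> (y \<otimes> z) \<otimes> x"
  proof
    assume "x \<otimes> (y \<otimes> z) = (y \<otimes> z) \<otimes> x"
    then have "(x \<otimes> y) \<otimes> z = (y \<otimes> x) \<otimes> z" using z_central[OF xC] by (simp add: m_assoc)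
    then show False using xy_noncommuting by simp
  qed
  have ne: "g \<noteq> g \<otimes> z" if "g \<in> carrier G" for g using z_ne that by (metis l_cancel_one' zC)
  have "y \<noteq> w" "y \<noteq> w \<otimes> z" "y \<otimes> z \<noteq> w" "y \<otimes> z \<noteq> w \<otimes> z"
    using w(3) ywz yz by metis+
  then have card4: "card ?E = 4" using ne[OF yC] ne[OF w(1)] by simp
  have sq: "(g \<otimes> z) [^] p = \<one>" if "g \<in> carrier G" "g [^] p = \<one>" for g
    using that z_central[OF that(1)] pow_mult_distrib[of g z p] zp by simp
  have E: "e \<in> carrier G \<and> e [^] p = \<one> \<and> (\<exists>g\<in>carrier G. g \<otimes> e \<noteq> e \<otimes> g)" if e: "e \<in> ?E" for e
  proof -
    consider "e = y" | "e = y \<otimes> z" | "e = w" | "e = w \<otimes> z" using e by blast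
    then show ?thesis
    proof cases
      case 1
      then show ?thesis using yp xy_noncommuting xC yC by metis
    next
      case 2
      then show ?thesis using sq[OF yC yp] xyz xC yC by (metis m_closed zC)
    next
      case 3
      then show ?thesis using w yC by metis
    next
      case 4
      then show ?thesis using sq[OF w(1,2)] ywz w(1) yC by (metis m_closed zC)
    qed
  qed
  have cyc2: "cyc e = {\<one>, e}" if e: "e \<in> ?E" for e
  proof
    have e': "e \<in> carrier G" "e [^] p = \<one>" using E[OF e] by auto
    show "{\<one>, e} \<subseteq> cyc e"
      using self_in_cyc[OF e'(1)] subgroup.one_closed[OF subgroup_cyc[OF e'(1)]] by simp
    show "cyc e \<subseteq> {\<one>, e}"
    proof
      fix v assume "v \<in> cyc e"
      then obtain k :: int where k: "v = e [^] k" by blast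
      show "v \<in> {\<one>, e}"
      proof (cases "even k")
        case True
        then show ?thesis using int_pow_zero_dvd[OF e', of k] k \<open>p = 2\<close> by simp
      next
        case False
        then have "e [^] (k - 1) = \<one>" using int_pow_zero_dvd[OF e', of "k - 1"] \<open>p = 2\<close> by simp
        then show ?thesis using k int_pow_mult[OF e'(1), of "k - 1" 1] e' by simp
      qed
    qed
  qed
  have "inj_on cyc ?E"
  proof (rule inj_onI)
    fix e e' assume e: "e \<in> ?E" "e' \<in> ?E" and eq: "cyc e = cyc e'"
    have "e \<noteq> \<one>" "e' \<noteq> \<one>" using E[OF e(1)] E[OF e(2)] by auto
    then show "e = e'" using eq unfolding cyc2[OF e(1)] cyc2[OF e(2)] by auto
  qed
  then have cE: "card (cyc ` ?E) = 4" using card4 by (simp only: card_image)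
  have "cyc e \<in> nonnormals" if "e \<in> ?E" for e
    using E[OF that] noncentral_prime_order_nonnormal[of e] subgroup_cyc[of e] by auto
  then have "cyc ` ?E \<subseteq> nonnormals" by (rule image_subsetI)
  then have q: "4 \<le> card nonnormals"
    unfolding cE[symmetric] by (rule card_mono[OF finite_subgroups[OF fin]])
  have k: "2 * card (conj_class ` nonnormals) \<le> card nonnormals"
    using p_group_classes_bound[OF prime_p] ord \<open>p = 2\<close> by blast
  have "5 * (a + c) \<le> 4 * (a + b)" if "a \<le> 6" "4 \<le> b" "2 * c \<le> b" for a b c :: real
    using that by argo
  moreover have "real (card normals) \<le> real 6" "real 4 \<le> real (card nonnormals)"
    "real (2 * card (conj_class ` nonnormals)) \<le> real (card nonnormals)"
    using nu q k by (simp_all only: of_nat_le_iff)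
  then have "real (card normals) \<le> 6" "4 \<le> real (card nonnormals)"
    "2 * real (card (conj_class ` nonnormals)) \<le> real (card nonnormals)"
    by (simp_all only: of_nat_mult of_nat_numeral)
  ultimately have "5 * (real (card normals) + real (card (conj_class ` nonnormals)))
      \<le> 4 * (real (card normals) + real (card nonnormals))" by blast
  then show ?thesis unfolding d_prime_eq[OF fin] using card_normals_pos[OF fin] by (simp add: divide_simps)
qed

end

lemma (in group) non_dedekind_d_star_le:
  assumes p: "Factorial_Ring.prime p" and ord: "order G = p ^ n" and nd: "\<not> dedekind_group G"
  shows "d_star G \<le> 1 - (real p - 1) / real ((n - 1) * (p + 1) + 2)"
    and "p = 2 \<Longrightarrow> n = 3 \<Longrightarrow> d_star G \<le> 4 / 5"
proof -
  have fin: "finite (carrier G)" using ord prime_gt_0_nat[OF p] order_gt_0_iff_finite by simp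
  obtain H K m x y z r where HK: "subgroup H G" "K \<lhd> G\<lparr>carrier := H\<rparr>" and m: "m \<le> n"
    "order (G\<lparr>carrier := H\<rparr> Mod K) = p ^ m"
    and C: "class2_pgroup (G\<lparr>carrier := H\<rparr> Mod K) x y z p r"
      "\<And>V. V \<lhd> G\<lparr>carrier := H\<rparr> Mod K \<Longrightarrow> V \<noteq> {\<one>\<^bsub>G\<lparr>carrier := H\<rparr> Mod K\<^esub>} \<Longrightarrow> z \<in> V"
    using non_dedekind_section[OF p ord nd] by blast
  note le = d_star_le[OF fin HK]
  show "d_star G \<le> 1 - (real p - 1) / real ((n - 1) * (p + 1) + 2)"
    using le class2_pgroup.minimal_d_prime_le[OF C(1) m(2,1) C(2)] by linarith
  show "d_star G \<le> 4 / 5" if "p = 2" "n = 3"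
    using le class2_pgroup.minimal_d_prime_le_order_8[OF C(1) that(1) _ _ C(2), of m] m that by simp
qed

section \<open>Ingredients of the lower bound\<close>

context class2_pgroup
begin

text \<open>If \<open>z\<close> is not in \<open>B\<close>, commutators in \<open>B\<close> are
  powers of \<open>z\<close>, and a nontrivial one would generate \<open>z\<close>. As proper
  subgroups are abelian, only quotients of the whole group can lower \<open>d_star\<close>.\<close>

lemma proper_subgroup_commute:
  assumes B: "subgroup B G" "B \<noteq> carrier G" and gh: "g \<in> B" "h \<in> B"
  shows "g \<otimes> h = h \<otimes> g"
proof (cases "z \<in> B")
  case True
  then show ?thesis using overgroup_commute B gh by blast
next
  case False
  have g: "g \<in> carrier G" and h: "h \<in> carrier G" using subgroup.mem_carrier[OF B(1)] gh by auto
  obtain a b c where gn: "g = nf a b c" using nf_cases[OF g] .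
  obtain a' b' c' where hn: "h = nf a' b' c'" using nf_cases[OF h] .
  define k where "k = a' * b - a * b'"
  have e: "g \<otimes> h = h \<otimes> g \<otimes> z [^] k" unfolding gn hn k_def by (rule commute_nf)
  have "inv (h \<otimes> g) \<otimes> (g \<otimes> h) = z [^] k" unfolding e using g h by (simp add: inv_cancel_left)
  moreover have "inv (h \<otimes> g) \<otimes> (g \<otimes> h) \<in> B"
    using gh by (simp add: subgroup.m_closed[OF B(1)] subgroup.m_inv_closed[OF B(1)])
  ultimately have zk: "z [^] k \<in> B" by simp
  have "int p dvd k"
  proof (rule ccontr)
    assume "\<not> int p dvd k"
    then obtain t :: int where "(z [^] k) [^] t = z" using prime_order_root[OF prime_p zC zp] by blast
    then show False using subgroup_int_pow_closed[OF B(1) zk, of t] False by simp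
  qed
  then show ?thesis using e zpow_eq_one_iff g h by simp
qed

lemma card_normals_ge:
  assumes fin: "finite (carrier G)"
  shows "r * (p + 1) + 3 \<le> card normals"
proof -
  have "insert {\<one>} {B. subgroup B G \<and> z \<in> B} \<subseteq> normals"
    using one_is_normal normal_if_z by blast
  then have "card (insert {\<one>} {B. subgroup B G \<and> z \<in> B}) \<le> card normals"
    by (rule card_mono[OF finite_normals[OF fin]])
  then show ?thesis
    using z_ne finite_subgroups[OF fin] card_overgroups by (simp add: card_insert_if)
qed

end

section \<open>The relations of the modular and dihedral groups\<close>

locale m_relations = group G for G (structure) +
  fixes x y and p n :: nat
  assumes xG [simp, intro]: "x \<in> carrier G" and yG [simp, intro]: "y \<in> carrier G"
    and prime: "Factorial_Ring.prime p" and n3: "n \<ge> 3"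
    and x_pow: "x [^] (p ^ (n - 1)) = \<one>" and y_pow: "y [^] p = \<one>"
    and y_x: "y \<otimes> x = x [^] (p ^ (n - 2) + 1) \<otimes> y"
    and generated: "carrier G = generate G {x, y}"
begin

definition q :: int where "q = int p ^ (n - 2)"

definition z where "z = x [^] q"

lemma z_closed [simp]: "z \<in> carrier G" by (simp add: z_def)

lemma x_int_pow: "x [^] a = \<one>" if "int p ^ (n - 1) dvd a" for a :: int
  using int_pow_zero_dvd[OF xG x_pow] that by simp

lemma q_p: "q * int p = int p ^ (n - 1)"
proof -
  have "n - 1 = Suc (n - 2)" using n3 by simp
  then show ?thesis by (simp add: q_def)
qed

sublocale commutator_triple G x y z
proof unfold_locales
  have yxy: "y \<otimes> x \<otimes> inv y = x [^] (q + 1)"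
  proof -
    have "x [^] (q + 1) = x [^] (p ^ (n - 2) + 1)"
      using int_pow_int[of G x "p ^ (n - 2) + 1"] by (simp add: q_def add.commute)
    then show ?thesis using y_x by (simp add: m_assoc)
  qed
  \<comment> \<open>Conjugation by \<open>y\<close> multiplies \<open>z\<close> by
    \<open>x [^] (q * q)\<close>. This is trivial because \<open>2(n - 2) \<ge> n - 1\<close>, that
    is, \<open>n \<ge> 3\<close>.\<close>
  have "int p ^ (n - 1) dvd q * q"
    unfolding q_def power_add[symmetric] using n3 by (intro le_imp_power_dvd) simp
  then have qq: "x [^] (q * q) = \<one>" by (rule x_int_pow)
  have "y \<otimes> z \<otimes> inv y = x [^] ((q + 1) * q)"
    unfolding z_def using conj_int_pow[OF yG xG, of q] yxy by (simp add: int_pow_pow)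
  also have "\<dots> = x [^] (q * q) \<otimes> z" by (simp add: z_def algebra_simps flip: int_pow_mult)
  finally have "y \<otimes> z \<otimes> inv y = z" using qq by simp
  then have yz: "y \<otimes> z = z \<otimes> y" using inv_solve_right[of z "y \<otimes> z" y] by simp
  have xz: "x \<otimes> z = z \<otimes> x" unfolding z_def by (rule commute_int_pow) auto
  let ?C = "{g \<in> carrier G. g \<otimes> z = z \<otimes> g}"
  have "subgroup ?C G"
  proof
    show "a \<otimes> b \<in> ?C" if "a \<in> ?C" "b \<in> ?C" for a b
      using that by (simp add: m_assoc) (metis m_assoc z_closed)
    show "inv a \<in> ?C" if "a \<in> ?C" for a
      using that commute_int_pow[of z a "- 1"] by (simp add: int_pow_neg)
  qed auto
  moreover have "{x, y} \<subseteq> ?C" using xz yz by simp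
  ultimately have "carrier G \<subseteq> ?C" unfolding generated using generate_subgroup_incl by blast
  then show "g \<otimes> z = z \<otimes> g" if "g \<in> carrier G" for g using that by auto
  have "y \<otimes> x = (y \<otimes> x \<otimes> inv y) \<otimes> y" by (simp add: m_assoc)
  also have "\<dots> = x \<otimes> z \<otimes> y" unfolding yxy z_def using int_pow_mult[OF xG, of 1 q] by (simp add: add.commute)
  finally show "y \<otimes> x = x \<otimes> y \<otimes> z" using yz by (simp add: m_assoc)
  show "carrier G = generate G {x, y}" by (rule generated)
qed auto

lemma nf_reduce: "nf a b c = nf (a + q * c) b 0"
proof -
  have "nf a b c = x [^] a \<otimes> (y [^] b \<otimes> z [^] c)" by (simp add: nf_def m_assoc)
  also have "y [^] b \<otimes> z [^] c = z [^] c \<otimes> y [^] b" by (simp add: zpow_central)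
  also have "x [^] a \<otimes> (z [^] c \<otimes> y [^] b) = x [^] a \<otimes> x [^] (q * c) \<otimes> y [^] b"
    by (simp add: z_def int_pow_pow m_assoc)
  finally show ?thesis by (simp add: nf_def int_pow_mult)
qed

lemma finite_carrier: "finite (carrier G)"
proof (rule finite_subset)
  let ?D = "{0..<int p ^ (n - 1)} \<times> {0..<int p}"
  show "carrier G \<subseteq> (\<lambda>(a, b). nf a b 0) ` ?D"
  proof
    fix g assume "g \<in> carrier G"
    then obtain a b c where g: "g = nf a b c" using nf_cases by metis
    have pos: "int p > 0" using prime_gt_0_nat[OF prime] by simp
    define a' b' where "a' = (a + q * c) mod int p ^ (n - 1)" and "b' = b mod int p"
    have "x [^] (a + q * c - a') = \<one>"
      by (rule x_int_pow) (simp add: a'_def minus_mod_eq_mult_div)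
    then have xa: "x [^] (a + q * c) = x [^] a'" using int_pow_mult[OF xG, of "a + q * c - a'" a'] by simp
    have "y [^] (b - b') = \<one>"
      by (rule int_pow_zero_dvd[OF yG y_pow]) (simp add: b'_def minus_mod_eq_mult_div)
    then have "y [^] b = y [^] b'" using int_pow_mult[OF yG, of "b - b'" b'] by simp
    then have "g = nf a' b' 0" unfolding g nf_reduce[of a b c] using xa by (simp add: nf_def)
    moreover have "(a', b') \<in> ?D" using pos by (simp add: a'_def b'_def)
    ultimately show "g \<in> (\<lambda>(a, b). nf a b 0) ` ?D" by (metis (mono_tags, lifting) case_prod_conv rev_image_eqI)
  qed
qed simp

lemma commute_if_z_trivial:
  assumes "z = \<one>" "g \<in> carrier G" "h \<in> carrier G"
  shows "g \<otimes> h = h \<otimes> g"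
proof -
  obtain a b c where gn: "g = nf a b c" using nf_cases[OF assms(2)] .
  obtain a' b' c' where hn: "h = nf a' b' c'" using nf_cases[OF assms(3)] .
  have "z [^] (a' * b - a * b') = \<one>" unfolding assms(1) by (rule int_pow_one)
  then show ?thesis
    unfolding gn hn commute_nf[of a b c a' b' c'] by (simp only: r_one m_closed nf_closed)
qed

end

section \<open>The relations without collapse\<close>

locale m_nonabelian = m_relations +
  assumes z_nontrivial: "z \<noteq> \<one>"
begin

text \<open>The powers of \<open>z\<close> form the least nontrivial subgroup of the cyclic
  \<open>p\<close>-group of powers of \<open>x\<close>. A subgroup without \<open>z\<close>
  therefore meets that group trivially; the trivial subgroup then yields the exact order of
  \<open>x\<close>.\<close>

lemma xpow_mem_iff:
  assumes B: "subgroup B G" "z \<notin> B"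
  shows "x [^] (a::int) \<in> B \<longleftrightarrow> int p ^ (n - 1) dvd a"
proof -
  let ?I = "{a::int. x [^] a \<in> B}"
  have diff: "a - b \<in> ?I" if "a \<in> ?I" "b \<in> ?I" for a b
    using that subgroup.m_closed[OF B(1)] subgroup.m_inv_closed[OF B(1)] by (simp add: int_pow_diff)
  have "int p ^ (n - 1) \<in> ?I"
    using x_int_pow[of "int p ^ (n - 1)"] subgroup.one_closed[OF B(1)] by simp
  then obtain j where j: "j \<le> n - 1" "\<And>a. a \<in> ?I \<longleftrightarrow> int p ^ j dvd a"
    using int_ideal_prime_power[OF prime diff] by blast
  have "\<not> int p ^ j dvd int p ^ (n - 2)" using B(2) j(2)[of q] by (simp add: z_def q_def)
  then have "\<not> j \<le> n - 2" using le_imp_power_dvd by blast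
  then have "j = n - 1" using j(1) by simp
  then show ?thesis using j(2)[of a] by simp
qed

lemma xpow_eq_one_iff: "x [^] (a::int) = \<one> \<longleftrightarrow> int p ^ (n - 1) dvd a"
  using xpow_mem_iff[OF triv_subgroup, of a] z_nontrivial by simp

sublocale class2_pgroup G x y z p "n - 2"
proof unfold_locales
  show "z [^] p = \<one>"
    using x_int_pow[of "q * int p"] q_p by (simp add: z_def int_pow_pow flip: int_pow_int)
  show "x [^] a \<in> range (\<lambda>c::int. z [^] c) \<longleftrightarrow> int p ^ (n - 2) dvd a" for a :: int
  proof
    assume "x [^] a \<in> range (\<lambda>c::int. z [^] c)"
    then obtain c :: int where "x [^] a = x [^] (q * c)" by (auto simp: z_def int_pow_pow)
    then have "x [^] (a - q * c) = \<one>" by (simp add: int_pow_diff)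
    then have "int p ^ (n - 1) dvd a - q * c" using xpow_eq_one_iff by simp
    then have "q dvd a - q * c" using q_p by (metis dvd_mult_left)
    then have "q dvd (a - q * c) + q * c" by (rule dvd_add) simp
    then show "int p ^ (n - 2) dvd a" by (simp add: q_def)
  next
    assume "int p ^ (n - 2) dvd a"
    then obtain c where "a = q * c" unfolding q_def by (elim dvdE)
    then have "x [^] a = z [^] c" by (simp add: z_def int_pow_pow)
    then show "x [^] a \<in> range (\<lambda>c::int. z [^] c)" by blast
  qed
qed (use prime y_pow z_nontrivial in auto)

text \<open>A nonnormal \<open>B\<close> misses \<open>z\<close>, so it meets the powers of
  \<open>x\<close> trivially and its elements are determined by their \<open>y\<close> exponent
  modulo \<open>p\<close>. Any element with \<open>y\<close> exponent \<open>1\<close> then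
  generates it.\<close>

lemma nonnormal_cases:
  assumes B: "B \<in> nonnormals"
  obtains s where "B = cyc (nf s 1 0)" "(nf s 1 0) [^] p = \<one>"
proof -
  have sB: "subgroup B G" using B by simp
  have zB: "z \<notin> B" using B normal_if_z by blast
  have "B \<noteq> {\<one>}" using B one_is_normal by auto
  have triv: "nf a b c = \<one>" if "nf a b c \<in> B" "int p dvd b" for a b c
  proof -
    have e: "nf a b c = x [^] (a + q * c)"
      unfolding nf_reduce[of a b c] using int_pow_zero_dvd[OF yG y_pow that(2)] by (simp add: nf_def)
    then show ?thesis using that(1) xpow_mem_iff[OF sB zB] xpow_eq_one_iff by metis
  qed
  obtain h where h: "h \<in> B" "h \<noteq> \<one>" using \<open>B \<noteq> {\<one>}\<close> subgroup.one_closed[OF sB] by blast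
  obtain a b c where "h = nf a b c" using nf_cases subgroup.mem_carrier[OF sB h(1)] by metis
  then have h0: "h = nf (a + q * c) b 0" using nf_reduce by simp
  define a0 where "a0 = a + q * c"
  have b: "\<not> int p dvd b" using triv h h0 by metis
  then obtain t0 where t0: "int p dvd t0 * b - 1" using int_inverse_mod_prime[OF prime] by blast
  define t where "t = nat (t0 mod int p)"
  have ti: "int t = t0 mod int p" using prime_gt_0_nat[OF prime] by (simp add: t_def)
  have "t0 * b - 1 - (int t * b - 1) = int p * (t0 div int p * b)"
    unfolding ti by (simp add: minus_mod_eq_mult_div flip: left_diff_distrib)
  then have "int p dvd t0 * b - 1 - (int t * b - 1)" by simp
  then have tb: "int p dvd int t * b - 1" using t0 by (metis dvd_diff_right_iff)
  have yt: "y [^] (int t * b) = y"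
  proof -
    have "y [^] (int t * b) = y [^] (int t * b - 1) \<otimes> y [^] (1::int)"
      using int_pow_mult[OF yG, of "int t * b - 1" 1] by simp
    then show ?thesis using int_pow_zero_dvd[OF yG y_pow tb] by simp
  qed
  obtain d where "h [^] t = nf (int t * a0) (int t * b) d" using nf_nat_pow h0 a0_def by metis
  also have "nf (int t * a0) (int t * b) d = nf (int t * a0) 1 d" by (simp add: nf_def yt)
  also have "\<dots> = nf (int t * a0 + q * d) 1 0" by (rule nf_reduce)
  finally obtain s where "h [^] t = nf s 1 0" by blast
  moreover have "h [^] t \<in> B"
    using subgroup_int_pow_closed[OF sB h(1), of "int t"] by (simp add: int_pow_int)
  ultimately have wB: "nf s 1 0 \<in> B" by simp
  let ?w = "nf s 1 0"
  have wpow: "\<exists>a c. ?w [^] k = nf a k c" for k :: int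
  proof (cases k)
    case (nonneg m)
    then show ?thesis using nf_nat_pow[of s 1 m] by (auto simp: int_pow_int)
  next
    case (neg m)
    then show ?thesis
      using nf_nat_pow[of s 1 "Suc m"] by (auto simp: int_pow_neg_int nf_inv simp del: nat_pow_Suc of_nat_Suc)
  qed
  have "B \<subseteq> cyc ?w"
  proof
    fix g assume g: "g \<in> B"
    then obtain a b c where gn: "g = nf a b c" using nf_cases subgroup.mem_carrier[OF sB] by metis
    obtain a' c' where w: "?w [^] (- b) = nf a' (- b) c'" using wpow by blast
    have "g \<otimes> ?w [^] (- b) \<in> B"
      by (rule subgroup.m_closed[OF sB g subgroup_int_pow_closed[OF sB wB]])
    then have "g \<otimes> ?w [^] (- b) = \<one>" unfolding gn w nf_mult by (rule triv) simp
    moreover have "g \<in> carrier G" using subgroup.mem_carrier[OF sB g] .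
    ultimately have "g = ?w [^] b" by (simp add: int_pow_neg inv_solve_right')
    then show "g \<in> cyc ?w" by blast
  qed
  then have "B = cyc ?w" using cyc_subset[OF sB wB] by blast
  moreover have "?w [^] p = \<one>"
  proof -
    have "?w [^] p \<in> B"
      using subgroup_int_pow_closed[OF sB wB, of "int p"] by (simp add: int_pow_int)
    then show ?thesis using triv nf_nat_pow[of s 1 p] by simp
  qed
  ultimately show thesis by (rule that)
qed

text \<open>For \<open>x [^] s \<otimes> y\<close> to have order \<open>p\<close>, \<open>q\<close>
  must divide \<open>s\<close>; as \<open>s\<close> counts only modulo \<open>q * p\<close>, at most
  \<open>p\<close> subgroups remain.\<close>

lemma card_nonnormals_le:
  assumes "\<not> (p = 2 \<and> n = 3)"
  shows "card nonnormals \<le> p"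
proof -
  have "nonnormals \<subseteq> (\<lambda>i. cyc (nf (q * i) 1 0)) ` {0..<int p}"
  proof
    fix B assume "B \<in> nonnormals"
    then obtain s where B: "B = cyc (nf s 1 0)" "(nf s 1 0) [^] p = \<one>" by (rule nonnormal_cases)
    define t where "t = int p * (int p - 1) div 2"
    define q' where "q' = int p ^ (n - 3)"
    have "n - 2 = Suc (n - 3)" using n3 by simp
    then have qq: "q = int p * q'" by (simp add: q_def q'_def)
    have "nf (int p * s) (int p) (s * t) = \<one>" using B(2) nf_nat_pow[of s 1 p] by (simp add: t_def)
    then have "x [^] (int p * s + q * (s * t)) = \<one>"
      unfolding nf_reduce[of "int p * s"] using int_pow_zero_dvd[OF yG y_pow, of "int p"] by (simp add: nf_def)
    then have "int p ^ (n - 1) dvd int p * s + q * (s * t)" using xpow_eq_one_iff by simp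
    then have "q * int p dvd int p * s + q * (s * t)" by (simp add: q_p)
    moreover have "int p * s + q * (s * t) = s * (1 + q' * t) * int p" by (simp add: qq algebra_simps)
    ultimately have d: "q dvd s * (1 + q' * t)" using prime_gt_0_nat[OF prime] by simp
    \<comment> \<open>The \<open>p\<close>-th power is \<open>x [^] (p * s * (1 + q' * t))\<close>,
      and the bracket has to be prime to \<open>p\<close>. For odd \<open>p\<close> the binomial
      coefficient \<open>t\<close> is a multiple of \<open>p\<close>; for \<open>n > 3\<close> so is
      \<open>q'\<close>. For \<open>p = 2\<close> and \<open>n = 3\<close> the bracket would be
      \<open>2\<close>.\<close>
    have "int p dvd q' * t"
    proof (cases "n = 3")
      case True
      then have "odd p" using assms prime prime_odd_nat prime_ge_2_nat[OF prime] by force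
      then have "even (int p - 1)" by simp
      then have "t = int p * ((int p - 1) div 2)" unfolding t_def by (rule div_mult_swap[symmetric])
      then show ?thesis by simp
    next
      case False
      then have "int p dvd q'" using n3 by (simp add: q'_def)
      then show ?thesis by simp
    qed
    then have "\<not> int p dvd 1 + q' * t"
      using prime_gt_1_nat[OF prime] by (metis dvd_add_left_iff int_dvd_int_iff nat_dvd_1_iff_1 nat_neq_iff of_nat_1)
    then have "coprime (int p) (1 + q' * t)" using prime by (simp add: prime_imp_coprime)
    then have "coprime q (1 + q' * t)" by (simp add: q_def)
    then have "q dvd s" using d by (simp add: coprime_dvd_mult_left_iff)
    then obtain i where i: "s = q * i" by (elim dvdE)
    have "q * i - q * (i mod int p) = int p ^ (n - 1) * (i div int p)"
      unfolding q_p[symmetric] by (simp add: minus_mod_eq_mult_div mult.assoc flip: right_diff_distrib)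
    then have "x [^] (q * i - q * (i mod int p)) = \<one>" using x_int_pow by simp
    then have "x [^] (q * i) = x [^] (q * (i mod int p))"
      using int_pow_mult[OF xG, of "q * i - q * (i mod int p)" "q * (i mod int p)"] by simp
    then have "B = cyc (nf (q * (i mod int p)) 1 0)" using B(1) i by (simp add: nf_def)
    moreover have "i mod int p \<in> {0..<int p}" using prime_gt_0_nat[OF prime] by simp
    ultimately show "B \<in> (\<lambda>i. cyc (nf (q * i) 1 0)) ` {0..<int p}" by (rule image_eqI)
  qed
  then have "card nonnormals \<le> card {0..<int p}" by (rule surj_card_le[rotated]) simp
  then show ?thesis by simp
qed

text \<open>The counts run opposite to the upper bound: at least \<open>T - p\<close> normal
  subgroups, at most \<open>p\<close> nonnormal ones, at least one class of these. The term dropped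
  in the chain is \<open>(p - 1)(\<nu> - (T - p)) \<ge> 0\<close>.\<close>

lemma d_prime_ge:
  assumes "\<not> (p = 2 \<and> n = 3)"
  shows "1 - (real p - 1) / real ((n - 1) * (p + 1) + 2) \<le> d_prime G"
proof -
  define \<nu> c \<kappa> T where "\<nu> = real (card normals)" and "c = real (card nonnormals)"
    and "\<kappa> = real (card (conj_class ` nonnormals))" and "T = real ((n - 1) * (p + 1) + 2)"
  have p1: "real p > 1" using prime_gt_1_nat[OF prime] by simp
  have "n - 1 = Suc (n - 2)" using n3 by simp
  then have "(n - 1) * (p + 1) + 2 \<le> card normals + p"
    using card_normals_ge[OF finite_carrier] by simp
  then have nu: "T - p \<le> \<nu>" unfolding T_def \<nu>_def by linarith
  have cp: "c \<le> p" unfolding c_def using card_nonnormals_le[OF assms] by simp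
  have k1: "\<kappa> \<ge> 1"
    unfolding \<kappa>_def using nonnormals_nonempty finite_subgroups[OF finite_carrier]
    by (simp add: card_gt_0_iff Suc_leI)
  have "1 * (p + 1) \<le> (n - 1) * (p + 1)" using n3 by (intro mult_le_mono1) simp
  then have "p + 1 \<le> (n - 1) * (p + 1)" by (simp only: mult_1)
  then have "p < (n - 1) * (p + 1) + 2" by (rule less_le_trans[of _ "p + 1" , OF _ le_trans[OF _ le_add1], rotated]) simp
  then have Tp: "T > p" unfolding T_def by (simp only: of_nat_less_iff)
  have pos: "\<nu> > 0" unfolding \<nu>_def using card_normals_pos[OF finite_carrier] by simp
  have c0: "c \<ge> 0" unfolding c_def by simp
  have "(T - p + 1) * (\<nu> + c) \<le> (T - p + 1) * (\<nu> + p)" using cp Tp by (intro mult_left_mono) auto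
  also have "\<dots> = T * (\<nu> + 1) - (real p - 1) * (\<nu> - (T - p))" by (simp add: algebra_simps)
  also have "\<dots> \<le> T * (\<nu> + 1)" using nu p1 by simp
  also have "\<dots> \<le> T * (\<nu> + \<kappa>)" using k1 Tp p1 by (intro mult_left_mono) auto
  finally have "(T - p + 1) / T \<le> (\<nu> + \<kappa>) / (\<nu> + c)"
    using Tp p1 pos c0 by (simp add: divide_simps mult.commute)
  moreover have "(T - p + 1) / T = 1 - (real p - 1) / T" using Tp p1 by (simp add: field_simps)
  ultimately show ?thesis unfolding d_prime_eq[OF finite_carrier] \<nu>_def c_def \<kappa>_def T_def by simp
qed

text \<open>At least six normal subgroups and at most four nonnormal ones in at least two classes
  give \<open>(6 + 2) / (6 + 4)\<close>.\<close>

lemma d_prime_ge_order_8: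
  assumes "p = 2" "n = 3"
  shows "4 / 5 \<le> d_prime G"
proof -
  have nu: "card normals \<ge> 6" using card_normals_ge[OF finite_carrier] assms by simp
  have "nonnormals \<subseteq> (\<lambda>i. cyc (nf i 1 0)) ` {0..<4}"
  proof
    fix B assume "B \<in> nonnormals"
    then obtain s where B: "B = cyc (nf s 1 0)" "(nf s 1 0) [^] p = \<one>" by (rule nonnormal_cases)
    have "x [^] (s - s mod 4) = \<one>" using x_int_pow assms by (simp add: minus_mod_eq_mult_div)
    then have "x [^] s = x [^] (s mod 4)" using int_pow_mult[OF xG, of "s - s mod 4" "s mod 4"] by simp
    then have "B = cyc (nf (s mod 4) 1 0)" using B(1) by (simp add: nf_def)
    then show "B \<in> (\<lambda>i. cyc (nf i 1 0)) ` {0..<4}" by (rule image_eqI) simp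
  qed
  then have "card nonnormals \<le> card {0..<4::int}" by (rule surj_card_le[rotated]) simp
  then have c: "card nonnormals \<le> 4" by simp
  let ?w = "nf 1 1 0"
  have "?w [^] p = nf 2 2 1" using nf_nat_pow[of 1 1 2] assms by simp
  also have "\<dots> = nf (2 + q) 2 0" using nf_reduce[of 2 2 1] by simp
  also have "\<dots> = \<one>"
  proof -
    have "q = 2" unfolding q_def using assms by simp
    then have "x [^] (2 + q) = \<one>" using x_int_pow[of 4] assms by simp
    moreover have "y [^] (2::int) = \<one>" using int_pow_zero_dvd[OF yG y_pow, of 2] assms by simp
    ultimately show ?thesis unfolding nf_def by simp
  qed
  finally have w2: "?w [^] p = \<one>" .
  have "y \<otimes> ?w \<noteq> ?w \<otimes> y"
    using commute_nf[of 0 1 0 1 1 0] z_nontrivial by (simp add: nf_y nf_zpow[symmetric]) (simp add: nf_zpow)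
  then have W: "cyc ?w \<in> nonnormals"
    using noncentral_prime_order_nonnormal[of ?w y] w2 subgroup_cyc[of ?w] by auto
  have Y: "cyc y \<in> nonnormals"
    using noncentral_prime_order_nonnormal[OF yG y_pow xG xy_noncommuting] subgroup_cyc[OF yG] by auto
  \<comment> \<open>Conjugation changes only the \<open>z\<close> exponent, so the \<open>x\<close>
    exponent modulo \<open>p ^ (n - 2) = 2\<close> separates the two classes.\<close>
  have "conj_class (cyc ?w) \<noteq> conj_class (cyc y)"
  proof
    assume "conj_class (cyc ?w) = conj_class (cyc y)"
    then have "cyc ?w \<in> conj_class (cyc y)" using conj_class_refl[of "cyc ?w"] W by simp
    then obtain g where g: "g \<in> carrier G" "cyc ?w = (\<lambda>h. g \<otimes> h \<otimes> inv g) ` cyc y"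
      using conj_class_eq[of "cyc y"] Y by auto
    have "?w \<in> (\<lambda>h. g \<otimes> h \<otimes> inv g) ` cyc y" using g(2) self_in_cyc[of ?w] by simp
    then obtain k :: int where k: "?w = g \<otimes> nf 0 k 0 \<otimes> inv g" by (auto simp: nf_ypow)
    obtain a b c where "g = nf a b c" using nf_cases[OF g(1)] .
    then have "nf 1 1 0 = nf 0 k (0 + 0 * b - a * k)" using k nf_conj[of a b c 0 k 0] by simp
    from nf_eqD(1)[OF this] show False using assms by simp
  qed
  then have "card {conj_class (cyc ?w), conj_class (cyc y)} = 2" by simp
  moreover have "{conj_class (cyc ?w), conj_class (cyc y)} \<subseteq> conj_class ` nonnormals"
    using W Y by auto
  then have "card {conj_class (cyc ?w), conj_class (cyc y)} \<le> card (conj_class ` nonnormals)"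
    by (rule card_mono[OF finite_imageI[OF finite_subgroups[OF finite_carrier]]])
  ultimately have k: "2 \<le> card (conj_class ` nonnormals)" by simp
  have "real (card nonnormals) \<le> 4" "6 \<le> real (card normals)" "2 \<le> real (card (conj_class ` nonnormals))"
    using c nu k by auto
  then show ?thesis unfolding d_prime_eq[OF finite_carrier] by (simp add: divide_simps)
qed

end

section \<open>Sections of a group with the modular relations\<close>

lemma (in m_relations) quotient_m_relations:
  assumes K: "K \<lhd> G"
  shows "m_relations (G Mod K) (K #> x) (K #> y) p n"
proof -
  interpret K: normal K G by (rule K)
  interpret Q: group "G Mod K" by (rule K.factorgroup_is_group)
  interpret h: group_hom G "G Mod K" "\<lambda>g. K #> g"
    using K.r_coset_hom_Mod Q.group_axioms group_axioms by (simp add: group_hom_def group_hom_axioms_def)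
  show ?thesis
  proof unfold_locales
    show "K #> x \<in> carrier (G Mod K)" "K #> y \<in> carrier (G Mod K)"
      using h.hom_closed by blast+
    show "(K #> x) [^]\<^bsub>G Mod K\<^esub> (p ^ (n - 1)) = \<one>\<^bsub>G Mod K\<^esub>"
      using h.hom_nat_pow[OF xG, of "p ^ (n - 1)"] x_pow h.hom_one by simp
    show "(K #> y) [^]\<^bsub>G Mod K\<^esub> p = \<one>\<^bsub>G Mod K\<^esub>"
      using h.hom_nat_pow[OF yG, of p] y_pow h.hom_one by simp
    have "(K #> y) \<otimes>\<^bsub>G Mod K\<^esub> (K #> x) = K #> (y \<otimes> x)"
      by (rule h.hom_mult[symmetric]) auto
    also have "\<dots> = (K #> (x [^] (p ^ (n - 2) + 1))) \<otimes>\<^bsub>G Mod K\<^esub> (K #> y)"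
      unfolding y_x by (rule h.hom_mult) auto
    also have "K #> (x [^] (p ^ (n - 2) + 1)) = (K #> x) [^]\<^bsub>G Mod K\<^esub> (p ^ (n - 2) + 1)"
      by (rule h.hom_nat_pow) simp
    finally show "(K #> y) \<otimes>\<^bsub>G Mod K\<^esub> (K #> x)
      = (K #> x) [^]\<^bsub>G Mod K\<^esub> (p ^ (n - 2) + 1) \<otimes>\<^bsub>G Mod K\<^esub> (K #> y)" .
    show "carrier (G Mod K) = generate (G Mod K) {K #> x, K #> y}"
    proof -
      have "generate (G Mod K) ((\<lambda>g. K #> g) ` {x, y}) = (\<lambda>g. K #> g) ` carrier G"
        unfolding generated by (rule h.generate_img) simp
      then show ?thesis unfolding carrier_FactGroup image_insert image_empty by (rule HOL.sym)
    qed
  qed (use prime n3 in auto)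
qed

text \<open>Sections of abelian subgroups have ratio \<open>1\<close>. A nonabelian subgroup is the
  whole group, so only quotients remain, and these satisfy the same relations with the same
  \<open>n\<close>.\<close>

lemma (in m_relations) d_star_ge_quotients:
  assumes c: "c \<le> 1"
    and quot: "\<And>K x y. K \<lhd> G \<Longrightarrow> m_nonabelian (G Mod K) x y p n \<Longrightarrow> c \<le> d_prime (G Mod K)"
  shows "c \<le> d_star G"
proof (rule d_star_ge[OF finite_carrier])
  fix H K assume H: "subgroup H G" and K: "K \<lhd> G\<lparr>carrier := H\<rparr>"
  let ?A = "G\<lparr>carrier := H\<rparr>" and ?S = "G\<lparr>carrier := H\<rparr> Mod K"
  interpret A: group ?A using H by (rule subgroup_imp_group)
  interpret K: normal K ?A by (rule K)
  interpret S: group ?S by (rule K.factorgroup_is_group)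
  have finS: "finite (carrier ?S)"
    using finite_carrier subgroup.subset[OF H] by (auto simp: carrier_FactGroup intro: finite_subset)
  show "c \<le> d_prime ?S"
  proof (cases "\<forall>g\<in>H. \<forall>h\<in>H. g \<otimes> h = h \<otimes> g")
    case True
    have "u \<otimes>\<^bsub>?S\<^esub> v = v \<otimes>\<^bsub>?S\<^esub> u" if u: "u \<in> carrier ?S" and v: "v \<in> carrier ?S" for u v
    proof -
      obtain g where g: "g \<in> H" "u = K #>\<^bsub>?A\<^esub> g" using u unfolding carrier_FactGroup by auto
      obtain h where h: "h \<in> H" "v = K #>\<^bsub>?A\<^esub> h" using v unfolding carrier_FactGroup by auto
      have "u \<otimes>\<^bsub>?S\<^esub> v = K #>\<^bsub>?A\<^esub> (g \<otimes> h)" "v \<otimes>\<^bsub>?S\<^esub> u = K #>\<^bsub>?A\<^esub> (h \<otimes> g)"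
        unfolding g(2) h(2) mult_FactGroup using K.rcos_sum[of g h] K.rcos_sum[of h g] g(1) h(1) by simp_all
      then show ?thesis using True g h by simp
    qed
    then show ?thesis using S.d_prime_abelian[OF finS] c by simp
  next
    case False
    then obtain g h where gh: "g \<in> H" "h \<in> H" "g \<otimes> h \<noteq> h \<otimes> g" by blast
    have "z \<noteq> \<one>" using commute_if_z_trivial gh subgroup.mem_carrier[OF H] by blast
    then interpret m_nonabelian G x y p n by unfold_locales
    have "H = carrier G" using proper_subgroup_commute[OF H _ gh(1,2)] gh(3) by blast
    then have AG: "?A = G" by simp
    have KG: "K \<lhd> G" using K AG by simp
    interpret Q: m_relations "G Mod K" "K #> x" "K #> y" p n by (rule quotient_m_relations[OF KG])
    show ?thesis
    proof (cases "Q.z = \<one>\<^bsub>G Mod K\<^esub>")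
      case True
      then have "d_prime (G Mod K) = 1"
        by (intro Q.d_prime_abelian Q.finite_carrier Q.commute_if_z_trivial)
      then show ?thesis using c AG by simp
    next
      case False
      then have "m_nonabelian (G Mod K) (K #> x) (K #> y) p n" by unfold_locales
      then show ?thesis using quot[OF KG] AG by simp
    qed
  qed
qed

lemma (in m_relations) d_star_ge:
  assumes "\<not> (p = 2 \<and> n = 3)"
  shows "1 - (real p - 1) / real ((n - 1) * (p + 1) + 2) \<le> d_star G"
proof (rule d_star_ge_quotients)
  show "1 - (real p - 1) / real ((n - 1) * (p + 1) + 2) \<le> 1"
    using prime_gt_1_nat[OF prime] by simp
qed (rule m_nonabelian.d_prime_ge[OF _ assms])

lemma (in m_relations) d_star_ge_order_8:
  assumes "p = 2" "n = 3"
  shows "4 / 5 \<le> d_star G"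
  by (rule d_star_ge_quotients) (use m_nonabelian.d_prime_ge_order_8[OF _ assms] in auto)

section \<open>The presented groups\<close>

lemma presented_group_pow:
  "pres_class R w [^]\<^bsub>presented_group R\<^esub> (m::nat) = pres_class R (wpow w m)"
proof (induction m)
  case 0
  show ?case by (simp add: presented_group_def)
next
  case (Suc m)
  have "wpow w m @ w = wpow w (Suc m)" by (simp flip: replicate_append_same)
  then show ?case using Suc by (simp add: presented_group_mult)
qed

lemma presented_group_carrier: "pres_class R w \<in> carrier (presented_group R)"
  by (simp add: presented_group_def)

lemma presented_group_one: "\<one>\<^bsub>presented_group R\<^esub> = pres_class R []"
  by (simp add: presented_group_def)

lemma presented_group_inv:
  "inv\<^bsub>presented_group R\<^esub> (pres_class R [(g, True)]) = pres_class R [(g, False)]"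
proof -
  interpret group "presented_group R" by (rule group_presented_group)
  have "pres_eq R [(g, False), (g, True)] []" using pres_eq.cancel[of R g False] by simp
  then have "pres_class R [(g, False)] \<otimes>\<^bsub>presented_group R\<^esub> pres_class R [(g, True)] = \<one>\<^bsub>presented_group R\<^esub>"
    by (simp add: presented_group_mult presented_group_one pres_class_eq_iff)
  then show ?thesis by (rule inv_equality) (auto simp: presented_group_carrier)
qed

lemma presented_group_generated:
  "carrier (presented_group R) = generate (presented_group R) {pres_class R wx, pres_class R wy}"
proof
  let ?P = "presented_group R" and ?g = "{pres_class R wx, pres_class R wy}"
  interpret group ?P by (rule group_presented_group)
  show "generate ?P ?g \<subseteq> carrier ?P" by (rule generate_incl) (auto simp: presented_group_carrier)
  have letter: "pres_class R [(g, e)] \<in> generate ?P ?g" for g e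
  proof -
    have "pres_class R [(g, True)] \<in> ?g" by (cases g) auto
    then show ?thesis
      by (cases e) (auto simp flip: presented_group_inv intro: generate.incl generate.inv)
  qed
  have "pres_class R w \<in> generate ?P ?g" for w
  proof (induction w)
    case Nil
    show ?case using generate.one[of ?P ?g] by (simp add: presented_group_one)
  next
    case (Cons l w)
    obtain g e where "l = (g, e)" by fastforce
    then have "pres_class R (l # w) = pres_class R [(g, e)] \<otimes>\<^bsub>?P\<^esub> pres_class R w"
      by (simp add: presented_group_mult)
    then show ?case using generate.eng[OF letter Cons] by simp
  qed
  then show "carrier ?P \<subseteq> generate ?P ?g" by (auto simp: presented_group_def)
qed

lemma presented_group_rel: "(u, v) \<in> R \<Longrightarrow> pres_class R u = pres_class R v"
  by (simp add: pres_class_eq_iff pres_eq.rel)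

lemma M_group_relations:
  assumes "Factorial_Ring.prime p" "n \<ge> 3"
  shows "\<exists>x y. m_relations (M_group p n) x y p n"
proof -
  define R :: "(two_gens gword \<times> two_gens gword) set" where
    "R = {(wpow wx (p ^ (n - 1)), []), (wpow wy p, []), (wy @ wx, wpow wx (p ^ (n - 2) + 1) @ wy)}"
  have M: "M_group p n = presented_group R" unfolding M_group_def R_def ..
  have R: "(wpow wx (p ^ (n - 1)), []) \<in> R" "(wpow wy p, []) \<in> R"
    "(wy @ wx, wpow wx (p ^ (n - 2) + 1) @ wy) \<in> R" unfolding R_def by blast+
  interpret group "presented_group R" by (rule group_presented_group)
  have "m_relations (presented_group R) (pres_class R wx) (pres_class R wy) p n"
  proof unfold_locales
    show "pres_class R wx [^]\<^bsub>presented_group R\<^esub> (p ^ (n - 1)) = \<one>\<^bsub>presented_group R\<^esub>"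
      unfolding presented_group_pow presented_group_one by (rule presented_group_rel[OF R(1)])
    show "pres_class R wy [^]\<^bsub>presented_group R\<^esub> p = \<one>\<^bsub>presented_group R\<^esub>"
      unfolding presented_group_pow presented_group_one by (rule presented_group_rel[OF R(2)])
    show "pres_class R wy \<otimes>\<^bsub>presented_group R\<^esub> pres_class R wx
      = pres_class R wx [^]\<^bsub>presented_group R\<^esub> (p ^ (n - 2) + 1) \<otimes>\<^bsub>presented_group R\<^esub> pres_class R wy"
      unfolding presented_group_pow presented_group_mult by (rule presented_group_rel[OF R(3)])
    show "carrier (presented_group R) = generate (presented_group R) {pres_class R wx, pres_class R wy}"
      by (rule presented_group_generated)
  qed (use assms in \<open>simp_all add: presented_group_carrier\<close>)
  then show ?thesis unfolding M by blast
qed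

lemma D8_relations: "\<exists>x y. m_relations D8 x y 2 3"
proof -
  define R :: "(two_gens gword \<times> two_gens gword) set" where
    "R = {(wpow wx 4, []), (wpow wy 2, []), (wy @ wx @ wy, wx_inv)}"
  have D: "D8 = presented_group R" unfolding D8_def R_def ..
  have R: "(wpow wx 4, []) \<in> R" "(wpow wy 2, []) \<in> R" "(wy @ wx @ wy, wx_inv) \<in> R"
    unfolding R_def by blast+
  let ?P = "presented_group R" and ?x = "pres_class R wx" and ?y = "pres_class R wy"
  interpret group ?P by (rule group_presented_group)
  have x: "?x \<in> carrier ?P" and y: "?y \<in> carrier ?P" by (rule presented_group_carrier)+
  have x4: "?x [^]\<^bsub>?P\<^esub> (4::nat) = \<one>\<^bsub>?P\<^esub>"
    unfolding presented_group_pow presented_group_one by (rule presented_group_rel[OF R(1)])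
  have y2: "?y [^]\<^bsub>?P\<^esub> (2::nat) = \<one>\<^bsub>?P\<^esub>"
    unfolding presented_group_pow presented_group_one by (rule presented_group_rel[OF R(2)])
  have "?y \<otimes>\<^bsub>?P\<^esub> (?x \<otimes>\<^bsub>?P\<^esub> ?y) = inv\<^bsub>?P\<^esub> ?x"
    unfolding presented_group_mult presented_group_inv by (rule presented_group_rel[OF R(3)])
  moreover have "inv\<^bsub>?P\<^esub> ?x = ?x [^]\<^bsub>?P\<^esub> (3::nat)"
    by (rule inv_equality) (use x x4 in \<open>simp_all add: numeral_eq_Suc\<close>)
  \<comment> \<open>As \<open>y x y\<close> is the inverse of \<open>x\<close>, which is its cube,
    this gives \<open>y x = x^3 y\<close> with \<open>3 = 2 ^ (3 - 2) + 1\<close>.\<close>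
  moreover have "?y \<otimes>\<^bsub>?P\<^esub> ?x = ?y \<otimes>\<^bsub>?P\<^esub> (?x \<otimes>\<^bsub>?P\<^esub> ?y) \<otimes>\<^bsub>?P\<^esub> ?y"
    using x y y2 by (simp add: m_assoc numeral_eq_Suc)
  ultimately have yx: "?y \<otimes>\<^bsub>?P\<^esub> ?x = ?x [^]\<^bsub>?P\<^esub> (3::nat) \<otimes>\<^bsub>?P\<^esub> ?y" by simp
  have "m_relations ?P ?x ?y 2 3"
  proof unfold_locales
    show "?y \<otimes>\<^bsub>?P\<^esub> ?x = ?x [^]\<^bsub>?P\<^esub> ((2::nat) ^ (3 - 2) + 1) \<otimes>\<^bsub>?P\<^esub> ?y"
      using yx by simp
    show "?x [^]\<^bsub>?P\<^esub> ((2::nat) ^ (3 - 1)) = \<one>\<^bsub>?P\<^esub>" using x4 by simp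
    show "carrier ?P = generate ?P {?x, ?y}" by (rule presented_group_generated)
  qed (use x y y2 two_is_prime_nat in simp_all)
  then show ?thesis unfolding D by blast
qed

section \<open>Nilpotent groups with Dedekind Sylow subgroups\<close>

lemma prod_dvd_of_pairwise_coprime:
  fixes f :: "'i \<Rightarrow> nat"
  assumes "finite I" "\<And>i j. i \<in> I \<Longrightarrow> j \<in> I \<Longrightarrow> i \<noteq> j \<Longrightarrow> coprime (f i) (f j)" "\<And>i. i \<in> I \<Longrightarrow> f i dvd m"
  shows "(\<Prod>i\<in>I. f i) dvd m"
  using assms
proof (induction I)
  case (insert i I)
  have "coprime (f i) (\<Prod>j\<in>I. f j)"
    using insert.hyps insert.prems(1) by (intro prod_coprime_right) auto
  moreover have "(\<Prod>j\<in>I. f j) dvd m" using insert by auto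
  ultimately show ?case using insert by (simp add: divides_mult)
qed simp

lemma (in group) card_subgroup_dvd:
  assumes "subgroup A G" "subgroup B G" "A \<subseteq> B"
  shows "card A dvd card B"
proof -
  have "subgroup A (G\<lparr>carrier := B\<rparr>)" by (rule subgroup_incl[OF assms])
  from group.lagrange[OF subgroup_imp_group[OF assms(2)] this]
  have "card B = card (rcosets\<^bsub>G\<lparr>carrier := B\<rparr>\<^esub> A) * card A" by (simp add: order_def)
  then show ?thesis by simp
qed

text \<open>The index sends \<open>h\<close> into \<open>H\<close> and \<open>m\<close> sends it to
  \<open>1\<close>; a Bezout combination recovers \<open>h\<close> from these two powers.\<close>

lemma (in normal) coprime_order_mem:
  assumes h: "h \<in> carrier G" "h [^] (m::nat) = \<one>" and cop: "coprime m (card (rcosets H))"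
  shows "h \<in> H"
proof -
  interpret Q: group "G Mod H" by (rule factorgroup_is_group)
  interpret \<pi>: group_hom G "G Mod H" "\<lambda>g. H #> g"
    using r_coset_hom_Mod Q.group_axioms is_group by (simp add: group_hom_def group_hom_axioms_def)
  let ?k = "card (rcosets H)"
  have "H #> (h [^] ?k) = (H #> h) [^]\<^bsub>G Mod H\<^esub> ?k" by (rule \<pi>.hom_nat_pow[OF h(1)])
  also have "\<dots> = H"
    using Q.pow_order_eq_1[of "H #> h"] \<pi>.hom_closed[OF h(1)] by (simp add: order_def FactGroup_def)
  finally have hk: "h [^] ?k \<in> H"
    using rcos_self[OF nat_pow_closed[OF h(1)] subgroup_axioms, of ?k] by simp
  obtain u v :: int where "u * int m + v * int ?k = 1"
    using cop bezout_int[of "int m" "int ?k"] by auto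
  then have "int m * u + int ?k * v = 1" by (simp only: mult.commute)
  then have "h = h [^] (int m * u) \<otimes> h [^] (int ?k * v)"
    using h(1) by (simp flip: int_pow_mult)
  also have "h [^] (int m * u) = \<one>" using h int_pow_zero_dvd[of h m] by simp
  also have "h [^] (int ?k * v) = (h [^] ?k) [^] v" using h(1) by (simp add: int_pow_pow flip: int_pow_int)
  finally show ?thesis
    using subgroup_int_pow_closed[OF is_subgroup hk, of v] h(1) by simp
qed

context group
begin

text \<open>On a finite set the injective conjugation map is onto as soon as it maps
  \<open>H\<close> into \<open>H\<close>.\<close>

lemma normalizer_iff:
  assumes fin: "finite (carrier G)" and H: "subgroup H G"
  shows "g \<in> normalizer G H \<longleftrightarrow> g \<in> carrier G \<and> (\<forall>h\<in>H. g \<otimes> h \<otimes> inv g \<in> H)"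
proof -
  have HC: "H \<subseteq> carrier G" by (rule subgroup.subset[OF H])
  have img: "g <# H #> inv g = (\<lambda>h. g \<otimes> h \<otimes> inv g) ` H" for g
    unfolding l_coset_def r_coset_def by auto
  have "(\<lambda>h. g \<otimes> h \<otimes> inv g) ` H = H" if g: "g \<in> carrier G" and "\<forall>h\<in>H. g \<otimes> h \<otimes> inv g \<in> H"
  proof -
    have "inj_on (\<lambda>h. g \<otimes> h \<otimes> inv g) H"
      by (rule inj_onI) (use g HC in \<open>auto simp: subset_iff m_assoc\<close>)
    then show ?thesis using that(2) finite_subset[OF HC fin] by (intro endo_inj_surj) auto
  qed
  then show ?thesis
    unfolding normalizer_def stabilizer_def using HC img by auto
qed

lemma lower_central_subset: "lower_central G c \<subseteq> carrier G"
proof (induction c)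
  case (Suc c)
  then show ?case unfolding lower_central.simps by (intro generate_incl) auto
qed simp

text \<open>\<open>P\<close> is normal in its normaliser with index prime to \<open>p\<close>, so
  \<open>coprime_order_mem\<close> applies there.\<close>

lemma sylow_contains_normalizing:
  assumes p: "Factorial_Ring.prime p" and fin: "finite (carrier G)"
    and P: "subgroup P G" "card P = p ^ a" "order G = p ^ a * l" "\<not> p dvd l"
    and h: "h \<in> normalizer G P" "h [^] (p ^ e) = \<one>"
  shows "h \<in> P"
proof -
  let ?N = "normalizer G P"
  have sN: "subgroup ?N G" by (rule normalizer_imp_subgroup[OF subgroup.subset[OF P(1)]])
  let ?A = "G\<lparr>carrier := ?N\<rparr>"
  interpret A: group ?A by (rule subgroup_imp_group[OF sN])
  interpret N: normal P ?A by (rule subgroup_in_normalizer[OF P(1)])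
  let ?k = "card (rcosets\<^bsub>?A\<^esub> P)"
  have "?k * card P = card ?N" using A.lagrange[OF N.is_subgroup] by (simp add: order_def)
  moreover have "card ?N dvd order G"
    using card_subgroup_dvd[OF sN subgroup_self subgroup.subset[OF sN]] by (simp add: order_def)
  ultimately have "p ^ a * ?k dvd p ^ a * l" using P by (simp add: mult.commute)
  then have "?k dvd l" using prime_gt_0_nat[OF p] by simp
  then have "\<not> p dvd ?k" using P(4) dvd_trans by blast
  then have "coprime (p ^ e) ?k" using p by (simp add: prime_imp_coprime)
  moreover have "h [^]\<^bsub>?A\<^esub> (p ^ e) = \<one>\<^bsub>?A\<^esub>" using h(2) nat_pow_consistent[of h "p ^ e" ?N] by simp
  ultimately show ?thesis using N.coprime_order_mem[of h "p ^ e"] h(1) by simp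
qed

text \<open>A Sylow subgroup \<open>P\<close> contains every \<open>p\<close>-element normalising it. If the term \<open>c + 1\<close> of the
  lower central series normalises \<open>P\<close>, then so does the term \<open>c\<close>, since it moves elements of \<open>P\<close>
  by elements of the term \<open>c + 1\<close>.\<close>

lemma nilpotent_sylow_normal:
  assumes nil: "nilpotent_group G" and p: "Factorial_Ring.prime p" and fin: "finite (carrier G)"
    and P: "subgroup P G" "card P = p ^ a" "order G = p ^ a * l" "\<not> p dvd l"
  shows "P \<lhd> G"
proof -
  obtain c where c: "lower_central G c = {\<one>}" using nil unfolding nilpotent_group_def by blast
  let ?N = "normalizer G P"
  have sN: "subgroup ?N G" by (rule normalizer_imp_subgroup[OF subgroup.subset[OF P(1)]])
  note iff = normalizer_iff[OF fin P(1)]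
  have PN: "P \<subseteq> ?N"
    using subgroup.subset[OF normal_imp_subgroup[OF subgroup_in_normalizer[OF P(1)]]] by simp
  \<comment> \<open>The induction climbs from the trivial term \<open>c\<close> to the whole group,
    which is reached at \<open>j = c\<close>.\<close>
  have "lower_central G (c - j) \<subseteq> ?N" if "j \<le> c" for j
    using that
  proof (induction j)
    case 0
    show ?case using c subgroup.one_closed[OF sN] by simp
  next
    case (Suc j)
    have cj: "c - j = Suc (c - Suc j)" using Suc.prems by simp
    have IH: "lower_central G (c - j) \<subseteq> ?N" using Suc by simp
    show ?case
    proof
      fix v assume v: "v \<in> lower_central G (c - Suc j)"
      have vC: "v \<in> carrier G" using v lower_central_subset by blast
      have "v \<otimes> a' \<otimes> inv v \<in> P" if a': "a' \<in> P" for a'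
      proof -
        have aC: "a' \<in> carrier G" using subgroup.mem_carrier[OF P(1) a'] .
        have "v \<otimes> a' \<otimes> inv v \<otimes> inv a' \<in> lower_central G (c - j)"
          unfolding cj lower_central.simps by (rule generate.incl) (use v aC in blast)
        then have "v \<otimes> a' \<otimes> inv v \<otimes> inv a' \<otimes> a' \<in> ?N"
          using IH PN a' subgroup.m_closed[OF sN] by blast
        then have "v \<otimes> a' \<otimes> inv v \<in> ?N" using vC aC by (simp add: m_assoc)
        moreover have "(v \<otimes> a' \<otimes> inv v) [^] (p ^ a) = \<one>"
        proof -
          interpret P: group "G\<lparr>carrier := P\<rparr>" by (rule subgroup_imp_group[OF P(1)])
          have "a' [^] (p ^ a) = \<one>"
            using P.pow_order_eq_1[of a'] a' P(2) nat_pow_consistent[of a' "p ^ a" P] by (simp add: order_def)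
          then show ?thesis
            using conj_int_pow[OF vC aC, of "int (p ^ a)"] vC unfolding int_pow_int by simp
        qed
        ultimately show ?thesis by (rule sylow_contains_normalizing[OF p fin P])
      qed
      then show "v \<in> ?N" using iff vC by blast
    qed
  qed
  from this[of c] have "carrier G \<subseteq> ?N" by simp
  then show ?thesis using iff P(1) by (intro normal_invI) auto
qed

lemma normal_commute:
  assumes A: "A \<lhd> G" and B: "B \<lhd> G" and AB: "A \<inter> B = {\<one>}" and a: "a \<in> A" and b: "b \<in> B"
  shows "a \<otimes> b = b \<otimes> a"
proof -
  have sA: "subgroup A G" and sB: "subgroup B G" using A B by (auto intro: normal_imp_subgroup)
  have aC: "a \<in> carrier G" and bC: "b \<in> carrier G" using subgroup.mem_carrier sA sB a b by metis+
  have "a \<otimes> b \<otimes> inv a \<otimes> inv b \<in> B"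
    by (rule subgroup.m_closed[OF sB normal.inv_op_closed2[OF B aC b] subgroup.m_inv_closed[OF sB b]])
  moreover have "a \<otimes> (b \<otimes> inv a \<otimes> inv b) \<in> A"
    by (rule subgroup.m_closed[OF sA a normal.inv_op_closed2[OF A bC subgroup.m_inv_closed[OF sA a]]])
  then have "a \<otimes> b \<otimes> inv a \<otimes> inv b \<in> A" using aC bC by (simp add: m_assoc)
  ultimately have "a \<otimes> b \<otimes> inv a \<otimes> inv b = \<one>" using AB by blast
  then have "a \<otimes> b = inv (inv a \<otimes> inv b)"
    using aC bC by (metis inv_closed inv_equality inv_inv m_assoc m_closed)
  then show ?thesis using aC bC by (simp add: inv_mult_group)
qed

text \<open>Normality permits \<open>coprime_order_mem\<close> to be applied to the centraliser of a
  Sylow subgroup.\<close>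

lemma centralizer_normal:
  assumes P: "P \<lhd> G"
  shows "{g \<in> carrier G. \<forall>a\<in>P. g \<otimes> a = a \<otimes> g} \<lhd> G"
proof -
  let ?C = "{g \<in> carrier G. \<forall>a\<in>P. g \<otimes> a = a \<otimes> g}"
  have PC: "a \<in> carrier G" if "a \<in> P" for a
    using subgroup.mem_carrier[OF normal_imp_subgroup[OF P] that] .
  have "subgroup ?C G"
  proof
    show "g \<otimes> h \<in> ?C" if g: "g \<in> ?C" and h: "h \<in> ?C" for g h
    proof -
      have "g \<otimes> h \<otimes> a = a \<otimes> (g \<otimes> h)" if a: "a \<in> P" for a
      proof -
        have "g \<otimes> h \<otimes> a = g \<otimes> (a \<otimes> h)" using g h a PC[OF a] by (simp add: m_assoc)
        also have "\<dots> = (g \<otimes> a) \<otimes> h" using g h PC[OF a] by (simp add: m_assoc)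
        also have "\<dots> = (a \<otimes> g) \<otimes> h" using g a by simp
        also have "\<dots> = a \<otimes> (g \<otimes> h)" using g h PC[OF a] by (simp add: m_assoc)
        finally show ?thesis .
      qed
      then show ?thesis using g h by simp
    qed
    show "inv g \<in> ?C" if g: "g \<in> ?C" for g
    proof -
      have "inv g \<otimes> a = a \<otimes> inv g" if "a \<in> P" for a
        using g commute_int_pow[of a g "- 1"] PC[OF that] that by (simp add: int_pow_neg)
      then show ?thesis using g by simp
    qed
  qed (use PC in auto)
  then show ?thesis
  proof (rule normal_invI)
    fix g c assume g: "g \<in> carrier G" and c: "c \<in> ?C"
    have "g \<otimes> c \<otimes> inv g \<otimes> a = a \<otimes> (g \<otimes> c \<otimes> inv g)" if a: "a \<in> P" for a
    proof -
      have b: "inv g \<otimes> a \<otimes> g \<in> P" using normal.inv_op_closed1[OF P g a] .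
      have "g \<otimes> c \<otimes> inv g \<otimes> a = g \<otimes> (c \<otimes> (inv g \<otimes> a \<otimes> g)) \<otimes> inv g"
        using g c PC[OF a] by (simp add: m_assoc)
      also have "c \<otimes> (inv g \<otimes> a \<otimes> g) = (inv g \<otimes> a \<otimes> g) \<otimes> c" using b c by simp
      also have "g \<otimes> (inv g \<otimes> a \<otimes> g \<otimes> c) \<otimes> inv g = a \<otimes> (g \<otimes> c \<otimes> inv g)"
        using g c PC[OF a] by (simp add: m_assoc inv_cancel_left)
      finally show ?thesis .
    qed
    then show "g \<otimes> c \<otimes> inv g \<in> ?C" using g c by simp
  qed
qed

text \<open>Each \<open>P i\<close> normalises an arbitrary subgroup \<open>U\<close>: an element of \<open>U\<close> is the product of a power in
  \<open>P i\<close> and a power of order prime to \<open>p i\<close>, and the latter centralises \<open>P i\<close>.\<close>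

lemma nilpotent_dedekind_sylow:
  fixes p n :: "nat \<Rightarrow> nat"
  assumes nil: "nilpotent_group G" and fin: "finite (carrier G)"
    and I: "finite I" "inj_on p I" "\<And>i. i \<in> I \<Longrightarrow> Factorial_Ring.prime (p i)"
    and ord: "order G = (\<Prod>i\<in>I. p i ^ n i)"
    and P: "\<And>i. i \<in> I \<Longrightarrow> subgroup (P i) G" "\<And>i. i \<in> I \<Longrightarrow> card (P i) = p i ^ n i"
    and ded: "\<And>i. i \<in> I \<Longrightarrow> dedekind_group (G\<lparr>carrier := P i\<rparr>)"
  shows "dedekind_group G"
proof -
  have cop: "coprime (p i ^ n i) (p j ^ n j)" if "i \<in> I" "j \<in> I" "i \<noteq> j" for i j
    using that I by (simp add: primes_coprime inj_on_eq_iff)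
  define m where "m i = (\<Prod>j\<in>I - {i}. p j ^ n j)" for i
  have ordi: "order G = p i ^ n i * m i" if "i \<in> I" for i
    unfolding ord m_def using prod.remove[OF I(1) that] .
  have copm: "coprime (p i ^ n i) (m i)" if "i \<in> I" for i
    unfolding m_def using that cop by (intro prod_coprime_right) auto
  have ndvd: "\<not> p i dvd m i" if "i \<in> I" for i
  proof
    assume "p i dvd m i"
    then have "\<exists>j\<in>I - {i}. p i dvd p j ^ n j"
      unfolding m_def prime_dvd_prod_iff[OF finite_Diff[OF I(1)] I(3)[OF that]] .
    then obtain j where j: "j \<in> I" "j \<noteq> i" "p i dvd p j ^ n j" by blast
    have "p i dvd p j" by (rule prime_dvd_power[OF I(3)[OF that] j(3)])
    then have "p i = p j" by (rule primes_dvd_imp_eq[OF I(3)[OF that] I(3)[OF j(1)]])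
    then show False using inj_onD[OF I(2) _ that j(1)] j(2) by simp
  qed
  have normal: "P i \<lhd> G" if "i \<in> I" for i
    by (rule nilpotent_sylow_normal[OF nil I(3) fin P(1,2) ordi ndvd]) (use that in auto)
  have comm: "a \<otimes> b = b \<otimes> a" if "i \<in> I" "j \<in> I" "i \<noteq> j" "a \<in> P i" "b \<in> P j" for i j a b
  proof (rule normal_commute[OF normal[OF that(1)] normal[OF that(2)] _ that(4,5)])
    let ?J = "P i \<inter> P j"
    have sJ: "subgroup ?J G" using subgroups_Inter_pair P that by blast
    have "card ?J dvd p i ^ n i" "card ?J dvd p j ^ n j"
      using card_subgroup_dvd[OF sJ P(1)[OF that(1)]] card_subgroup_dvd[OF sJ P(1)[OF that(2)]] P(2) that
      by auto
    then have "card ?J = 1" using cop[OF that(1-3)] by (metis coprime_common_divisor_nat)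
    then obtain e where "?J = {e}" by (auto simp: card_1_singleton_iff)
    then show "?J = {\<one>}" using subgroup.one_closed[OF sJ] by simp
  qed
  have "U \<lhd> G" if U: "subgroup U G" for U
  proof -
    have UC: "u \<in> carrier G" if "u \<in> U" for u using subgroup.mem_carrier[OF U that] .
    have norm: "g \<otimes> u \<otimes> inv g \<in> U" if i: "i \<in> I" and g: "g \<in> P i" and u: "u \<in> U" for i g u
    proof -
      have gC: "g \<in> carrier G" by (rule subgroup.mem_carrier[OF P(1)[OF i] g])
      let ?C = "{c \<in> carrier G. \<forall>a\<in>P i. c \<otimes> a = a \<otimes> c}"
      have Cn: "?C \<lhd> G" by (rule centralizer_normal[OF normal[OF i]])
      have sC: "subgroup ?C G" using Cn by (rule normal_imp_subgroup)
      \<comment> \<open>The centraliser contains every \<open>P j\<close> with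
        \<open>j \<noteq> i\<close>, so its index divides \<open>p i ^ n i\<close> and is prime to
        \<open>m i\<close>.\<close>
      have "m i dvd card ?C"
        unfolding m_def
      proof (rule prod_dvd_of_pairwise_coprime)
        fix j assume j: "j \<in> I - {i}"
        have "P j \<subseteq> ?C"
          using comm[of j i] i j subgroup.mem_carrier[OF P(1), of j] by auto
        then show "p j ^ n j dvd card ?C" using card_subgroup_dvd[OF P(1) sC, of j] P(2)[of j] j by simp
      qed (use I cop in auto)
      moreover have "card (rcosets ?C) * card ?C = p i ^ n i * m i" using lagrange[OF sC] ordi[OF i] by simp
      moreover have "m i > 0" using ndvd[OF i] by (cases "m i") auto
      ultimately have "card (rcosets ?C) dvd p i ^ n i"
        by (elim dvdE) (auto simp: mult.assoc intro: dvdI[OF HOL.sym])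
      then have copC: "coprime (m i) (card (rcosets ?C))"
        using copm[OF i] by (meson coprime_commute coprime_divisors dvd_refl)
      have "card (rcosets (P i)) * p i ^ n i = p i ^ n i * m i"
        using lagrange[OF P(1)[OF i]] ordi[OF i] P(2)[OF i] by simp
      then have copP: "coprime (p i ^ n i) (card (rcosets (P i)))"
        using copm[OF i] prime_gt_0_nat[OF I(3)[OF i]] by simp
      obtain s t :: int where st: "s * int (p i ^ n i) + t * int (m i) = 1"
        using copm[OF i] bezout_int[of "int (p i ^ n i)" "int (m i)"] by auto
      \<comment> \<open>Bezout splits \<open>u\<close> into commuting parts: \<open>w\<close> has
        order dividing \<open>m i\<close> and centralises \<open>P i\<close>, while \<open>v\<close>
        lies in \<open>P i\<close>, so that conjugation by \<open>g\<close> affects only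
        \<open>v\<close>.\<close>
      define w v where "w = u [^] (s * int (p i ^ n i))" and "v = u [^] (t * int (m i))"
      have uC: "u \<in> carrier G" by (rule UC[OF u])
      have triv: "u [^] (c::int) = \<one>" if "int (order G) dvd c" for c
        by (rule int_pow_zero_dvd[OF uC pow_order_eq_1[OF uC] that])
      have uwv: "u = w \<otimes> v" using uC st by (simp add: w_def v_def flip: int_pow_mult)
      have "w [^] int (m i) = \<one>" unfolding w_def int_pow_pow[OF uC] by (rule triv) (simp add: ordi[OF i])
      then have "w [^] m i = \<one>" unfolding int_pow_int .
      then have wC: "w \<in> ?C" using normal.coprime_order_mem[OF Cn _ _ copC, of w] uC by (simp add: w_def)
      have "v [^] int (p i ^ n i) = \<one>" unfolding v_def int_pow_pow[OF uC] by (rule triv) (simp add: ordi[OF i])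
      then have "v [^] (p i ^ n i) = \<one>" unfolding int_pow_int .
      then have vP: "v \<in> P i"
        using normal.coprime_order_mem[OF normal[OF i] _ _ copP, of v] uC by (simp add: v_def)
      have vU: "v \<in> U" and wU: "w \<in> U"
        unfolding v_def w_def by (rule subgroup_int_pow_closed[OF U u])+
      let ?V = "U \<inter> P i"
      have "subgroup ?V G" using subgroups_Inter_pair U P(1)[OF i] by blast
      then have "subgroup ?V (G\<lparr>carrier := P i\<rparr>)" using subgroup_incl P(1)[OF i] by blast
      then have "?V \<lhd> G\<lparr>carrier := P i\<rparr>" using ded[OF i] unfolding dedekind_group_def by blast
      then have "g \<otimes> v \<otimes> inv g \<in> ?V"
        using normal.inv_op_closed2[of ?V "G\<lparr>carrier := P i\<rparr>" g v] g vU vP m_inv_consistent[OF P(1)[OF i] g]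
        by simp
      then have "w \<otimes> (g \<otimes> v \<otimes> inv g) \<in> U" using subgroup.m_closed[OF U wU] by blast
      moreover have "g \<otimes> u \<otimes> inv g = w \<otimes> (g \<otimes> v \<otimes> inv g)"
      proof -
        have "g \<otimes> w = w \<otimes> g" using wC g by simp
        then have gwv: "g \<otimes> w \<otimes> v = w \<otimes> g \<otimes> v" by simp
        have C: "w \<in> carrier G" "v \<in> carrier G" using UC[OF wU] UC[OF vU] .
        have "g \<otimes> u \<otimes> inv g = (g \<otimes> w \<otimes> v) \<otimes> inv g" unfolding uwv using gC C by (simp add: m_assoc)
        also have "\<dots> = w \<otimes> (g \<otimes> v \<otimes> inv g)" unfolding gwv using gC C by (simp add: m_assoc)
        finally show ?thesis .
      qed
      ultimately show ?thesis by simp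
    qed
    let ?N = "normalizer G U"
    have sN: "subgroup ?N G" by (rule normalizer_imp_subgroup[OF subgroup.subset[OF U]])
    \<comment> \<open>The normaliser contains every \<open>P i\<close>, and their orders are
      pairwise coprime with product \<open>order G\<close>.\<close>
    have "order G dvd card ?N"
      unfolding ord
    proof (rule prod_dvd_of_pairwise_coprime)
      fix i assume i: "i \<in> I"
      have "P i \<subseteq> ?N" using norm[OF i] normalizer_iff[OF fin U] subgroup.mem_carrier[OF P(1)[OF i]] by blast
      then show "p i ^ n i dvd card ?N" using card_subgroup_dvd[OF P(1)[OF i] sN] P(2)[OF i] by simp
    qed (use I cop in auto)
    then have "card (carrier G) \<le> card ?N"
      using finite_subset[OF subgroup.subset[OF sN] fin] subgroup.one_closed[OF sN]
      by (intro dvd_imp_le) (auto simp: order_def card_gt_0_iff)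
    then have "?N = carrier G" by (rule card_seteq[OF fin subgroup.subset[OF sN]])
    then show ?thesis using normalizer_iff[OF fin U] U by (intro normal_invI) auto
  qed
  then show ?thesis unfolding dedekind_group_def using group_axioms by blast
qed

end

section \<open>Comparison of the two bounds\<close>

lemma M_group_d_star_ge:
  assumes "Factorial_Ring.prime p" "n \<ge> 3" "\<not> (p = 2 \<and> n = 3)"
  shows "1 - (real p - 1) / real ((n - 1) * (p + 1) + 2) \<le> d_star (M_group p n)"
proof -
  obtain x y where M: "m_relations (M_group p n) x y p n" using M_group_relations assms by blast
  show ?thesis by (rule m_relations.d_star_ge[OF M assms(3)])
qed

lemma D8_d_star_ge: "4 / 5 \<le> d_star D8"
proof -
  obtain x y where D: "m_relations D8 x y 2 3" using D8_relations by blast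
  show ?thesis by (rule m_relations.d_star_ge_order_8[OF D HOL.refl HOL.refl])
qed

lemma dedekind_if_d_star_gt_M:
  assumes "group F" "Factorial_Ring.prime p" "order F = p ^ n" "n \<ge> 3" "\<not> (p = 2 \<and> n = 3)"
    and "d_star F > d_star (M_group p n)"
  shows "dedekind_group F"
proof (rule ccontr)
  assume "\<not> dedekind_group F"
  from group.non_dedekind_d_star_le(1)[OF assms(1-3) this] M_group_d_star_ge[OF assms(2,4,5)] assms(6)
  show False by linarith
qed

lemma dedekind_if_d_star_gt_D8:
  assumes "group F" "order F = 2 ^ 3" "d_star F > d_star D8"
  shows "dedekind_group F"
proof (rule ccontr)
  assume "\<not> dedekind_group F"
  from group.non_dedekind_d_star_le(2)[OF assms(1) two_is_prime_nat assms(2) this HOL.refl HOL.refl]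
    D8_d_star_ge assms(3)
  show False by linarith
qed

theorem corollary3p7:
  fixes G :: "('a, 'b) monoid_scheme"
    and k :: nat
    and p n :: "nat \<Rightarrow> nat"
    and P :: "nat \<Rightarrow> 'a set"
  assumes "nilpotent_group G"
    and "finite (carrier G)"
    and "k \<ge> 1"
    and "\<forall>i\<in>{1..k}. Factorial_Ring.prime (p i)"
    and "strict_mono_on {1..k} p"
    and "order G = (\<Prod>i=1..k. p i ^ n i)"
    and "\<forall>i\<in>{1..k}. sylow_subgroup G (p i) (P i)"
    and "\<forall>i\<in>{1..k}. card (P i) = p i ^ n i"
    and "\<forall>i\<in>{1..k}. n i \<ge> 3"
  shows
    "(p 1 = 2 \<and> n 1 = 3
        \<and> d_star (G\<lparr>carrier := P 1\<rparr>) > d_star D8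
        \<and> (\<forall>i\<in>{2..k}. d_star (G\<lparr>carrier := P i\<rparr>) > d_star (M_group (p i) (n i)))
      \<longrightarrow> dedekind_group G)
     \<and>
     ((p 1 = 2 \<longrightarrow> n 1 \<ge> 4) \<and> (odd (p 1) \<longrightarrow> n 1 \<ge> 3)
        \<and> (\<forall>i\<in>{1..k}. d_star (G\<lparr>carrier := P i\<rparr>) > d_star (M_group (p i) (n i)))
      \<longrightarrow> dedekind_group G)"
proof -
  let ?F = "\<lambda>i. G\<lparr>carrier := P i\<rparr>"
  have G: "group G" using assms(1) by (simp add: nilpotent_group_def)
  have sub: "subgroup (P i) G" if "i \<in> {1..k}" for i using assms(7) that by (simp add: sylow_subgroup_def)
  have F: "group (?F i)" "order (?F i) = p i ^ n i" if "i \<in> {1..k}" for i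
    using subgroup.subgroup_is_group[OF sub[OF that] G] assms(8) that by (simp_all add: order_def)
  \<comment> \<open>The primes increase strictly, so the exceptional pair \<open>p = 2\<close>,
    \<open>n = 3\<close> can occur only at \<open>i = 1\<close>.\<close>
  have p2: "p i > 2" if "i \<in> {2..k}" for i
  proof -
    have "p 1 < p i" using assms(5) that by (auto simp: strict_mono_on_def)
    moreover have "p 1 \<ge> 2" using assms(3,4) by (auto intro: prime_ge_2_nat)
    ultimately show ?thesis by linarith
  qed
  have M: "dedekind_group (?F i)"
    if "i \<in> {1..k}" "\<not> (p i = 2 \<and> n i = 3)" "d_star (?F i) > d_star (M_group (p i) (n i))" for i
    by (rule dedekind_if_d_star_gt_M[OF F(1)[OF that(1)] _ F(2)[OF that(1)] _ that(2,3)])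
      (use assms(4,9) that(1) in auto)
  have main: "dedekind_group G" if "\<And>i. i \<in> {1..k} \<Longrightarrow> dedekind_group (?F i)"
  proof (rule group.nilpotent_dedekind_sylow[OF G assms(1,2) finite_atLeastAtMost _ _ assms(6) sub _ that])
    show "inj_on p {1..k}" using assms(5) by (rule strict_mono_on_imp_inj_on)
  qed (use assms(4,8) in auto)
  show ?thesis
  proof (intro conjI impI; elim conjE)
    assume n1: "p 1 = 2" "n 1 = 3" and d1: "d_star (?F 1) > d_star D8"
      and d: "\<forall>i\<in>{2..k}. d_star (?F i) > d_star (M_group (p i) (n i))"
    show "dedekind_group G"
    proof (rule main)
      fix i assume i: "i \<in> {1..k}"
      show "dedekind_group (?F i)"
      proof (cases "i = 1")
        case True
        then show ?thesis using dedekind_if_d_star_gt_D8[OF F(1)[OF i]] F(2)[OF i] n1 d1 by simp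
      next
        case False
        then have "i \<in> {2..k}" using i by auto
        then show ?thesis using M[OF i] p2[of i] d by simp
      qed
    qed
  next
    assume n1: "p 1 = 2 \<longrightarrow> n 1 \<ge> 4"
      and d: "\<forall>i\<in>{1..k}. d_star (?F i) > d_star (M_group (p i) (n i))"
    show "dedekind_group G"
    proof (rule main)
      fix i assume i: "i \<in> {1..k}"
      have "\<not> (p i = 2 \<and> n i = 3)"
      proof (cases "i = 1")
        case False
        then have "i \<in> {2..k}" using i by auto
        then show ?thesis using p2[of i] by simp
      qed (use n1 in auto)
      then show "dedekind_group (?F i)" using M[OF i] d i by blast
    qed
  qed
qed

end
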